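(* Let $m\ge2$ be fixed. Let $f$ be the density function of $\sum_{i=1}^{m-1}Y_i$, where $Y_i\sim\mathrm{Exp}(i)$ (rate $i$) are independent. Define functions $h_k$ on $[0,\infty)$ recursively by $h_0(t)=1-e^{-t}$ and, for $k\ge1$, $$h_k(t)=\int_0^t f(s)\Bigl(\bigl(h_{k-1}(t-s)+e^{-(t-s)}\bigr)^m-e^{-m(t-s)}\Bigr)\,ds .$$ Then for every $k\ge0$, as $n\to\infty$, the fraction of nodes of the random $m$-ary search tree $T_n$ with $n$ keys that are $k$-protected converges almost surely to $$P_k=P_k(m)=2\int_0^\infty h_k(t)e^{-t}\,dt .$$ Moreover, for $k\ge1$, $$P_k=\frac2m\int_0^\infty e^{-t}\Bigl(\bigl(h_{k-1}(t)+e^{-t}\bigr)^m-e^{-mt}\Bigr)\,dt .$$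
   Context: $m$-ary search tree: each node holds up to $m-1$ keys (distinct reals). Start with an empty root. The first $m-1$ keys are stored in the root; when the root becomes full, $m$ new empty nodes are added as its children $1,\dots,m$. The $m-1$ keys divide $\mathbb R$ into intervals $J_1,\dots,J_m$; each further key lying in $J_i$ is passed to child $i$, where the same rule is applied recursively. Finally all empty nodes are deleted; the $m$-ary search tree consists of the nodes containing at least one key. $T_n$ is the tree built from the first $n$ terms of an i.i.d. sequence of keys with a continuous distribution. The rank of a node in a rooted tree is the smallest distance to a descendant that is a leaf (a leaf has rank 0). A node is $k$-protected if its rank is at least $k$. *)

theory Defs
  imports "HOL-Probability.Probability"
begin

datatype mtree = Node (node_keys: "real set") (children: "mtree list")

abbreviation empty_node :: mtree where
  "empty_node \<equiv> Node {} []"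

lemma size_nth_less [termination_simp]:
  "i < length ts \<Longrightarrow> size (ts ! i) < Suc (size_list size ts)"
  by (simp add: less_Suc_eq_le size_list_estimation'[OF nth_mem])

text \<open>A key arriving at a full node with key set K is passed to the child whose (0-based) index
  is the number of keys in K below it. In a tree built from distinct keys a full node has exactly
  m children, so the guard \<open>i < length ts\<close> always holds there; it only makes the function total.\<close>

fun insert_key :: "nat \<Rightarrow> real \<Rightarrow> mtree \<Rightarrow> mtree" where
  "insert_key m x (Node K ts) =
    (if card K < m - 1
     then Node (insert x K) (if card (insert x K) = m - 1 then replicate m empty_node else [])
     else let i = card {y \<in> K. y < x}
          in if i < length ts then Node K (ts[i := insert_key m x (ts ! i)]) else Node K ts)"

definition build_tree :: "nat \<Rightarrow> real list \<Rightarrow> mtree" where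
  "build_tree m xs = fold (insert_key m) xs empty_node"

text \<open>Nodes are addressed by the list of child indices on the path from the root.\<close>

primrec subtree_at :: "nat list \<Rightarrow> mtree \<Rightarrow> mtree option" where
  "subtree_at [] t = Some t"
| "subtree_at (i # v) t =
    (if i < length (children t) then subtree_at v (children t ! i) else None)"

definition nonempty_nodes :: "mtree \<Rightarrow> nat list set" where
  "nonempty_nodes t = {v. \<exists>s. subtree_at v t = Some s \<and> node_keys s \<noteq> {}}"

text \<open>The search tree, after deletion of the empty nodes, as a prefix-closed set of addresses.\<close>

definition search_tree :: "nat \<Rightarrow> real list \<Rightarrow> nat list set" where
  "search_tree m xs = nonempty_nodes (build_tree m xs)"

definition is_leaf :: "nat list set \<Rightarrow> nat list \<Rightarrow> bool" where
  "is_leaf T v \<longleftrightarrow> v \<in> T \<and> (\<forall>i. v @ [i] \<notin> T)"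

text \<open>The descendants of v are the nodes \<open>v @ w\<close>, at distance \<open>length w\<close> from v.\<close>

definition node_rank :: "nat list set \<Rightarrow> nat list \<Rightarrow> nat" where
  "node_rank T v = (LEAST d. \<exists>w. is_leaf T (v @ w) \<and> length w = d)"

definition k_protected :: "nat \<Rightarrow> nat list set \<Rightarrow> nat list \<Rightarrow> bool" where
  "k_protected k T v \<longleftrightarrow> k \<le> node_rank T v"

definition protected_fraction :: "nat \<Rightarrow> nat list set \<Rightarrow> real" where
  "protected_fraction k T = real (card {v \<in> T. k_protected k T v}) / real (card T)"

primrec protect_h :: "nat \<Rightarrow> (real \<Rightarrow> real) \<Rightarrow> nat \<Rightarrow> real \<Rightarrow> real" where
  "protect_h m f 0 = (\<lambda>t. 1 - exp (- t))"
| "protect_h m f (Suc k) = (\<lambda>t. LBINT s:{0..t}.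
      f s * ((protect_h m f k (t - s) + exp (- (t - s))) ^ m - exp (- (real m * (t - s)))))"

definition protect_P :: "nat \<Rightarrow> (real \<Rightarrow> real) \<Rightarrow> nat \<Rightarrow> real" where
  "protect_P m f k = 2 * (LBINT t:{0..}. protect_h m f k t * exp (- t))"

end

theory Submission imports Defs "HOL-Real_Asymp.Real_Asymp" begin

text \<open>The ranks of i.i.d. continuous keys are uniform, so the tree grows by inserting each new key into a
  uniformly chosen gap. For a function \<open>\<phi>\<close> on shapes, the sum of \<open>\<phi>\<close> over the nodes whose
  subtree holds s keys has a linear drift that involves only the classes s and s - 1. Hence, once the
  number of empty nodes is known to be asymptotically linear (a Lyapunov argument for the cyclic
  dynamics of the nodes that are not full), all these sums, divided by n, converge in mean square at a
  polynomial rate by induction on s. As they have bounded increments, Borel-Cantelli along \<open>n = j ^ q\<close>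
  gives almost sure convergence, and the limiting fraction of nodes whose subtree holds \<open>s \<ge> 1\<close> keys is
  2 / ((s + 1) (s + 2)). So the fraction of k-protected nodes tends to
  \<open>\<Sum>s. 2 / ((s + 1) (s + 2)) * p k s\<close>, where \<open>p k s\<close> is the probability that the root of a random tree
  with s keys is k-protected. Finally \<open>h\<^sub>k(t) = e\<^sup>-\<^sup>t \<Sum>s. p k s * (1 - e\<^sup>-\<^sup>t) ^ s\<close>, because both sides satisfy
  the same recursion in k; Beta integrals turn this into both formulas for \<open>P\<^sub>k\<close>.\<close>

section \<open>Tree shapes and their drift\<close>

text \<open>The weight \<open>2 / ((s + 1) * (s + 2))\<close> is forced by the drift. A tree with s
  - 1 keys has s gaps, class s is left at rate s + 1, and linear growth costs one more, so the
  densities satisfy (s + 2) c_s = s c_(s-1). This says nothing about c_0: empty nodes are born when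
  a node of class m - 2 fills up, so the classes 0, ..., m - 2 feed each other in a cycle, and only
  this cycle needs the Lyapunov argument. No spectral analysis of the cycle is made, because any
  mean square exponent below 2 suffices. The value of c_0 cancels in the end: nonempty nodes are
  born exactly when a key enters an empty node, so both kinds have the same density. Protection
  depends on subtrees of unbounded size, so the sums over all nodes are truncated at S keys; few
  nodes are lost, as the weights over s \<ge> 1 add up to 1.\<close>

lemma sum_list_list_update:
  fixes xs :: "'a list" and g :: "'a \<Rightarrow> 'b::ab_group_add"
  assumes "i < length xs"
  shows "(\<Sum>x\<leftarrow>xs[i := y]. g x) = (\<Sum>x\<leftarrow>xs. g x) - g (xs ! i) + g y"
  using assms
proof (induction xs arbitrary: i)
  case (Cons a xs) then show ?case by (cases i) (auto simp: algebra_simps)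
qed simp

lemma sum_list_list_update_nat:
  fixes g :: "'a \<Rightarrow> nat"
  assumes "i < length xs"
  shows "(\<Sum>x\<leftarrow>xs[i := y]. g x) + g (xs ! i) = (\<Sum>x\<leftarrow>xs. g x) + g y"
  using assms
proof (induction xs arbitrary: i)
  case (Cons a xs) then show ?case by (cases i) (auto simp: algebra_simps)
qed simp

lemma sum_list_concat: "sum_list (concat xss) = (\<Sum>xs\<leftarrow>xss. sum_list xs)"
  by (induction xss) auto

lemma sum_list_zero_map: "(\<And>t. t \<in> set ts \<Longrightarrow> g t = (0 :: real)) \<Longrightarrow> (\<Sum>t\<leftarrow>ts. g t) = 0"
  by (induction ts) auto

text \<open>The shape of a search tree: \<open>Part j\<close> is a node with \<open>j < m - 1\<close> keys, \<open>Full ts\<close> a full node with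
  its m children, empty ones included.\<close>

datatype shape = Part nat | Full "shape list"

locale search_tree_arity =
  fixes m :: nat
  assumes m2: "2 \<le> m"
begin

definition grow :: "nat \<Rightarrow> shape" where
  "grow j = (if Suc (Suc j) < m then Part (Suc j) else Full (replicate m (Part 0)))"

text \<open>The insertions into all gaps, from left to right, so that the entry at index r is the effect of
  a new key that exceeds exactly r of the old ones.\<close>

fun succs :: "shape \<Rightarrow> shape list" where
  "succs (Part j) = replicate (Suc j) (grow j)"
| "succs (Full ts) =
    concat (map (\<lambda>i. map (\<lambda>x. Full (ts[i := x])) (succs (ts ! i))) [0..<length ts])"

fun keys :: "shape \<Rightarrow> nat" where
  "keys (Part j) = j"
| "keys (Full ts) = m - 1 + (\<Sum>t\<leftarrow>ts. keys t)"

fun wf_shape :: "shape \<Rightarrow> bool" where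
  "wf_shape (Part j) \<longleftrightarrow> Suc j < m"
| "wf_shape (Full ts) \<longleftrightarrow> length ts = m \<and> (\<forall>t\<in>set ts. wf_shape t)"

fun node_sum :: "(shape \<Rightarrow> real) \<Rightarrow> shape \<Rightarrow> real" where
  "node_sum \<phi> (Part j) = \<phi> (Part j)"
| "node_sum \<phi> (Full ts) = \<phi> (Full ts) + (\<Sum>t\<leftarrow>ts. node_sum \<phi> t)"

text \<open>For a tree with n keys, \<open>up \<phi> t / (n + 1)\<close> is the conditional mean of
  \<phi> after one more uniformly placed key. Using the sum instead of the mean keeps the
  coefficients of the drift independent of n.\<close>

definition up :: "(shape \<Rightarrow> real) \<Rightarrow> shape \<Rightarrow> real" where
  "up \<phi> t = (\<Sum>x\<leftarrow>succs t. \<phi> x)"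

lemma up_Part: "up \<phi> (Part j) = real (Suc j) * \<phi> (grow j)"
  by (simp add: up_def sum_list_replicate algebra_simps)

lemma up_Full: "up \<phi> (Full ts) = (\<Sum>i<length ts. up (\<lambda>x. \<phi> (Full (ts[i := x]))) (ts ! i))"
  unfolding up_def succs.simps map_concat sum_list_concat
  by (simp add: comp_def interv_sum_list_conv_sum_set_nat atLeast0LessThan)

lemma wf_grow: "wf_shape (Part j) \<Longrightarrow> wf_shape (grow j)"
  using m2 by (auto simp: grow_def)

lemma keys_grow: "wf_shape (Part j) \<Longrightarrow> keys (grow j) = Suc j"
  using m2 by (auto simp: grow_def sum_list_replicate)

lemma succs_FullE:
  assumes "x \<in> set (succs (Full ts))"
  obtains i y where "i < length ts" "y \<in> set (succs (ts ! i))" "x = Full (ts[i := y])"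
  using assms by auto

lemma succs_wf_keys:
  "wf_shape t \<Longrightarrow> x \<in> set (succs t) \<Longrightarrow> wf_shape x \<and> keys x = Suc (keys t)"
proof (induction t arbitrary: x)
  case (Part j)
  then show ?case using wf_grow keys_grow by auto
next
  case (Full ts)
  obtain i y where iy: "i < length ts" "y \<in> set (succs (ts ! i))" "x = Full (ts[i := y])"
    using Full.prems(2) by (rule succs_FullE)
  have y: "wf_shape y \<and> keys y = Suc (keys (ts ! i))"
    using Full.prems(1) iy by (intro Full.IH[OF nth_mem]) simp_all
  have "wf_shape x"
    using y iy Full.prems(1) set_update_subset_insert[of ts i y] by auto
  moreover have "keys x = Suc (keys (Full ts))"
    using y iy sum_list_list_update_nat[OF iy(1), of keys y] by simp
  ultimately show ?case by simp
qed

lemma succs_keys: "wf_shape t \<Longrightarrow> x \<in> set (succs t) \<Longrightarrow> keys x = Suc (keys t)"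
  using succs_wf_keys by blast

lemma length_succs: "wf_shape t \<Longrightarrow> length (succs t) = Suc (keys t)"
proof (induction t)
  case (Full ts)
  have "length (succs (Full ts)) = (\<Sum>i<length ts. length (succs (ts ! i)))"
    by (simp add: length_concat comp_def interv_sum_list_conv_sum_set_nat atLeast0LessThan)
  also have "\<dots> = (\<Sum>i<length ts. Suc (keys (ts ! i)))"
    using Full by (intro sum.cong) auto
  also have "\<dots> = length ts + (\<Sum>i<length ts. keys (ts ! i))"
    using sum.distrib[of "\<lambda>_. 1" "\<lambda>i. keys (ts ! i)" "{..<length ts}"] by simp
  also have "\<dots> = Suc (keys (Full ts))"
    using Full.prems m2 by (simp add: sum_list_sum_nth atLeast0LessThan)
  finally show ?case .
qed simp

lemma up_add: "up (\<lambda>x. \<phi> x + \<psi> x) t = up \<phi> t + up \<psi> t"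
  by (simp add: up_def sum_list_addf)

lemma up_diff: "up (\<lambda>x. \<phi> x - \<psi> x) t = up \<phi> t - up \<psi> t"
  by (simp add: up_def sum_list_subtractf)

lemma up_const: "wf_shape t \<Longrightarrow> up (\<lambda>x. c) t = real (Suc (keys t)) * c"
  by (simp add: up_def length_succs sum_list_triv algebra_simps del: of_nat_Suc)

lemma up_cmult: "up (\<lambda>x. c * \<phi> x) t = c * up \<phi> t"
  by (simp add: up_def sum_list_const_mult)

lemma up_mono:
  "(\<And>x. x \<in> set (succs t) \<Longrightarrow> \<phi> x \<le> \<psi> x) \<Longrightarrow> up \<phi> t \<le> up \<psi> t"
  unfolding up_def by (rule sum_list_mono)

lemma up_cong:
  "(\<And>x. x \<in> set (succs t) \<Longrightarrow> \<phi> x = \<psi> x) \<Longrightarrow> up \<phi> t = up \<psi> t"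
  unfolding up_def by (metis map_cong)

lemma node_sum_Full_nth:
  "node_sum \<phi> (Full ts) = \<phi> (Full ts) + (\<Sum>i<length ts. node_sum \<phi> (ts ! i))"
  by (simp add: sum_list_sum_nth atLeast0LessThan)

text \<open>A new key alters only the subtrees of the nodes on its search path, and over all gaps
  each subtree undergoes exactly its own insertions; this gives the first term. The second term is
  the birth of nodes: each of the m - 1 gaps of a \<open>Part (m - 2)\<close> creates m empty
  children.\<close>

lemma node_sum_generator:
  assumes "wf_shape t"
  shows "up (\<lambda>x. node_sum \<phi> x - node_sum \<phi> t) t =
    node_sum (\<lambda>u. up (\<lambda>x. \<phi> x - \<phi> u) u) t
    + real m * \<phi> (Part 0) * real (m - 1) * node_sum (\<lambda>u. of_bool (u = Part (m - 2))) t"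
  using assms
proof (induction t)
  case (Part j)
  show ?case
  proof (cases "Suc (Suc j) < m")
    case True
    then have "j \<noteq> m - 2" by linarith
    then show ?thesis using True by (simp add: up_Part grow_def)
  next
    case False
    then have j: "m - 2 = j" "m - 1 = Suc j" using Part by simp_all
    have g: "grow j = Full (replicate m (Part 0))" using False by (simp add: grow_def)
    show ?thesis
      by (simp add: up_Part g j[unfolded One_nat_def] sum_list_replicate algebra_simps)
  qed
next
  case (Full ts)
  let ?c = "real m * \<phi> (Part 0) * real (m - 1)"
  let ?K = "\<lambda>u. of_bool (u = Part (m - 2)) :: real"
  have upd: "node_sum \<phi> (Full (ts[i := x])) - node_sum \<phi> (Full ts)
      = (\<phi> (Full (ts[i := x])) - \<phi> (Full ts)) + (node_sum \<phi> x - node_sum \<phi> (ts ! i))"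
    if "i < length ts" for i x
    using sum_list_list_update[OF that, of "node_sum \<phi>" x] by simp
  have "up (\<lambda>x. node_sum \<phi> x - node_sum \<phi> (Full ts)) (Full ts)
      = (\<Sum>i<length ts. up (\<lambda>x. \<phi> (Full (ts[i := x])) - \<phi> (Full ts)) (ts ! i)
          + up (\<lambda>x. node_sum \<phi> x - node_sum \<phi> (ts ! i)) (ts ! i))"
    unfolding up_Full by (intro sum.cong refl) (simp add: upd up_add del: node_sum.simps)
  also have "\<dots> = up (\<lambda>x. \<phi> x - \<phi> (Full ts)) (Full ts)
      + (\<Sum>i<length ts. up (\<lambda>x. node_sum \<phi> x - node_sum \<phi> (ts ! i)) (ts ! i))"
    by (simp add: sum.distrib up_Full)
  also have "(\<Sum>i<length ts. up (\<lambda>x. node_sum \<phi> x - node_sum \<phi> (ts ! i)) (ts ! i))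
     = (\<Sum>i<length ts. node_sum (\<lambda>u. up (\<lambda>x. \<phi> x - \<phi> u) u) (ts ! i) + ?c * node_sum ?K (ts ! i))"
    using Full by (intro sum.cong refl) auto
  finally show ?case
    by (simp add: node_sum_Full_nth sum.distrib sum_distrib_left del: node_sum.simps)
qed

lemma node_sum_cong:
  assumes "\<And>u. wf_shape u \<Longrightarrow> \<phi> u = \<psi> u" "wf_shape t"
  shows "node_sum \<phi> t = node_sum \<psi> t"
  using assms(2) by (induction t) (auto simp: assms(1) intro!: arg_cong[of _ _ sum_list] map_cong)

lemma node_sum_add: "node_sum (\<lambda>u. \<phi> u + \<psi> u) t = node_sum \<phi> t + node_sum \<psi> t"
proof (induction t)
  case (Full ts)
  then have "map (node_sum (\<lambda>u. \<phi> u + \<psi> u)) ts = map (\<lambda>t. node_sum \<phi> t + node_sum \<psi> t) ts" by auto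
  then show ?case by (simp only: node_sum.simps sum_list_addf add_ac)
qed simp

lemma node_sum_cmult: "node_sum (\<lambda>u. c * \<phi> u) t = c * node_sum \<phi> t"
proof (induction t)
  case (Full ts)
  then have "map (node_sum (\<lambda>u. c * \<phi> u)) ts = map (\<lambda>t. c * node_sum \<phi> t) ts" by auto
  then show ?case by (simp only: node_sum.simps sum_list_const_mult distrib_left)
qed simp

lemma node_sum_mono:
  assumes "\<And>u. wf_shape u \<Longrightarrow> \<phi> u \<le> \<psi> u" "wf_shape t"
  shows "node_sum \<phi> t \<le> node_sum \<psi> t"
  using assms(2)
proof (induction t)
  case (Full ts)
  then show ?case
    using assms(1)[OF Full.prems] sum_list_mono[of ts "node_sum \<phi>" "node_sum \<psi>"] by simp
qed (simp add: assms(1))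

lemma node_sum_zero: "node_sum (\<lambda>u. 0) t = 0"
  using node_sum_cmult[of 0 "\<lambda>u. 0"] by simp

lemma node_sum_sum: "node_sum (\<lambda>u. \<Sum>i\<in>I. \<phi> i u) t = (\<Sum>i\<in>I. node_sum (\<phi> i) t)"
  by (induction I rule: infinite_finite_induct) (auto simp: node_sum_add node_sum_zero)

section \<open>Node sums over one size class\<close>

definition at_size :: "nat \<Rightarrow> (shape \<Rightarrow> real) \<Rightarrow> shape \<Rightarrow> real" where
  "at_size s \<phi> u = (if keys u = s then \<phi> u else 0)"

text \<open>Strict because a full node stores \<open>m - 1 \<ge> 1\<close> keys itself. Hence nodes
  of one size class are never nested.\<close>

lemma keys_child_less:
  assumes "wf_shape (Full ts)" "t \<in> set ts"
  shows "keys t < keys (Full ts)"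
  using assms m2 member_le_sum_list[of "keys t" "map keys ts"] by auto

lemma node_sum_at_size_above:
  "wf_shape t \<Longrightarrow> keys t < s \<Longrightarrow> node_sum (at_size s \<phi>) t = 0"
proof (induction t)
  case (Full ts)
  have "node_sum (at_size s \<phi>) t = 0" if "t \<in> set ts" for t
    using Full that keys_child_less[OF Full.prems(1) that] by auto
  then have "(\<Sum>t\<leftarrow>ts. node_sum (at_size s \<phi>) t) = 0" by (rule sum_list_zero_map)
  moreover have "at_size s \<phi> (Full ts) = 0" using Full.prems(2) by (simp only: at_size_def) simp
  ultimately show ?case by simp
qed (simp add: at_size_def)

lemma node_sum_at_size_eq:
  assumes "wf_shape t" "keys t = s"
  shows "node_sum (at_size s \<phi>) t = \<phi> t"
proof (cases t)
  case (Full ts)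
  have "node_sum (at_size s \<phi>) t = 0" if "t \<in> set ts" for t
    using assms Full that keys_child_less[of ts t] by (intro node_sum_at_size_above) auto
  then have "(\<Sum>t\<leftarrow>ts. node_sum (at_size s \<phi>) t) = 0" by (rule sum_list_zero_map)
  moreover have "at_size s \<phi> (Full ts) = \<phi> t" using Full assms(2) by (simp only: at_size_def) simp
  ultimately show ?thesis using Full by simp
qed (use assms in \<open>auto simp: at_size_def\<close>)

lemma node_sum_at_size_le:
  assumes "wf_shape t" "keys t \<le> s" "\<And>u. \<bar>\<phi> u\<bar> \<le> b"
  shows "\<bar>node_sum (at_size s \<phi>) t\<bar> \<le> b"
proof -
  have "0 \<le> b" using assms(3)[of t] by linarith
  then show ?thesis
    using assms node_sum_at_size_above[OF assms(1), of s \<phi>] node_sum_at_size_eq[OF assms(1), of s \<phi>]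
    by (cases "keys t = s") auto
qed

definition bounded_incr :: "(shape \<Rightarrow> real) \<Rightarrow> bool" where
  "bounded_incr G \<longleftrightarrow> (\<exists>B. \<forall>t x. wf_shape t \<longrightarrow> x \<in> set (succs t) \<longrightarrow> \<bar>G x - G t\<bar> \<le> B)"

text \<open>Subtree sizes strictly decrease along the search path, so at most one node leaves class
  s and at most one existing node enters it; a node that fills up adds at most m empty
  children.\<close>

lemma node_sum_at_size_incr:
  assumes "wf_shape t" "x \<in> set (succs t)" and b: "\<And>u. \<bar>\<phi> u\<bar> \<le> b"
  shows "\<bar>node_sum (at_size s \<phi>) x - node_sum (at_size s \<phi>) t\<bar> \<le> (real m + 2) * b"
  using assms(1,2)
proof (induction t arbitrary: x)
  have b0: "0 \<le> b" using b[of "Part 0"] by linarith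
  have a: "\<bar>at_size s \<phi> u\<bar> \<le> b" for u using b[of u] b0 by (simp add: at_size_def)
  {
    case (Part j)
    have "\<bar>node_sum (at_size s \<phi>) x\<bar> \<le> (real m + 1) * b"
    proof (cases "Suc (Suc j) < m")
      case True
      then have "\<bar>node_sum (at_size s \<phi>) x\<bar> \<le> b" using Part a by (auto simp: grow_def)
      moreover have "0 \<le> real m * b" using b0 by simp
      moreover have "(real m + 1) * b = real m * b + b" by (simp add: distrib_right)
      ultimately show ?thesis by linarith
    next
      case False
      then have "node_sum (at_size s \<phi>) x
          = at_size s \<phi> (Full (replicate m (Part 0))) + real m * at_size s \<phi> (Part 0)"
        using Part by (auto simp: grow_def sum_list_replicate)
      moreover have "\<bar>real m * at_size s \<phi> (Part 0)\<bar> \<le> real m * b"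
        using a[of "Part 0"] by (simp add: abs_mult mult_left_mono)
      ultimately show ?thesis using a[of "Full (replicate m (Part 0))"]
        by (simp add: distrib_right)
    qed
    moreover have "\<bar>node_sum (at_size s \<phi>) (Part j)\<bar> \<le> b" using a by simp
    ultimately show ?case by (simp add: distrib_right)
  next
    case (Full ts)
    obtain i y where iy: "i < length ts" "y \<in> set (succs (ts ! i))" "x = Full (ts[i := y])"
      using Full.prems(2) by (rule succs_FullE)
    have wfi: "wf_shape (ts ! i)" using Full.prems iy by auto
    have wx: "wf_shape x" and kx: "keys x = Suc (keys (Full ts))"
      using succs_wf_keys Full.prems by blast+
    have ky: "wf_shape y" "keys y = Suc (keys (ts ! i))" using succs_wf_keys wfi iy by blast+
    have diff: "node_sum (at_size s \<phi>) x - node_sum (at_size s \<phi>) (Full ts)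
        = at_size s \<phi> x - at_size s \<phi> (Full ts)
          + (node_sum (at_size s \<phi>) y - node_sum (at_size s \<phi>) (ts ! i))"
      using sum_list_list_update[OF iy(1), of "node_sum (at_size s \<phi>)" y] iy(3) by simp
    have b2: "2 * b \<le> (real m + 2) * b" using b0 by (simp add: distrib_right)
    consider "keys (Full ts) > s" | "keys (Full ts) = s" | "keys (Full ts) < s" by linarith
    then show ?case
    proof cases
      case 1
      then have "at_size s \<phi> x = 0" "at_size s \<phi> (Full ts) = 0" using kx by (auto simp: at_size_def)
      then show ?thesis using diff Full.IH[OF _ wfi iy(2)] iy(1) by simp
    next
      case 2
      have less: "keys (ts ! i) < s" using keys_child_less[OF Full.prems(1), of "ts ! i"] iy 2 by simp
      then have "node_sum (at_size s \<phi>) (ts ! i) = 0" by (rule node_sum_at_size_above[OF wfi])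
      moreover have "\<bar>node_sum (at_size s \<phi>) y\<bar> \<le> b"
        using node_sum_at_size_le[OF ky(1) _ b] less ky by simp
      moreover have "at_size s \<phi> x = 0" using kx 2 by (simp add: at_size_def del: keys.simps)
      ultimately show ?thesis using diff a[of "Full ts"] b2 by linarith
    next
      case 3
      then have "node_sum (at_size s \<phi>) (Full ts) = 0"
        by (rule node_sum_at_size_above[OF Full.prems(1)])
      moreover have "\<bar>node_sum (at_size s \<phi>) x\<bar> \<le> b"
        using node_sum_at_size_le[OF wx _ b] 3 kx by simp
      ultimately show ?thesis using b2 b0 by linarith
    qed
  }
qed

lemma bounded_incr_at_size:
  assumes "\<And>u. \<bar>\<phi> u\<bar> \<le> b"
  shows "bounded_incr (node_sum (at_size s \<phi>))"
  unfolding bounded_incr_def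
  by (intro exI[of _ "(real m + 2) * b"] allI impI node_sum_at_size_incr assms)

definition nonempty_count :: "shape \<Rightarrow> real" where
  "nonempty_count = node_sum (\<lambda>u. of_bool (1 \<le> keys u))"

text \<open>A key changes this count only by entering an empty node. All positive sizes occur in the
  sum, so the bound for a single size class does not apply.\<close>

lemma bounded_incr_nonempty_count: "bounded_incr nonempty_count"
proof -
  have "\<bar>nonempty_count x - nonempty_count t\<bar> \<le> 1" if "wf_shape t" "x \<in> set (succs t)" for t x
    using that
  proof (induction t arbitrary: x)
    case (Part j)
    then show ?case using m2
      by (auto simp: nonempty_count_def grow_def sum_list_replicate)
  next
    case (Full ts)
    obtain i y where iy: "i < length ts" "y \<in> set (succs (ts ! i))" "x = Full (ts[i := y])"
      using Full.prems(2) by (rule succs_FullE)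
    have "nonempty_count x - nonempty_count (Full ts) = nonempty_count y - nonempty_count (ts ! i)"
      using sum_list_list_update[OF iy(1), of nonempty_count y] iy(3) m2 succs_keys[OF Full.prems]
      by (simp add: nonempty_count_def)
    then show ?case using Full.IH[OF _ _ iy(2)] Full.prems iy(1) by simp
  qed
  then show ?thesis unfolding bounded_incr_def by blast
qed

section \<open>Drift of the node counts\<close>

lemma wf_keys_small:
  assumes "wf_shape u" "Suc j < m"
  shows "keys u = j \<longleftrightarrow> u = Part j"
  using assms by (cases u) auto

text \<open>A node leaves size class s at rate s + 1 and is entered from class s - 1.\<close>

lemma drift_at_size:
  assumes "wf_shape t" "1 \<le> s"
  shows "up (\<lambda>x. node_sum (at_size s \<phi>) x - node_sum (at_size s \<phi>) t) t
    = node_sum (at_size (s - 1) (up \<phi>)) t - real (Suc s) * node_sum (at_size s \<phi>) t"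
proof -
  have *: "up (\<lambda>x. at_size s \<phi> x - at_size s \<phi> u) u
      = at_size (s - 1) (up \<phi>) u + (- real (Suc s)) * at_size s \<phi> u" if "wf_shape u" for u
  proof -
    have w: "real (Suc (keys u)) * at_size s \<phi> u = real (Suc s) * at_size s \<phi> u"
      by (simp add: at_size_def)
    have "up (at_size s \<phi>) u = at_size (s - 1) (up \<phi>) u"
    proof (cases "keys u = s - 1")
      case True
      then have "at_size s \<phi> x = \<phi> x" if "x \<in> set (succs u)" for x
        using succs_keys[OF \<open>wf_shape u\<close> that] assms(2) by (simp add: at_size_def)
      then show ?thesis using True up_cong[of u "at_size s \<phi>" \<phi>] by (simp add: at_size_def)
    next
      case False
      then have "at_size s \<phi> x = 0" if "x \<in> set (succs u)" for x
        using succs_keys[OF \<open>wf_shape u\<close> that] by (auto simp: at_size_def)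
      then show ?thesis using False up_cong[of u "at_size s \<phi>" "\<lambda>_. 0"]
        by (simp add: at_size_def up_def)
    qed
    then show ?thesis unfolding up_diff up_const[OF that] using w by linarith
  qed
  \<comment> \<open>Newborn empty nodes lie outside class s because s is positive, so the birth term
    of the generator vanishes.\<close>
  have z: "at_size s \<phi> (Part 0) = 0" using assms(2) by (simp add: at_size_def)
  have "node_sum (\<lambda>u. up (\<lambda>x. at_size s \<phi> x - at_size s \<phi> u) u) t
      = node_sum (at_size (s - 1) (up \<phi>)) t + (- real (Suc s)) * node_sum (at_size s \<phi>) t"
    unfolding node_sum_add[symmetric] node_sum_cmult[symmetric]
    by (rule node_sum_cong[OF * assms(1)])
  then show ?thesis unfolding node_sum_generator[OF assms(1)] z by (simp del: of_nat_Suc)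
qed

text \<open>This equation closes the cycle: each of the m - 1 gaps of a \<open>Part (m - 2)\<close>
  yields m empty nodes, while an empty node is lost through its single gap.\<close>

lemma drift_empty:
  assumes "wf_shape t"
  shows "up (\<lambda>x. node_sum (at_size 0 (\<lambda>_. 1)) x - node_sum (at_size 0 (\<lambda>_. 1)) t) t
    = real m * real (m - 1) * node_sum (at_size (m - 2) (\<lambda>_. 1)) t - node_sum (at_size 0 (\<lambda>_. 1)) t"
proof -
  have *: "up (\<lambda>x. at_size 0 (\<lambda>_. 1) x - at_size 0 (\<lambda>_. 1) u) u = (- 1) * at_size 0 (\<lambda>_. 1) u"
    if "wf_shape u" for u
  proof -
    have "up (at_size 0 (\<lambda>_. 1)) u = up (\<lambda>_. 0) u"
      using succs_keys[OF that] by (intro up_cong) (auto simp: at_size_def)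
    then have "up (at_size 0 (\<lambda>_. 1)) u = 0" by (simp add: up_def)
    moreover have "real (Suc (keys u)) * at_size 0 (\<lambda>_. 1) u = at_size 0 (\<lambda>_. 1) u"
      by (simp add: at_size_def)
    ultimately show ?thesis unfolding up_diff up_const[OF that] by simp
  qed
  have "node_sum (\<lambda>u. of_bool (u = Part (m - 2))) t = node_sum (at_size (m - 2) (\<lambda>_. 1)) t"
    using wf_keys_small[of _ "m - 2"] m2 by (intro node_sum_cong[OF _ assms]) (auto simp: at_size_def)
  moreover have "node_sum (\<lambda>u. up (\<lambda>x. at_size 0 (\<lambda>_. 1) x - at_size 0 (\<lambda>_. 1) u) u) t
      = (- 1) * node_sum (at_size 0 (\<lambda>_. 1)) t"
    unfolding node_sum_cmult[symmetric] by (rule node_sum_cong[OF * assms])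
  ultimately show ?thesis unfolding node_sum_generator[OF assms]
    by (simp add: at_size_def)
qed

text \<open>Nonempty nodes arise only from keys that enter empty nodes, and an empty node has one
  gap.\<close>

lemma drift_nonempty_count:
  assumes "wf_shape t"
  shows "up (\<lambda>x. nonempty_count x - nonempty_count t) t = node_sum (at_size 0 (\<lambda>_. 1)) t"
proof -
  have *: "up (\<lambda>x. of_bool (1 \<le> keys x) - of_bool (1 \<le> keys u)) u = at_size 0 (\<lambda>_. 1) u"
    if "wf_shape u" for u
  proof -
    have "up (\<lambda>x. of_bool (1 \<le> keys x) - of_bool (1 \<le> keys u)) u = up (\<lambda>_. 1 - of_bool (1 \<le> keys u)) u"
      using succs_keys[OF that] by (intro up_cong) auto
    then show ?thesis by (simp add: up_const that at_size_def)
  qed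
  show ?thesis unfolding nonempty_count_def node_sum_generator[OF assms]
    using node_sum_cong[OF * assms] by simp
qed

text \<open>Gaps live only in nodes that are not full, j + 1 of them in a node with j keys.\<close>

lemma gap_count:
  assumes "wf_shape t"
  shows "(\<Sum>j<m - 1. real (Suc j) * node_sum (at_size j (\<lambda>_. 1)) t) = real (Suc (keys t))"
proof -
  have *: "(\<Sum>j<m - 1. real (Suc j) * at_size j (\<lambda>_. 1) u)
      = (case u of Part j \<Rightarrow> real (Suc j) | Full ts \<Rightarrow> 0)" if "wf_shape u" for u
  proof (cases u)
    case (Part j)
    then have "(\<Sum>j<m - 1. real (Suc j) * at_size j (\<lambda>_. 1) u)
        = (\<Sum>i<m - 1. if i = j then real (Suc i) else 0)"
      by (intro sum.cong) (auto simp: at_size_def)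
    then show ?thesis using Part that by simp
  next
    case (Full ts)
    then show ?thesis by (auto intro!: sum.neutral simp: at_size_def)
  qed
  have "node_sum (\<lambda>u. case u of Part j \<Rightarrow> real (Suc j) | Full ts \<Rightarrow> 0) t = real (Suc (keys t))"
    using assms
  proof (induction t)
    case (Full ts)
    then have "node_sum (\<lambda>u. case u of Part j \<Rightarrow> real (Suc j) | Full ts \<Rightarrow> 0) (Full ts)
      = (\<Sum>i<length ts. real (Suc (keys (ts ! i))))"
      unfolding node_sum_Full_nth by (auto intro!: sum.cong)
    also have "\<dots> = real (length ts) + (\<Sum>i<length ts. real (keys (ts ! i)))"
      by (simp add: sum.distrib)
    also have "\<dots> = real (Suc (keys (Full ts)))"
      using Full.prems m2 by (simp add: sum_list_sum_nth atLeast0LessThan of_nat_diff)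
    finally show ?case .
  qed simp
  then show ?thesis
    unfolding node_sum_cmult[symmetric] node_sum_sum[symmetric]
    using node_sum_cong[OF * assms] by simp
qed

text \<open>The list has one entry per insertion history, hence n! entries, all equally likely.\<close>

primrec shapes :: "nat \<Rightarrow> shape list" where
  "shapes 0 = [Part 0]"
| "shapes (Suc n) = concat (map succs (shapes n))"

lemma shapes_wf_keys: "t \<in> set (shapes n) \<Longrightarrow> wf_shape t \<and> keys t = n"
  using m2 by (induction n arbitrary: t) (auto dest: succs_wf_keys)

lemma length_shapes: "length (shapes n) = fact n"
proof (induction n)
  case (Suc n)
  have "(\<Sum>t\<leftarrow>shapes n. length (succs t)) = (\<Sum>t\<leftarrow>shapes n. Suc n)"
    using shapes_wf_keys length_succs by (intro arg_cong[of _ _ sum_list] map_cong) auto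
  then show ?case using Suc by (simp add: length_concat comp_def sum_list_triv)
qed simp

section \<open>Expectations over a uniform insertion history\<close>

definition shape_sum :: "nat \<Rightarrow> (shape \<Rightarrow> real) \<Rightarrow> real" where
  "shape_sum n \<Phi> = (\<Sum>t\<leftarrow>shapes n. \<Phi> t)"

definition shape_mean :: "nat \<Rightarrow> (shape \<Rightarrow> real) \<Rightarrow> real" where
  "shape_mean n \<Phi> = shape_sum n \<Phi> / fact n"

lemma shape_sum_0: "shape_sum 0 \<Phi> = \<Phi> (Part 0)"
  by (simp add: shape_sum_def)

lemma shape_sum_Suc: "shape_sum (Suc n) \<Phi> = shape_sum n (up \<Phi>)"
  by (simp add: shape_sum_def up_def[abs_def] map_concat sum_list_concat comp_def)

lemma shape_mean_Suc: "real (Suc n) * shape_mean (Suc n) \<Phi> = shape_mean n (up \<Phi>)"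
  by (simp add: shape_mean_def shape_sum_Suc del: of_nat_Suc)

lemma shape_sum_mono:
  "(\<And>t. wf_shape t \<Longrightarrow> keys t = n \<Longrightarrow> \<Phi> t \<le> \<Psi> t) \<Longrightarrow> shape_sum n \<Phi> \<le> shape_sum n \<Psi>"
  unfolding shape_sum_def using shapes_wf_keys by (intro sum_list_mono) auto

lemma shape_sum_cong:
  "(\<And>t. wf_shape t \<Longrightarrow> keys t = n \<Longrightarrow> \<Phi> t = \<Psi> t) \<Longrightarrow> shape_sum n \<Phi> = shape_sum n \<Psi>"
  by (intro antisym shape_sum_mono) auto

lemma shape_mean_mono:
  "(\<And>t. wf_shape t \<Longrightarrow> keys t = n \<Longrightarrow> \<Phi> t \<le> \<Psi> t) \<Longrightarrow> shape_mean n \<Phi> \<le> shape_mean n \<Psi>"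
  unfolding shape_mean_def by (intro divide_right_mono shape_sum_mono) auto

lemma shape_mean_cong:
  "(\<And>t. wf_shape t \<Longrightarrow> keys t = n \<Longrightarrow> \<Phi> t = \<Psi> t) \<Longrightarrow> shape_mean n \<Phi> = shape_mean n \<Psi>"
  by (intro antisym shape_mean_mono) auto

lemma shape_mean_const: "shape_mean n (\<lambda>_. c) = c"
  by (simp add: shape_mean_def shape_sum_def sum_list_triv length_shapes)

lemma shape_mean_add: "shape_mean n (\<lambda>t. \<Phi> t + \<Psi> t) = shape_mean n \<Phi> + shape_mean n \<Psi>"
  by (simp add: shape_mean_def shape_sum_def sum_list_addf add_divide_distrib)

lemma shape_mean_cmult: "shape_mean n (\<lambda>t. c * \<Phi> t) = c * shape_mean n \<Phi>"
  by (simp add: shape_mean_def shape_sum_def sum_list_const_mult)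

end

section \<open>Mean square convergence of node counts\<close>

text \<open>Bernoulli's inequality for a real exponent. In the moment recursions it bounds
  \<open>x powr p * (1 + p / x)\<close> by \<open>(x + 1) powr p\<close>.\<close>

lemma one_plus_mult_le_powr:
  fixes y p :: real
  assumes "0 \<le> y" "1 \<le> p"
  shows "1 + p * y \<le> (1 + y) powr p"
proof -
  have "(1 + 0) powr p - p * 0 \<le> (1 + y) powr p - p * y"
  proof (rule DERIV_nonneg_imp_nondecreasing[OF assms(1)])
    fix u :: real assume u: "0 \<le> u" "u \<le> y"
    have "((\<lambda>u. (1 + u) powr p - p * u) has_real_derivative p * (1 + u) powr (p - 1) - p) (at u)"
      using u by (auto intro!: derivative_eq_intros)
    moreover have "0 \<le> p * (1 + u) powr (p - 1) - p"
      using u assms ge_one_powr_ge_zero[of "1 + u" "p - 1"]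
      by (simp add: mult_le_cancel_left1[of p, simplified])
    ultimately show "\<exists>z. ((\<lambda>u. (1 + u) powr p - p * u) has_real_derivative z) (at u) \<and> 0 \<le> z"
      by blast
  qed
  then show ?thesis by simp
qed

text \<open>A discrete Gronwall estimate: without its source the recursion grows like n^\<gamma>,
  and as \<gamma> < p, a source of order n^(p-1) produces order n^p.\<close>

lemma powr_growth_bound:
  fixes v :: "nat \<Rightarrow> real"
  assumes p: "1 \<le> p" "0 \<le> \<gamma>" "\<gamma> < p"
    and v: "\<And>n. 0 \<le> v n"
    and step: "\<And>n. v (Suc n) \<le> v n * (1 + \<gamma> / (real n + 1)) + K * (real n + 1) powr (p - 1)"
  shows "\<exists>C\<ge>0. \<forall>n. v n \<le> C * (real n + 1) powr p"
proof -
  \<comment> \<open>The first entry starts the induction; the second lets the source fit into the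
    surplus \<open>C * (p - \<gamma>)\<close> left by the larger exponent.\<close>
  define C where "C = max (v 0) (K / (p - \<gamma>))"
  have C0: "0 \<le> C" unfolding C_def using v[of 0] by simp
  have KC: "K \<le> C * (p - \<gamma>)"
  proof -
    have "K / (p - \<gamma>) \<le> C" by (simp add: C_def)
    then show ?thesis using p by (simp add: field_simps)
  qed
  have "v n \<le> C * (real n + 1) powr p" for n
  proof (induction n)
    case 0 then show ?case by (simp add: C_def)
  next
    case (Suc n)
    let ?x = "real n + 1"
    have pw: "?x powr p = ?x * ?x powr (p - 1)"
      by (simp add: powr_diff)
    have "v (Suc n) \<le> C * ?x powr p * (1 + \<gamma> / ?x) + K * ?x powr (p - 1)"
      using step[of n] mult_right_mono[OF Suc, of "1 + \<gamma> / ?x"] p(2) by simp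
    also have "\<dots> \<le> C * ?x powr p * (1 + \<gamma> / ?x) + C * (p - \<gamma>) * ?x powr (p - 1)"
      using KC by (intro add_left_mono mult_right_mono) auto
    also have "\<dots> = C * (?x powr p * (1 + p / ?x))"
      unfolding pw by (simp add: field_simps)
    also have "\<dots> \<le> C * (?x powr p * (1 + 1 / ?x) powr p)"
    proof (intro mult_left_mono C0)
      show "1 + p / ?x \<le> (1 + 1 / ?x) powr p"
        using one_plus_mult_le_powr[of "1 / ?x" p] p(1) by simp
    qed auto
    also have "?x powr p * (1 + 1 / ?x) powr p = (real (Suc n) + 1) powr p"
    proof -
      have "?x * (1 + 1 / ?x) = real (Suc n) + 1" by (simp add: distrib_left)
      then show ?thesis by (simp add: powr_mult[symmetric])
    qed
    finally show ?case .
  qed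
  then show ?thesis using C0 by blast
qed

lemma mult_one_plus_divide:
  fixes \<nu> :: real
  assumes "\<nu> \<noteq> 0"
  shows "\<nu> * (a * (1 + \<gamma> / \<nu>) + x) = \<nu> * a + \<gamma> * a + \<nu> * x"
  using assms by (simp add: distrib_left distrib_right)

context search_tree_arity
begin

text \<open>For \<open>p < 2\<close> this is convergence of \<open>G / (n + 1)\<close> to c in mean square at a polynomial rate.\<close>

definition l2_conv :: "real \<Rightarrow> (shape \<Rightarrow> real) \<Rightarrow> real \<Rightarrow> bool" where
  "l2_conv p G c \<longleftrightarrow>
    (\<exists>C\<ge>0. \<forall>n. shape_mean n (\<lambda>t. (G t - c * (real n + 1))\<^sup>2) \<le> C * (real n + 1) powr p)"

lemma shape_mean_nonneg:
  "(\<And>t. wf_shape t \<Longrightarrow> keys t = n \<Longrightarrow> 0 \<le> \<Phi> t) \<Longrightarrow> 0 \<le> shape_mean n \<Phi>"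
  using shape_mean_mono[of n "\<lambda>_. 0" \<Phi>] by (simp add: shape_mean_const)

lemma l2_conv_cmult:
  assumes "l2_conv p G c"
  shows "l2_conv p (\<lambda>t. a * G t) (a * c)"
proof -
  obtain C where C: "0 \<le> C"
    "\<And>n. shape_mean n (\<lambda>t. (G t - c * (real n + 1))\<^sup>2) \<le> C * (real n + 1) powr p"
    using assms unfolding l2_conv_def by blast
  have "shape_mean n (\<lambda>t. (a * G t - a * c * (real n + 1))\<^sup>2) \<le> a\<^sup>2 * C * (real n + 1) powr p" for n
  proof -
    have "(\<lambda>t. (a * G t - a * c * (real n + 1))\<^sup>2) = (\<lambda>t. a\<^sup>2 * (G t - c * (real n + 1))\<^sup>2)"
      by (intro ext) (simp add: power_mult_distrib[symmetric] right_diff_distrib mult.assoc)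
    then show ?thesis
      using mult_left_mono[OF C(2)[of n], of "a\<^sup>2"] by (simp add: shape_mean_cmult mult.assoc)
  qed
  then show ?thesis unfolding l2_conv_def using C(1) by (intro exI[of _ "a\<^sup>2 * C"]) auto
qed

lemma l2_conv_cong:
  assumes "l2_conv p G c" "\<And>t. wf_shape t \<Longrightarrow> G t = H t"
  shows "l2_conv p H c"
proof -
  have "shape_mean n (\<lambda>t. (H t - c * (real n + 1))\<^sup>2) = shape_mean n (\<lambda>t. (G t - c * (real n + 1))\<^sup>2)" for n
    using assms(2) by (intro shape_mean_cong) auto
  then show ?thesis using assms(1) by (simp add: l2_conv_def)
qed

text \<open>The first-order term is kept exact, because the drift enters there; only the squared
  increment is estimated.\<close>

lemma up_square_le:
  assumes "wf_shape t" "\<And>x. x \<in> set (succs t) \<Longrightarrow> \<bar>g x\<bar> \<le> K"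
  shows "up (\<lambda>x. (a + g x)\<^sup>2) t
    \<le> real (Suc (keys t)) * a\<^sup>2 + 2 * a * up g t + real (Suc (keys t)) * K\<^sup>2"
proof -
  have "up (\<lambda>x. (a + g x)\<^sup>2) t \<le> up (\<lambda>x. a\<^sup>2 + 2 * a * g x + K\<^sup>2) t"
  proof (rule up_mono)
    fix x assume "x \<in> set (succs t)"
    then have "(g x)\<^sup>2 \<le> K\<^sup>2" using assms(2)[of x] abs_le_square_iff[of "g x" K] by simp
    then show "(a + g x)\<^sup>2 \<le> a\<^sup>2 + 2 * a * g x + K\<^sup>2" by (simp add: power2_sum)
  qed
  also have "\<dots> = real (Suc (keys t)) * a\<^sup>2 + 2 * a * up g t + real (Suc (keys t)) * K\<^sup>2"
    by (simp add: up_add up_cmult up_const assms(1) del: of_nat_Suc)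
  finally show ?thesis .
qed

text \<open>If G grows like c n, then c must balance the drift, \<open>c = w - \<rho> * c\<close>,
  which fixes the limit. In the recursion for the squared deviation the growth coefficient is 1;
  this is below p, so G inherits the rate of W.\<close>

lemma l2_conv_step:
  assumes p: "1 < p" and \<rho>: "0 \<le> \<rho>" and W: "l2_conv p W w" and G: "bounded_incr G"
    and drift: "\<And>t. wf_shape t \<Longrightarrow> up (\<lambda>x. G x - G t) t = W t - \<rho> * G t"
  shows "l2_conv p G (w / (1 + \<rho>))"
proof -
  define c where "c = w / (1 + \<rho>)"
  have w: "w = c * (1 + \<rho>)" using \<rho> by (simp add: c_def)
  obtain B where B: "\<And>t x. wf_shape t \<Longrightarrow> x \<in> set (succs t) \<Longrightarrow> \<bar>G x - G t\<bar> \<le> B"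
    using G unfolding bounded_incr_def by blast
  obtain C where C: "0 \<le> C"
    "\<And>n. shape_mean n (\<lambda>t. (W t - w * (real n + 1))\<^sup>2) \<le> C * (real n + 1) powr p"
    using W unfolding l2_conv_def by blast
  define K where "K = (B + \<bar>c\<bar>)\<^sup>2"
  define v where "v n = shape_mean n (\<lambda>t. (G t - c * (real n + 1))\<^sup>2)" for n
  have step: "v (Suc n) \<le> v n * (1 + 1 / (real n + 1)) + (C + K) * (real n + 1) powr (p - 1)" for n
  proof -
    let ?\<nu> = "real n + 1"
    have "?\<nu> * v (Suc n) = shape_mean n (up (\<lambda>x. (G x - c * (?\<nu> + 1))\<^sup>2))"
      using shape_mean_Suc[of n] by (simp add: v_def add.commute)
    also have "\<dots> \<le> shape_mean n (\<lambda>t. (?\<nu> + 1) * (G t - c * ?\<nu>)\<^sup>2 + (W t - w * ?\<nu>)\<^sup>2 + ?\<nu> * K)"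
    proof (rule shape_mean_mono)
      fix t assume t: "wf_shape t" "keys t = n"
      let ?Z = "G t - c * ?\<nu>" and ?W = "W t - w * ?\<nu>"
      have "up (\<lambda>x. (G x - c * (?\<nu> + 1))\<^sup>2) t = up (\<lambda>x. (?Z + (G x - G t - c))\<^sup>2) t"
        by (intro up_cong) (simp add: algebra_simps)
      also have "\<dots> \<le> ?\<nu> * ?Z\<^sup>2 + 2 * ?Z * up (\<lambda>x. G x - G t - c) t + ?\<nu> * K"
        using up_square_le[OF t(1), of "\<lambda>x. G x - G t - c" "B + \<bar>c\<bar>" ?Z] B[OF t(1)] t(2)
        unfolding K_def by (fastforce simp: add.commute)
      also have "up (\<lambda>x. G x - G t - c) t = ?W - \<rho> * ?Z"
        using t up_diff[of "\<lambda>x. G x - G t" "\<lambda>_. c" t] drift[OF t(1)]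
        by (simp add: up_const w algebra_simps)
      \<comment> \<open>The mixed product is split by AM-GM, and the damping term with \<rho> has
        the favourable sign.\<close>
      also have "2 * ?Z * (?W - \<rho> * ?Z) \<le> ?Z\<^sup>2 + ?W\<^sup>2"
      proof -
        have "0 \<le> (?Z - ?W)\<^sup>2 + 2 * \<rho> * ?Z\<^sup>2" using \<rho> by simp
        then show ?thesis by (simp add: power2_eq_square algebra_simps)
      qed
      finally show "up (\<lambda>x. (G x - c * (?\<nu> + 1))\<^sup>2) t \<le> (?\<nu> + 1) * ?Z\<^sup>2 + ?W\<^sup>2 + ?\<nu> * K"
        by (simp add: algebra_simps)
    qed
    also have "\<dots> = (?\<nu> + 1) * v n + shape_mean n (\<lambda>t. (W t - w * ?\<nu>)\<^sup>2) + ?\<nu> * K"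
      by (simp only: shape_mean_add shape_mean_cmult shape_mean_const v_def)
    also have "\<dots> \<le> (?\<nu> + 1) * v n + C * ?\<nu> powr p + ?\<nu> * K"
      using C(2)[of n] by simp
    also have "?\<nu> powr p = ?\<nu> * ?\<nu> powr (p - 1)" by (simp add: powr_diff)
    also have "?\<nu> * K \<le> ?\<nu> * (K * ?\<nu> powr (p - 1))"
    proof -
      have "1 \<le> ?\<nu> powr (p - 1)" using p by (intro ge_one_powr_ge_zero) auto
      then have "K * 1 \<le> K * ?\<nu> powr (p - 1)" by (intro mult_left_mono) (auto simp: K_def)
      then show ?thesis by (intro mult_left_mono) auto
    qed
    finally have "?\<nu> * v (Suc n) \<le> ?\<nu> * (v n * (1 + 1 / ?\<nu>) + (C + K) * ?\<nu> powr (p - 1))"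
      by (subst mult_one_plus_divide) (simp_all add: distrib_right distrib_left mult.left_commute)
    then show ?thesis by simp
  qed
  have "\<exists>C\<ge>0. \<forall>n. v n \<le> C * (real n + 1) powr p"
    using p by (intro powr_growth_bound[OF _ _ _ _ step]) (auto simp: v_def intro: shape_mean_nonneg)
  then show ?thesis unfolding l2_conv_def v_def c_def .
qed

section \<open>The cycle of nodes that are not full\<close>

definition size_count :: "nat \<Rightarrow> shape \<Rightarrow> real" where
  "size_count j = node_sum (at_size j (\<lambda>_. 1))"

text \<open>This is the harmonic number H_m minus 1, so \<open>empty_limit\<close> is 1 / (2 (H_m -
  1)), the classical number of nodes per key in an m-ary search tree.\<close>

definition cyc_weight :: real where
  "cyc_weight = (\<Sum>j<m - 1. 1 / (real j + 2))"

definition empty_limit :: real where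
  "empty_limit = 1 / (2 * cyc_weight)"

text \<open>With \<epsilon> = 1 / (4 (m - 1)^2), the Poincare inequality for the cycle yields the
  growth exponent 2 - 2 \<epsilon>. The choice 2 - \<epsilon> lies strictly above it, which leaves
  room for the source term, and still below 2.\<close>

definition rate_exp :: real where
  "rate_exp = 2 - 1 / (4 * (real (m - 1))\<^sup>2)"

lemma cyc_weight_pos: "0 < cyc_weight"
  unfolding cyc_weight_def using m2 by (intro sum_pos) (auto simp: lessThan_empty_iff)

lemma empty_limit_pos: "0 < empty_limit"
  using cyc_weight_pos by (simp add: empty_limit_def)

lemma rate_exp_bounds: "1 < rate_exp" "rate_exp < 2"
proof -
  have "1 \<le> (real (m - 1))\<^sup>2" using m2 by simp
  then have x: "1 < 4 * (real (m - 1))\<^sup>2" by linarith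
  then have "1 / (4 * (real (m - 1))\<^sup>2) < 1" by (subst divide_less_eq_1_pos) auto
  moreover have "0 < 1 / (4 * (real (m - 1))\<^sup>2)" using x by (intro divide_pos_pos) auto
  ultimately show "1 < rate_exp" "rate_exp < 2" unfolding rate_exp_def by linarith+
qed

text \<open>A discrete Poincare inequality. Any two values differ by at most twice the sum of the
  adjacent differences; since the weighted mean is zero, each value is itself a weighted mean of
  such differences. Cauchy-Schwarz then passes to the sum of squares.\<close>

lemma cycle_poincare:
  fixes Z :: "nat \<Rightarrow> real"
  assumes zero: "(\<Sum>j<m - 1. Z j / (real j + 2)) = 0"
  defines "pre \<equiv> \<lambda>j. if j = 0 then m - 2 else j - 1"
  shows "(\<Sum>j<m - 1. (Z j)\<^sup>2 / (real j + 2)) \<le> 2 * (real (m - 1))\<^sup>2 * (\<Sum>j<m - 1. (Z j - Z (pre j))\<^sup>2)"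
proof -
  let ?r = "m - 1"
  define D where "D = (\<Sum>l<?r. \<bar>Z l - Z (pre l)\<bar>)"
  define Q where "Q = (\<Sum>j<?r. (Z j - Z (pre j))\<^sup>2)"
  have r0: "0 < ?r" using m2 by simp
  have D0: "\<bar>Z j - Z 0\<bar> \<le> D" if "j < ?r" for j
  proof -
    have "\<bar>Z j - Z 0\<bar> \<le> (\<Sum>l\<in>{..j}. \<bar>Z l - Z (pre l)\<bar>)"
    proof (induction j)
      case (Suc j)
      then show ?case by (simp add: pre_def)
    qed simp
    also have "\<dots> \<le> D" unfolding D_def using that by (intro sum_mono2) auto
    finally show ?thesis .
  qed
  have D2: "\<bar>Z j - Z i\<bar> \<le> 2 * D" if "j < ?r" "i < ?r" for i j
    using D0[OF that(1)] D0[OF that(2)] by linarith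
  have Zj: "(Z j)\<^sup>2 \<le> 4 * (real ?r * Q)" if j: "j < ?r" for j
  proof -
    have "Z j * cyc_weight = (\<Sum>i<?r. (Z j - Z i) / (real i + 2))"
      using zero by (simp add: cyc_weight_def sum_distrib_left diff_divide_distrib sum_subtractf)
    then have "\<bar>Z j * cyc_weight\<bar> = \<bar>\<Sum>i<?r. (Z j - Z i) / (real i + 2)\<bar>" by simp
    also have "\<dots> \<le> (\<Sum>i<?r. \<bar>(Z j - Z i) / (real i + 2)\<bar>)" by (rule sum_abs)
    also have "\<dots> \<le> (\<Sum>i<?r. 2 * D * (1 / (real i + 2)))"
      using D2[OF j] by (intro sum_mono) (simp add: divide_right_mono)
    also have "\<dots> = 2 * D * cyc_weight" by (simp add: cyc_weight_def sum_distrib_left)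
    finally have "\<bar>Z j\<bar> \<le> 2 * D" using cyc_weight_pos by (simp add: abs_mult)
    then have "(Z j)\<^sup>2 \<le> (2 * D)\<^sup>2" using abs_le_square_iff[of "Z j" "2 * D"] by linarith
    also have "\<dots> = 4 * D\<^sup>2" by (simp add: power_mult_distrib)
    also have "D\<^sup>2 \<le> real ?r * Q"
      using sum_squared_le_sum_of_squares[of "\<lambda>l. \<bar>Z l - Z (pre l)\<bar>" "{..<?r}"]
      by (simp add: D_def Q_def mult.commute)
    finally show ?thesis by simp
  qed
  have Q0: "0 \<le> Q" by (simp add: Q_def sum_nonneg)
  have "(\<Sum>j<?r. (Z j)\<^sup>2 / (real j + 2)) \<le> (\<Sum>j<?r. 2 * real ?r * Q)"
  proof (rule sum_mono)
    fix j assume "j \<in> {..<?r}"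
    then have "(Z j)\<^sup>2 / (real j + 2) \<le> 4 * (real ?r * Q) / 2"
      using Zj by (intro frac_le) (auto simp: Q0)
    then show "(Z j)\<^sup>2 / (real j + 2) \<le> 2 * real ?r * Q" by (simp add: mult_ac)
  qed
  also have "\<dots> = 2 * (real ?r)\<^sup>2 * Q"
    by (simp only: sum_constant card_lessThan power2_eq_square mult.assoc mult.left_commute)
  finally show ?thesis unfolding Q_def .
qed

text \<open>The factor \<open>(j + 1) * (j + 2)\<close> undoes the equilibrium profile. If all
  \<open>y j\<close> have a common value, their drift equals that value, which is linear growth;
  unequal values are passed on around the cycle.\<close>

lemma up_size_count:
  assumes "wf_shape t" "j < m - 1"
  defines "pre \<equiv> \<lambda>j. if j = 0 then m - 2 else j - 1"
  defines "y \<equiv> \<lambda>j u. (real j + 1) * (real j + 2) * size_count j u"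
  shows "up (\<lambda>x. y j x - y j t) t = (real j + 2) * y (pre j) t - (real j + 1) * y j t"
proof -
  have y: "up (\<lambda>x. y j x - y j t) t
      = (real j + 1) * (real j + 2) * up (\<lambda>x. size_count j x - size_count j t) t"
    unfolding y_def up_cmult[symmetric] by (simp add: algebra_simps)
  show ?thesis
  proof (cases "j = 0")
    case True
    then show ?thesis unfolding y using drift_empty[OF assms(1)] m2
      by (simp add: y_def pre_def size_count_def of_nat_diff algebra_simps)
  next
    case False
    have "node_sum (at_size (j - 1) (up (\<lambda>_. 1))) t = node_sum (\<lambda>u. real j * at_size (j - 1) (\<lambda>_. 1) u) t"
      using False by (intro node_sum_cong[OF _ assms(1)]) (auto simp: at_size_def up_const)
    then have u: "up (\<lambda>x. size_count j x - size_count j t) t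
        = real j * size_count (j - 1) t - (real j + 1) * size_count j t"
      using drift_at_size[OF assms(1), of j "\<lambda>_. 1"] False
      by (simp add: size_count_def node_sum_cmult add.commute)
    have "real (j - Suc 0) = real j - 1" using False by (simp add: of_nat_diff)
    then show ?thesis unfolding y u using False
      by (simp add: y_def pre_def algebra_simps)
  qed
qed

lemma bounded_incr_size_count: "bounded_incr (size_count j)"
  unfolding size_count_def by (rule bounded_incr_at_size[of _ 1]) simp

text \<open>The rescaled counts \<open>y j\<close> of nodes with j keys drift towards \<open>y (j - 1)\<close> cyclically, and
  \<open>\<Sum>j. y j / (j + 2)\<close> is the number of gaps. So V is a Lyapunov function: its drift is twice
  itself minus the sum of the squared cyclic differences.\<close>

lemma l2_conv_empty: "l2_conv rate_exp (size_count 0) empty_limit"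
proof -
  let ?r = "m - 1"
  define pre where "pre = (\<lambda>j. if j = 0 then m - 2 else j - 1 :: nat)"
  define y where "y = (\<lambda>j u. (real j + 1) * (real j + 2) * size_count j u)"
  \<comment> \<open>The common limit of \<open>y j / (n + 1)\<close>, determined by the gap count:
    its product with \<open>cyc_weight\<close> has to be 1.\<close>
  define \<kappa> where "\<kappa> = 1 / cyc_weight"
  define Z where "Z n j t = y j t - \<kappa> * (real n + 1)" for n j t
  define V where "V n t = (\<Sum>j<?r. (Z n j t)\<^sup>2 / (real j + 2))" for n t
  define \<epsilon> where "\<epsilon> = 1 / (4 * (real ?r)\<^sup>2)"
  have r0: "0 < ?r" using m2 by simp
  have pre_bij: "bij_betw pre {..<?r} {..<?r}"
    by (rule bij_betw_byWitness[where f' = "\<lambda>j. if j = m - 2 then 0 else Suc j"])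
       (use m2 in \<open>auto simp: pre_def split: if_splits\<close>)
  have "\<exists>K. \<forall>j<?r. \<forall>t x. wf_shape t \<longrightarrow> x \<in> set (succs t) \<longrightarrow> \<bar>y j x - y j t - \<kappa>\<bar> \<le> K j"
  proof -
    have "\<exists>K. \<forall>t x. wf_shape t \<longrightarrow> x \<in> set (succs t) \<longrightarrow> \<bar>y j x - y j t - \<kappa>\<bar> \<le> K" for j
    proof -
      obtain B where B: "\<And>t x. wf_shape t \<Longrightarrow> x \<in> set (succs t) \<Longrightarrow> \<bar>size_count j x - size_count j t\<bar> \<le> B"
        using bounded_incr_size_count[of j] unfolding bounded_incr_def by blast
      have "\<bar>y j x - y j t - \<kappa>\<bar> \<le> (real j + 1) * (real j + 2) * B + \<bar>\<kappa>\<bar>"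
        if "wf_shape t" "x \<in> set (succs t)" for t x
      proof -
        have "\<bar>y j x - y j t\<bar> = (real j + 1) * (real j + 2) * \<bar>size_count j x - size_count j t\<bar>"
          by (simp add: y_def right_diff_distrib[symmetric] abs_mult)
        also have "\<dots> \<le> (real j + 1) * (real j + 2) * B"
          using B[OF that] by (intro mult_left_mono) auto
        finally show ?thesis by linarith
      qed
      then show ?thesis by blast
    qed
    then show ?thesis by metis
  qed
  then obtain K where K: "\<And>j t x. j < ?r \<Longrightarrow> wf_shape t \<Longrightarrow> x \<in> set (succs t) \<Longrightarrow> \<bar>y j x - y j t - \<kappa>\<bar> \<le> K j"
    by blast
  define L where "L = (\<Sum>j<?r. (K j)\<^sup>2)"
  have L0: "0 \<le> L" by (simp add: L_def sum_nonneg)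
  have upV: "up (V (Suc n)) t \<le> (real n + 1) * V n t + (2 - 2 * \<epsilon>) * V n t + (real n + 1) * L"
    if t: "wf_shape t" "keys t = n" for n t
  proof -
    let ?\<nu> = "real n + 1"
    let ?Z = "\<lambda>j. Z n j t"
    have "up (V (Suc n)) t = (\<Sum>j<?r. up (\<lambda>x. (Z (Suc n) j x)\<^sup>2) t / (real j + 2))"
    proof -
      have "up (\<lambda>x. \<Sum>j\<in>J. g j x) t = (\<Sum>j\<in>J. up (g j) t)" if "finite J" for J :: "nat set" and g
        using that by (induction J) (auto simp: up_add up_def)
      moreover have "up (\<lambda>x. g x / (real j + 2)) t = up g t / (real j + 2)" for g j
        using up_cmult[of "1 / (real j + 2)" g t] by simp
      ultimately show ?thesis unfolding V_def by simp
    qed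
    also have "\<dots> \<le> (\<Sum>j<?r. (?\<nu> * (?Z j)\<^sup>2 + 2 * ?Z j * ((real j + 2) * ?Z (pre j) - (real j + 1) * ?Z j)
        + ?\<nu> * (K j)\<^sup>2) / (real j + 2))"
    proof (intro sum_mono divide_right_mono)
      fix j assume j: "j \<in> {..<?r}"
      have "up (\<lambda>x. (Z (Suc n) j x)\<^sup>2) t = up (\<lambda>x. (?Z j + (y j x - y j t - \<kappa>))\<^sup>2) t"
        by (intro up_cong) (simp add: Z_def algebra_simps)
      also have "\<dots> \<le> ?\<nu> * (?Z j)\<^sup>2 + 2 * ?Z j * up (\<lambda>x. y j x - y j t - \<kappa>) t + ?\<nu> * (K j)\<^sup>2"
        using up_square_le[OF t(1), of "\<lambda>x. y j x - y j t - \<kappa>" "K j" "?Z j"] K[OF _ t(1)] j t(2)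
        by (simp add: add.commute)
      also have "up (\<lambda>x. y j x - y j t - \<kappa>) t = (real j + 2) * ?Z (pre j) - (real j + 1) * ?Z j"
        using t up_diff[of "\<lambda>x. y j x - y j t" "\<lambda>_. \<kappa>" t] up_size_count[OF t(1), of j] j
        by (simp add: up_const Z_def y_def pre_def algebra_simps)
      finally show "up (\<lambda>x. (Z (Suc n) j x)\<^sup>2) t \<le> ?\<nu> * (?Z j)\<^sup>2
        + 2 * ?Z j * ((real j + 2) * ?Z (pre j) - (real j + 1) * ?Z j) + ?\<nu> * (K j)\<^sup>2" .
    qed auto
    also have "\<dots> = (\<Sum>j<?r. (?\<nu> + 2) * ((?Z j)\<^sup>2 / (real j + 2))
        + (2 * (?Z j * ?Z (pre j)) - 2 * (?Z j)\<^sup>2) + ?\<nu> * ((K j)\<^sup>2 / (real j + 2)))"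
    proof (intro sum.cong refl)
      fix j :: nat
      have gen: "(\<nu> * z\<^sup>2 + 2 * z * (c * z' - (c - 1) * z) + \<nu> * k) / c
          = (\<nu> + 2) * (z\<^sup>2 / c) + (2 * (z * z') - 2 * z\<^sup>2) + \<nu> * (k / c)"
        if "c \<noteq> 0" for c z z' k \<nu> :: real
        using that by (simp add: divide_simps power2_eq_square) (simp add: algebra_simps)
      show "(?\<nu> * (?Z j)\<^sup>2 + 2 * ?Z j * ((real j + 2) * ?Z (pre j) - (real j + 1) * ?Z j)
        + ?\<nu> * (K j)\<^sup>2) / (real j + 2) = (?\<nu> + 2) * ((?Z j)\<^sup>2 / (real j + 2))
        + (2 * (?Z j * ?Z (pre j)) - 2 * (?Z j)\<^sup>2) + ?\<nu> * ((K j)\<^sup>2 / (real j + 2))"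
        using gen[of "real j + 2" ?\<nu> "?Z j" "?Z (pre j)" "(K j)\<^sup>2"] by (simp add: add_ac)
    qed
    also have "\<dots> = (?\<nu> + 2) * V n t + (\<Sum>j<?r. 2 * (?Z j * ?Z (pre j)) - 2 * (?Z j)\<^sup>2)
        + ?\<nu> * (\<Sum>j<?r. (K j)\<^sup>2 / (real j + 2))"
      by (simp add: sum.distrib V_def sum_distrib_left)
    \<comment> \<open>\<open>pre\<close> permutes the indices, so the squares at the shifted indices
      have the same sum, and the cross terms complete to squared differences.\<close>
    also have "(\<Sum>j<?r. 2 * (?Z j * ?Z (pre j)) - 2 * (?Z j)\<^sup>2) = - (\<Sum>j<?r. (?Z j - ?Z (pre j))\<^sup>2)"
    proof -
      have "(\<Sum>j<?r. (?Z (pre j))\<^sup>2) = (\<Sum>j<?r. (?Z j)\<^sup>2)"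
        using sum.reindex_bij_betw[OF pre_bij, of "\<lambda>j. (?Z j)\<^sup>2"] by simp
      then show ?thesis
        by (simp add: power2_diff sum.distrib sum_subtractf sum_distrib_left[symmetric] mult.assoc)
    qed
    also have "- (\<Sum>j<?r. (?Z j - ?Z (pre j))\<^sup>2) \<le> - (2 * \<epsilon> * V n t)"
    proof -
      \<comment> \<open>The number of gaps is deterministic, so the weighted sum of the deviations
        is exactly zero, as the Poincare inequality requires.\<close>
      have "(\<Sum>j<?r. ?Z j / (real j + 2)) = (\<Sum>j<?r. real (Suc j) * size_count j t - \<kappa> * ?\<nu> * (1 / (real j + 2)))"
        by (intro sum.cong refl) (simp add: Z_def y_def field_simps)
      also have "\<dots> = ?\<nu> - \<kappa> * ?\<nu> * cyc_weight"
        using gap_count[OF t(1)] t(2)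
        by (simp add: sum_subtractf sum_distrib_left size_count_def cyc_weight_def add.commute)
      also have "\<dots> = 0" using cyc_weight_pos by (simp add: \<kappa>_def)
      finally have "V n t \<le> 2 * (real ?r)\<^sup>2 * (\<Sum>j<?r. (?Z j - ?Z (pre j))\<^sup>2)"
        unfolding V_def pre_def by (rule cycle_poincare)
      then show ?thesis using r0 by (simp add: \<epsilon>_def field_simps)
    qed
    also have "?\<nu> * (\<Sum>j<?r. (K j)\<^sup>2 / (real j + 2)) \<le> ?\<nu> * L"
    proof -
      have "(K j)\<^sup>2 / (real j + 2) \<le> (K j)\<^sup>2" for j
        using divide_left_mono[of 1 "real j + 2" "(K j)\<^sup>2"] by simp
      then show ?thesis unfolding L_def by (intro mult_left_mono sum_mono) auto
    qed
    finally show ?thesis by (simp add: algebra_simps)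
  qed
  define v where "v n = shape_mean n (V n)" for n
  have p: "rate_exp = 2 - \<epsilon>" by (simp add: rate_exp_def \<epsilon>_def)
  have \<epsilon>: "0 < \<epsilon>" "\<epsilon> < 1" using rate_exp_bounds by (auto simp: p)
  have V0: "0 \<le> V n t" for n t unfolding V_def by (intro sum_nonneg) auto
  have step: "v (Suc n) \<le> v n * (1 + (2 - 2 * \<epsilon>) / (real n + 1)) + L * (real n + 1) powr (rate_exp - 1)" for n
  proof -
    let ?\<nu> = "real n + 1"
    have "?\<nu> * v (Suc n) = shape_mean n (up (V (Suc n)))"
      using shape_mean_Suc[of n] by (simp add: v_def add.commute)
    also have "\<dots> \<le> shape_mean n (\<lambda>t. ?\<nu> * V n t + (2 - 2 * \<epsilon>) * V n t + ?\<nu> * L)"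
      by (intro shape_mean_mono upV)
    also have "\<dots> = ?\<nu> * v n + (2 - 2 * \<epsilon>) * v n + ?\<nu> * L"
      by (simp only: shape_mean_add shape_mean_cmult shape_mean_const v_def)
    also have "?\<nu> * L \<le> ?\<nu> * (L * ?\<nu> powr (rate_exp - 1))"
    proof -
      have "1 \<le> ?\<nu> powr (rate_exp - 1)" using rate_exp_bounds by (intro ge_one_powr_ge_zero) auto
      then have "L * 1 \<le> L * ?\<nu> powr (rate_exp - 1)" by (intro mult_left_mono L0)
      then show ?thesis by (intro mult_left_mono) auto
    qed
    finally have "?\<nu> * v (Suc n) \<le> ?\<nu> * (v n * (1 + (2 - 2 * \<epsilon>) / ?\<nu>) + L * ?\<nu> powr (rate_exp - 1))"
      by (subst mult_one_plus_divide) simp_all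
    then show ?thesis by simp
  qed
  have "\<exists>C\<ge>0. \<forall>n. v n \<le> C * (real n + 1) powr rate_exp"
    using \<epsilon> by (intro powr_growth_bound[OF _ _ _ _ step]) (auto simp: v_def p V0 intro!: shape_mean_nonneg)
  then obtain C where C: "0 \<le> C" "\<And>n. v n \<le> C * (real n + 1) powr rate_exp" by blast
  have "shape_mean n (\<lambda>t. (size_count 0 t - empty_limit * (real n + 1))\<^sup>2) \<le> C * (real n + 1) powr rate_exp" for n
  proof -
    have "(size_count 0 t - empty_limit * (real n + 1))\<^sup>2 \<le> V n t" for t
    proof -
      have "(Z n 0 t)\<^sup>2 / (real 0 + 2) \<le> V n t"
        unfolding V_def by (rule member_le_sum) (use r0 in auto)
      moreover have "Z n 0 t = 2 * (size_count 0 t - empty_limit * (real n + 1))"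
        using cyc_weight_pos by (simp add: Z_def y_def \<kappa>_def empty_limit_def divide_simps)
      ultimately have "2 * (size_count 0 t - empty_limit * (real n + 1))\<^sup>2 \<le> V n t"
        by (simp only: power_mult_distrib) simp
      then show ?thesis using zero_le_power2[of "size_count 0 t - empty_limit * (real n + 1)"] by linarith
    qed
    then show ?thesis using shape_mean_mono C(2)[of n] unfolding v_def by (meson order_trans)
  qed
  then show ?thesis unfolding l2_conv_def using C(1) by blast
qed

text \<open>Class s + 1 has damping s + 2, so the step divides the limit by s + 3, while the mean of
  \<open>up \<phi>\<close> contributes a factor s + 1. In the base case only the value of \<phi> at
  \<open>Part 0\<close> matters.\<close>

theorem l2_conv_at_size:
  assumes "\<And>u. \<bar>\<phi> u\<bar> \<le> b"
  shows "l2_conv rate_exp (node_sum (at_size s \<phi>))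
    (2 * empty_limit / ((real s + 1) * (real s + 2)) * shape_mean s \<phi>)"
  using assms
proof (induction s arbitrary: \<phi> b)
  case 0
  have "l2_conv rate_exp (\<lambda>t. \<phi> (Part 0) * size_count 0 t) (\<phi> (Part 0) * empty_limit)"
    by (rule l2_conv_cmult[OF l2_conv_empty])
  moreover have "\<phi> (Part 0) * size_count 0 t = node_sum (at_size 0 \<phi>) t" if "wf_shape t" for t
    unfolding size_count_def node_sum_cmult[symmetric]
    using wf_keys_small[of _ 0] m2 by (intro node_sum_cong[OF _ that]) (auto simp: at_size_def)
  ultimately have "l2_conv rate_exp (node_sum (at_size 0 \<phi>)) (\<phi> (Part 0) * empty_limit)"
    by (rule l2_conv_cong)
  then show ?case by (simp add: shape_mean_def shape_sum_0 mult.commute)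
next
  case (Suc s)
  \<comment> \<open>\<open>up \<phi>\<close> itself is unbounded, as larger trees have more gaps.
    Cutting it off outside class s restores boundedness and leaves the sums over this class
    unchanged.\<close>
  define \<psi> where "\<psi> u = (if wf_shape u \<and> keys u = s then up \<phi> u else 0)" for u
  have b0: "0 \<le> b" using Suc.prems[of "Part 0"] by linarith
  have "\<bar>\<psi> u\<bar> \<le> (real s + 1) * b" for u
  proof (cases "wf_shape u \<and> keys u = s")
    case True
    have "\<bar>up \<phi> u\<bar> \<le> up (\<lambda>x. \<bar>\<phi> x\<bar>) u" unfolding up_def
      using sum_list_abs[of "map \<phi> (succs u)"] by (simp add: comp_def)
    also have "\<dots> \<le> up (\<lambda>_. b) u" by (intro up_mono Suc.prems)
    also have "\<dots> = (real s + 1) * b" using True by (simp add: up_const add.commute)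
    finally show ?thesis using True by (simp add: \<psi>_def)
  qed (auto simp: \<psi>_def b0)
  then have "l2_conv rate_exp (node_sum (at_size s \<psi>))
    (2 * empty_limit / ((real s + 1) * (real s + 2)) * shape_mean s \<psi>)" by (rule Suc.IH)
  moreover have "shape_mean s \<psi> = shape_mean s (up \<phi>)"
    by (intro shape_mean_cong) (auto simp: \<psi>_def)
  moreover have "node_sum (at_size s \<psi>) t = node_sum (at_size s (up \<phi>)) t" if "wf_shape t" for t
    by (intro node_sum_cong[OF _ that]) (auto simp: \<psi>_def at_size_def)
  ultimately have W: "l2_conv rate_exp (node_sum (at_size s (up \<phi>)))
      (2 * empty_limit / ((real s + 1) * (real s + 2)) * shape_mean s (up \<phi>))"
    by (metis l2_conv_cong)
  have "l2_conv rate_exp (node_sum (at_size (Suc s) \<phi>))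
    (2 * empty_limit / ((real s + 1) * (real s + 2)) * shape_mean s (up \<phi>) / (1 + (real s + 2)))"
    by (rule l2_conv_step[OF rate_exp_bounds(1) _ W bounded_incr_at_size[OF Suc.prems]])
       (use drift_at_size[of _ "Suc s" \<phi>] in \<open>auto simp: add.commute\<close>)
  moreover have "shape_mean s (up \<phi>) = (real s + 1) * shape_mean (Suc s) \<phi>"
    using shape_mean_Suc[of s \<phi>] by (simp add: add.commute)
  moreover have "2 * e / ((real s + 1) * (real s + 2)) * ((real s + 1) * x) / (1 + (real s + 2))
      = 2 * e / ((real (Suc s) + 1) * (real (Suc s) + 2)) * x" for e x :: real
    by (simp add: divide_simps)
  ultimately show ?case by (simp only:)
qed

text \<open>The drift is the number of empty nodes, with no damping. Hence both counts have the same
  limit and \<open>empty_limit\<close> cancels in fractions of nodes.\<close>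

lemma l2_conv_nonempty_count: "l2_conv rate_exp nonempty_count empty_limit"
proof -
  have "l2_conv rate_exp nonempty_count (empty_limit / (1 + 0))"
    by (rule l2_conv_step[OF rate_exp_bounds(1) _ l2_conv_empty bounded_incr_nonempty_count])
       (simp_all add: drift_nonempty_count size_count_def)
  then show ?thesis by simp
qed

end

section \<open>Shapes of search trees\<close>

lemma nth_concat_offset:
  assumes "i < length xss" "r < length (xss ! i)"
  shows "concat xss ! ((\<Sum>j<i. length (xss ! j)) + r) = xss ! i ! r"
  using assms
proof (induction xss arbitrary: i)
  case (Cons xs xss)
  show ?case
  proof (cases i)
    case (Suc i')
    have "(\<Sum>j<Suc i'. length ((xs # xss) ! j)) = length xs + (\<Sum>j<i'. length (xss ! j))"
      by (subst sum.lessThan_Suc_shift) simp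
    then show ?thesis using Cons Suc by (simp add: nth_append add.assoc)
  qed (use Cons in \<open>simp add: nth_append\<close>)
qed simp

context search_tree_arity
begin

fun all_keys :: "mtree \<Rightarrow> real set" where
  "all_keys (Node K ts) = K \<union> (\<Union>t\<in>set ts. all_keys t)"

text \<open>The intervals J_i are expressed by counting the separating keys below a key, which is
  exactly how \<open>insert_key\<close> routes it.\<close>

fun search_ordered :: "mtree \<Rightarrow> bool" where
  "search_ordered (Node K ts) \<longleftrightarrow> finite K \<and>
    (if card K < m - 1 then ts = []
     else card K = m - 1 \<and> length ts = m \<and> (\<forall>t\<in>set ts. search_ordered t) \<and>
       (\<forall>i<m. \<forall>y\<in>all_keys (ts ! i). y \<notin> K \<and> card {z \<in> K. z < y} = i))"

fun shape_of :: "mtree \<Rightarrow> shape" where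
  "shape_of (Node K ts) = (if card K < m - 1 then Part (card K) else Full (map shape_of ts))"

lemma finite_all_keys: "search_ordered T \<Longrightarrow> finite (all_keys T)"
  by (induction T) (auto split: if_splits)

lemma all_keys_Node_nth: "all_keys (Node K ts) = K \<union> (\<Union>i<length ts. all_keys (ts ! i))"
proof -
  have "set ts = (!) ts ` {..<length ts}" by (auto simp: in_set_conv_nth)
  then show ?thesis by simp
qed

lemma disjoint_children_keys:
  assumes "search_ordered (Node K ts)" "i < length ts"
  shows "j < length ts \<Longrightarrow> i \<noteq> j \<Longrightarrow> all_keys (ts ! i) \<inter> all_keys (ts ! j) = {}"
    and "K \<inter> all_keys (ts ! i) = {}"
proof -
  have ord: "y \<notin> K \<and> card {z \<in> K. z < y} = j" if "j < length ts" "y \<in> all_keys (ts ! j)" for j y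
    using assms(1) that by (simp split: if_splits)
  show "all_keys (ts ! i) \<inter> all_keys (ts ! j) = {}"
    if "j < length ts" "i \<noteq> j"
    using ord[of i] ord[of j] assms(2) that by (metis disjoint_iff)
  show "K \<inter> all_keys (ts ! i) = {}"
    using ord[of i] assms(2) by (metis disjoint_iff)
qed

lemma wf_shape_of: "search_ordered T \<Longrightarrow> wf_shape (shape_of T)"
  by (induction T) (auto split: if_splits)

lemma keys_shape_of: "search_ordered T \<Longrightarrow> keys (shape_of T) = card (all_keys T)"
proof (induction T)
  case (Node K ts)
  show ?case
  proof (cases "card K < m - 1")
    case True then show ?thesis using Node.prems by simp
  next
    case False
    have fin: "finite (all_keys (ts ! i))" if "i < length ts" for i
      using Node.prems that False by (intro finite_all_keys) auto
    have "card (all_keys (Node K ts)) = card K + card (\<Union>i<length ts. all_keys (ts ! i))"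
      unfolding all_keys_Node_nth
    proof (rule card_Un_disjoint)
      show "finite K" using Node.prems by simp
      show "K \<inter> (\<Union>i<length ts. all_keys (ts ! i)) = {}"
        using disjoint_children_keys(2)[OF Node.prems] by auto
    qed (use fin in auto)
    also have "card (\<Union>i<length ts. all_keys (ts ! i)) = (\<Sum>i<length ts. card (all_keys (ts ! i)))"
      using disjoint_children_keys(1)[OF Node.prems] fin by (intro card_UN_disjoint) auto
    also have "\<dots> = (\<Sum>i<length ts. keys (shape_of (ts ! i)))"
      using Node False by (intro sum.cong refl) auto
    finally show ?thesis
      using Node.prems False by (simp add: sum_list_sum_nth atLeast0LessThan)
  qed
qed

text \<open>Each child to the left of i contributes its own keys and one separating key. As
  \<open>Suc\<close> of its number of keys is also its number of gaps, the sum is the offset of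
  block i in the left-to-right list \<open>succs\<close>.\<close>

lemma rank_split:
  assumes T: "search_ordered (Node K ts)" "\<not> card K < m - 1" and x: "x \<notin> all_keys (Node K ts)"
    and i: "i = card {y \<in> K. y < x}"
  shows "card {y \<in> all_keys (Node K ts). y < x}
    = (\<Sum>j<i. Suc (card (all_keys (ts ! j)))) + card {y \<in> all_keys (ts ! i). y < x}"
    and "i < m"
proof -
  have K: "finite K" "card K = m - 1" and len: "length ts = m"
    and ord: "\<And>j y. j < m \<Longrightarrow> y \<in> all_keys (ts ! j) \<Longrightarrow> y \<notin> K \<and> card {z \<in> K. z < y} = j"
    using T by auto
  have "i \<le> card K" unfolding i using K(1) by (intro card_mono) auto
  then show im: "i < m" using K m2 by simp
  have fin: "finite (all_keys (ts ! j))" if "j < m" for j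
    using T that len by (intro finite_all_keys) auto
  have mono: "card {z \<in> K. z < a} \<le> card {z \<in> K. z < b}" if "a \<le> b" for a b :: real
    using K(1) that by (intro card_mono) auto
  have below: "y < x" if "j < i" "y \<in> all_keys (ts ! j)" for j y
    using mono[of x y] ord[of j y] that im i by (cases "y < x") auto
  have above: "\<not> y < x" if "i < j" "j < m" "y \<in> all_keys (ts ! j)" for j y
    using mono[of y x] ord[of j y] that i by (cases "y < x") auto
  have "{y \<in> all_keys (Node K ts). y < x}
      = {y \<in> K. y < x} \<union> ((\<Union>j<i. all_keys (ts ! j)) \<union> {y \<in> all_keys (ts ! i). y < x})"
  proof (intro equalityI subsetI)
    fix y assume y: "y \<in> {y \<in> all_keys (Node K ts). y < x}"
    show "y \<in> {y \<in> K. y < x} \<union> ((\<Union>j<i. all_keys (ts ! j)) \<union> {y \<in> all_keys (ts ! i). y < x})"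
    proof (cases "y \<in> K")
      case False
      then obtain j where j: "j < m" "y \<in> all_keys (ts ! j)"
        using y len by (auto simp: all_keys_Node_nth simp del: all_keys.simps)
      then have "\<not> i < j" using above y by blast
      then show ?thesis using j y by (cases "j = i") auto
    qed (use y in auto)
  next
    fix y assume "y \<in> {y \<in> K. y < x} \<union> ((\<Union>j<i. all_keys (ts ! j)) \<union> {y \<in> all_keys (ts ! i). y < x})"
    then show "y \<in> {y \<in> all_keys (Node K ts). y < x}"
      using below im len by (auto simp: all_keys_Node_nth simp del: all_keys.simps)
  qed
  also have "card \<dots> = card {y \<in> K. y < x}
      + card ((\<Union>j<i. all_keys (ts ! j)) \<union> {y \<in> all_keys (ts ! i). y < x})"
  proof (intro card_Un_disjoint)
    have "z \<notin> K" if "z \<in> all_keys (ts ! j)" "j \<le> i" for z j using ord[of j z] that im by simp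
    then show "{y \<in> K. y < x} \<inter> ((\<Union>j<i. all_keys (ts ! j)) \<union> {y \<in> all_keys (ts ! i). y < x}) = {}"
      by (auto intro: less_imp_le)
  qed (use K(1) fin im in auto)
  also have "card ((\<Union>j<i. all_keys (ts ! j)) \<union> {y \<in> all_keys (ts ! i). y < x})
      = card (\<Union>j<i. all_keys (ts ! j)) + card {y \<in> all_keys (ts ! i). y < x}"
  proof (intro card_Un_disjoint)
    show "(\<Union>j<i. all_keys (ts ! j)) \<inter> {y \<in> all_keys (ts ! i). y < x} = {}"
    proof -
      have "all_keys (ts ! j) \<inter> all_keys (ts ! i) = {}" if "j < i" for j
        using disjoint_children_keys(1)[OF T(1), of j i] that im len by simp
      then show ?thesis by blast
    qed
  qed (use fin im in auto)
  also have "card (\<Union>j<i. all_keys (ts ! j)) = (\<Sum>j<i. card (all_keys (ts ! j)))"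
    using disjoint_children_keys(1)[OF T(1)] fin im len by (intro card_UN_disjoint) auto
  finally show "card {y \<in> all_keys (Node K ts). y < x}
    = (\<Sum>j<i. Suc (card (all_keys (ts ! j)))) + card {y \<in> all_keys (ts ! i). y < x}"
    using sum.distrib[of "\<lambda>_. 1" "\<lambda>j. card (all_keys (ts ! j))" "{..<i}"] i by simp
qed

text \<open>The order of \<open>succs\<close> is made so that the rank of the key is the index. At a
  full node \<open>rank_split\<close> resolves the rank into a block of the concatenation and a
  position inside it.\<close>

lemma insert_key_shape:
  assumes "search_ordered T" "x \<notin> all_keys T"
  shows "search_ordered (insert_key m x T) \<and> all_keys (insert_key m x T) = insert x (all_keys T)
    \<and> shape_of (insert_key m x T) = succs (shape_of T) ! card {y \<in> all_keys T. y < x}"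
  using assms
proof (induction T)
  case (Node K ts)
  show ?case
  proof (cases "card K < m - 1")
    case True
    then have ts: "ts = []" and K: "finite K" "x \<notin> K" using Node.prems by auto
    have c: "card (insert x K) = Suc (card K)" using K by simp
    have r: "card {y \<in> K. y < x} \<le> card K" using K by (intro card_mono) auto
    have g: "succs (Part (card K)) ! card {y \<in> K. y < x} = grow (card K)"
      using r by (simp add: nth_replicate del: replicate_Suc)
    show ?thesis
    proof (cases "Suc (card K) = m - 1")
      case full: True
      then have "insert_key m x (Node K ts) = Node (insert x K) (replicate m empty_node)"
        using True c by simp
      moreover have "grow (card K) = Full (replicate m (Part 0))" using full by (simp add: grow_def)
      moreover have "all_keys (replicate m empty_node ! i) = {}" if "i < m" for i using that by simp
      ultimately show ?thesis using True ts K c full g m2 by simp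
    next
      case False
      then have "insert_key m x (Node K ts) = Node (insert x K) []" using True c by simp
      moreover have "grow (card K) = Part (Suc (card K))" "Suc (card K) < m - 1"
        using False True by (auto simp: grow_def)
      ultimately show ?thesis using True ts K c g by simp
    qed
  next
    case False
    define i where "i = card {y \<in> K. y < x}"
    note rs = rank_split[OF Node.prems(1) False Node.prems(2) i_def]
    have K: "finite K" "card K = m - 1" and len: "length ts = m" and wf: "\<And>t. t \<in> set ts \<Longrightarrow> search_ordered t"
      and ord: "\<And>j y. j < m \<Longrightarrow> y \<in> all_keys (ts ! j) \<Longrightarrow> y \<notin> K \<and> card {z \<in> K. z < y} = j"
      using Node.prems(1) False by simp_all
    have i: "i < length ts" using rs(2) len by simp
    define y where "y = insert_key m x (ts ! i)"
    have ins: "insert_key m x (Node K ts) = Node K (ts[i := y])"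
      using False i by (simp add: i_def y_def Let_def)
    have IH: "search_ordered y" "all_keys y = insert x (all_keys (ts ! i))"
      "shape_of y = succs (shape_of (ts ! i)) ! card {z \<in> all_keys (ts ! i). z < x}"
    proof -
      have "x \<notin> all_keys (ts ! i)" using Node.prems(2) i by simp
      then show "search_ordered y" "all_keys y = insert x (all_keys (ts ! i))"
        "shape_of y = succs (shape_of (ts ! i)) ! card {z \<in> all_keys (ts ! i). z < x}"
        using Node.IH[OF nth_mem[OF i] wf[OF nth_mem[OF i]]] unfolding y_def by blast+
    qed
    have ak: "all_keys (Node K (ts[i := y])) = insert x (all_keys (Node K ts))"
    proof -
      have "(\<Union>j<length ts. all_keys (ts[i := y] ! j)) = insert x (\<Union>j<length ts. all_keys (ts ! j))"
      proof (intro equalityI subsetI)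
        fix z assume "z \<in> (\<Union>j<length ts. all_keys (ts[i := y] ! j))"
        then obtain j where "j < length ts" "z \<in> all_keys (ts[i := y] ! j)" by blast
        then show "z \<in> insert x (\<Union>j<length ts. all_keys (ts ! j))"
          using i IH(2) by (cases "j = i") auto
      next
        fix z assume "z \<in> insert x (\<Union>j<length ts. all_keys (ts ! j))"
        then consider "z = x" | j where "j < length ts" "z \<in> all_keys (ts ! j)" by blast
        then show "z \<in> (\<Union>j<length ts. all_keys (ts[i := y] ! j))"
        proof cases
          case 1
          then show ?thesis using i IH(2) by (intro UN_I[of i]) auto
        next
          case (2 j)
          moreover have "z \<in> all_keys (ts[i := y] ! j)" using 2 i IH(2) by (cases "j = i") simp_all
          ultimately show ?thesis by blast
        qed
      qed
      then show ?thesis unfolding all_keys_Node_nth by simp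
    qed
    have "search_ordered (Node K (ts[i := y]))"
    proof -
      have "\<forall>t\<in>set (ts[i := y]). search_ordered t"
        using set_update_subset_insert[of ts i y] wf IH(1) by auto
      moreover have "z \<notin> K \<and> card {w \<in> K. w < z} = j" if "j < m" "z \<in> all_keys (ts[i := y] ! j)" for j z
      proof (cases "j = i \<and> z = x")
        case True
        then show ?thesis using Node.prems(2) i_def by simp
      next
        case False
        then have "z \<in> all_keys (ts ! j)" using that i IH(2) by (cases "j = i") simp_all
        then show ?thesis using ord that(1) by blast
      qed
      ultimately show ?thesis using K False len by simp
    qed
    moreover have "shape_of (Node K (ts[i := y]))
        = succs (shape_of (Node K ts)) ! card {y \<in> all_keys (Node K ts). y < x}"
    proof -
      let ?us = "map shape_of ts"
      let ?xss = "map (\<lambda>i. map (\<lambda>x. Full (?us[i := x])) (succs (?us ! i))) [0..<length ?us]"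
      let ?r = "card {z \<in> all_keys (ts ! i). z < x}"
      have len_j: "length (?xss ! j) = Suc (card (all_keys (ts ! j)))" if "j < length ts" for j
        using that length_succs[OF wf_shape_of[OF wf]] keys_shape_of[OF wf] by simp
      have r: "?r < length (?xss ! i)" unfolding len_j[OF i]
        using i wf finite_all_keys[of "ts ! i"] by (auto simp: less_Suc_eq_le intro!: card_mono)
      have "succs (shape_of (Node K ts)) ! card {y \<in> all_keys (Node K ts). y < x}
          = concat ?xss ! ((\<Sum>j<i. length (?xss ! j)) + ?r)"
      proof -
        have "(\<Sum>j<i. length (?xss ! j)) = (\<Sum>j<i. Suc (card (all_keys (ts ! j))))"
          using i by (intro sum.cong refl len_j) auto
        then show ?thesis using rs(1) False by (simp del: all_keys.simps)
      qed
      also have "\<dots> = ?xss ! i ! ?r" using i r by (intro nth_concat_offset) auto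
      also have "\<dots> = Full (?us[i := shape_of y])"
        using i r IH(3) by simp
      finally show ?thesis using False by (simp add: map_update)
    qed
    ultimately show ?thesis unfolding ins using ak by blast
  qed
qed

definition keys_rank :: "real list \<Rightarrow> real \<Rightarrow> nat" where
  "keys_rank xs x = card {y \<in> set xs. y < x}"

lemma build_tree_snoc: "build_tree m (xs @ [x]) = insert_key m x (build_tree m xs)"
  by (simp add: build_tree_def)

lemma build_tree_ordered:
  "distinct xs \<Longrightarrow> search_ordered (build_tree m xs) \<and> all_keys (build_tree m xs) = set xs"
proof (induction xs rule: rev_induct)
  case Nil then show ?case using m2 by (simp add: build_tree_def)
next
  case (snoc x xs)
  then show ?case using insert_key_shape[of "build_tree m xs" x] by (simp add: build_tree_snoc)
qed

lemma shape_of_build_tree_Nil: "shape_of (build_tree m []) = Part 0"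
  using m2 by (simp add: build_tree_def)

lemma shape_of_build_tree_snoc:
  assumes "distinct (xs @ [x])"
  shows "shape_of (build_tree m (xs @ [x])) = succs (shape_of (build_tree m xs)) ! keys_rank xs x"
  using build_tree_ordered[of xs] insert_key_shape[of "build_tree m xs" x] assms
  by (simp add: build_tree_snoc keys_rank_def)

text \<open>Level 0 demands a key, so no level holds for \<open>Part 0\<close>; empty children,
  absent from the final tree, are therefore excused explicitly. Demanding a nonempty child keeps
  leaves out of the positive levels.\<close>

fun prot :: "nat \<Rightarrow> shape \<Rightarrow> bool" where
  "prot 0 t \<longleftrightarrow> 1 \<le> keys t"
| "prot (Suc k) (Part j) \<longleftrightarrow> False"
| "prot (Suc k) (Full ts) \<longleftrightarrow> (\<exists>t\<in>set ts. t \<noteq> Part 0) \<and> (\<forall>t\<in>set ts. t = Part 0 \<or> prot k t)"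

lemma node_keys_empty_iff: "search_ordered T \<Longrightarrow> node_keys T = {} \<longleftrightarrow> shape_of T = Part 0"
  using m2 by (cases T) auto

lemma empty_iff_keys: "wf_shape t \<Longrightarrow> t = Part 0 \<longleftrightarrow> keys t = 0"
  using wf_keys_small[of t 0] m2 by auto

lemma Nil_in_nonempty_nodes: "[] \<in> nonempty_nodes T \<longleftrightarrow> node_keys T \<noteq> {}"
  by (simp add: nonempty_nodes_def)

lemma Cons_in_nonempty_nodes:
  "i # v \<in> nonempty_nodes (Node K ts) \<longleftrightarrow> i < length ts \<and> v \<in> nonempty_nodes (ts ! i)"
  by (simp add: nonempty_nodes_def)

lemma nonempty_nodes_empty:
  assumes "search_ordered T" "node_keys T = {}"
  shows "nonempty_nodes T = {}"
proof -
  have "T = Node {} []" using assms m2 by (cases T) (auto split: if_splits)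
  then have "subtree_at v T = (if v = [] then Some T else None)" for v by (cases v) auto
  then show ?thesis using assms(2) by (auto simp: nonempty_nodes_def)
qed

lemma is_leaf_Cons:
  "is_leaf (nonempty_nodes (Node K ts)) (i # w) \<longleftrightarrow> i < length ts \<and> is_leaf (nonempty_nodes (ts ! i)) w"
  by (auto simp: is_leaf_def Cons_in_nonempty_nodes)

lemma ex_leaf:
  assumes "search_ordered T" "node_keys T \<noteq> {}"
  shows "\<exists>w. is_leaf (nonempty_nodes T) w"
  using assms
proof (induction T)
  case (Node K ts)
  show ?case
  proof (cases "\<exists>i<length ts. node_keys (ts ! i) \<noteq> {}")
    case True
    then obtain i where i: "i < length ts" "node_keys (ts ! i) \<noteq> {}" by blast
    then have "search_ordered (ts ! i)" using Node.prems by (auto split: if_splits)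
    then obtain w where "is_leaf (nonempty_nodes (ts ! i)) w" using Node.IH[of "ts ! i"] i by auto
    then show ?thesis using i by (intro exI[of _ "i # w"]) (simp add: is_leaf_Cons)
  next
    case False
    then have "is_leaf (nonempty_nodes (Node K ts)) []" using Node.prems
      by (auto simp: is_leaf_def Cons_in_nonempty_nodes Nil_in_nonempty_nodes)
    then show ?thesis by blast
  qed
qed

text \<open>A leaf must exist, since otherwise \<open>node_rank\<close> is a \<open>LEAST\<close>
  over an empty set, with an unspecified value.\<close>

lemma k_protected_root_iff:
  assumes "\<exists>w. is_leaf A w"
  shows "k_protected k A [] \<longleftrightarrow> (\<forall>w. is_leaf A w \<longrightarrow> k \<le> length w)"
proof -
  let ?P = "\<lambda>d. \<exists>w. is_leaf A w \<and> length w = d"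
  have nr: "node_rank A [] = Least ?P" by (simp add: node_rank_def)
  have "?P (Least ?P)" using assms by (intro LeastI_ex[of ?P]) blast
  then obtain u where u: "is_leaf A u" "length u = Least ?P" by blast
  moreover have "Least ?P \<le> length w" if "is_leaf A w" for w using that by (intro Least_le) blast
  ultimately show ?thesis unfolding k_protected_def nr u(2)[symmetric] by (meson order_trans)
qed

text \<open>A path from the root to another leaf continues in a child and is one shorter there. An
  empty child has no leaves, so it imposes no condition.\<close>

lemma k_protected_root:
  assumes "search_ordered T" "node_keys T \<noteq> {}"
  shows "k_protected k (nonempty_nodes T) [] \<longleftrightarrow> prot k (shape_of T)"
  using assms
proof (induction k arbitrary: T)
  case 0
  then show ?case using node_keys_empty_iff[OF 0(1)] empty_iff_keys[OF wf_shape_of[OF 0(1)]]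
    by (simp add: k_protected_def)
next
  case (Suc k)
  obtain K ts where T: "T = Node K ts" by (cases T)
  let ?A = "nonempty_nodes T"
  have leafs: "is_leaf ?A [] \<longleftrightarrow> (\<forall>i<length ts. node_keys (ts ! i) = {})"
    using Suc.prems(2)
    by (auto simp: is_leaf_def T Cons_in_nonempty_nodes Nil_in_nonempty_nodes)
  have "k_protected (Suc k) ?A [] \<longleftrightarrow> (\<forall>w. is_leaf ?A w \<longrightarrow> Suc k \<le> length w)"
    by (rule k_protected_root_iff[OF ex_leaf[OF Suc.prems]])
  also have "\<dots> \<longleftrightarrow> \<not> is_leaf ?A [] \<and>
      (\<forall>i<length ts. \<forall>w. is_leaf (nonempty_nodes (ts ! i)) w \<longrightarrow> k \<le> length w)"
  proof (rule iffI)
    assume r: "\<forall>w. is_leaf ?A w \<longrightarrow> Suc k \<le> length w"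
    have "k \<le> length w" if "i < length ts" "is_leaf (nonempty_nodes (ts ! i)) w" for i w
    proof -
      have "is_leaf ?A (i # w)" using that by (simp add: T is_leaf_Cons)
      then have "Suc k \<le> length (i # w)" using r by blast
      then show ?thesis by simp
    qed
    moreover have "\<not> is_leaf ?A []" using r[rule_format, of "[]"] by auto
    ultimately show "\<not> is_leaf ?A [] \<and>
      (\<forall>i<length ts. \<forall>w. is_leaf (nonempty_nodes (ts ! i)) w \<longrightarrow> k \<le> length w)" by blast
  next
    assume r: "\<not> is_leaf ?A [] \<and>
      (\<forall>i<length ts. \<forall>w. is_leaf (nonempty_nodes (ts ! i)) w \<longrightarrow> k \<le> length w)"
    show "\<forall>w. is_leaf ?A w \<longrightarrow> Suc k \<le> length w"
    proof (intro allI impI)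
      fix w assume "is_leaf ?A w"
      then show "Suc k \<le> length w"
      proof (cases w)
        case Nil
        then show ?thesis using r \<open>is_leaf ?A w\<close> by blast
      next
        case (Cons i v)
        then have "i < length ts" "is_leaf (nonempty_nodes (ts ! i)) v"
          using \<open>is_leaf ?A w\<close> by (simp_all add: T is_leaf_Cons)
        then show ?thesis using r Cons by simp
      qed
    qed
  qed
  also have "\<dots> \<longleftrightarrow> prot (Suc k) (shape_of T)"
  proof (cases "card K < m - 1")
    case True
    then have "ts = []" using Suc.prems T by simp
    then show ?thesis using True T leafs by simp
  next
    case False
    have so: "search_ordered t" if "t \<in> set ts" for t using Suc.prems T False that by auto
    have ch: "(\<forall>w. is_leaf (nonempty_nodes t) w \<longrightarrow> k \<le> length w) \<longleftrightarrow> shape_of t = Part 0 \<or> prot k (shape_of t)"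
      if t: "t \<in> set ts" for t
    proof (cases "node_keys t = {}")
      case True
      then show ?thesis using nonempty_nodes_empty[OF so[OF t]] node_keys_empty_iff[OF so[OF t]]
        by (simp add: is_leaf_def)
    next
      case False
      then show ?thesis
        using k_protected_root_iff[OF ex_leaf[OF so[OF t]], of k] Suc.IH[OF so[OF t]] node_keys_empty_iff[OF so[OF t]]
        by simp
    qed
    moreover have "\<not> is_leaf ?A [] \<longleftrightarrow> (\<exists>t\<in>set ts. shape_of t \<noteq> Part 0)"
    proof -
      have "(\<forall>i<length ts. node_keys (ts ! i) = {}) \<longleftrightarrow> (\<forall>t\<in>set ts. node_keys t = {})"
        using all_set_conv_all_nth[of ts "\<lambda>t. node_keys t = {}"] by blast
      then show ?thesis unfolding leafs using node_keys_empty_iff[OF so] by blast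
    qed
    moreover note all_set_conv_all_nth[of ts "\<lambda>t. shape_of t = Part 0 \<or> prot k (shape_of t)"]
    ultimately show ?thesis using ch False T by simp
  qed
  finally show ?case .
qed

lemma k_protected_Cons:
  assumes "i < length ts"
  shows "k_protected k (nonempty_nodes (Node K ts)) (i # v) \<longleftrightarrow> k_protected k (nonempty_nodes (ts ! i)) v"
  using assms by (simp add: k_protected_def node_rank_def is_leaf_Cons)

text \<open>Ranks depend only on the subtree, so the protected nodes are those of the children, plus
  possibly the root. The case k = 0 counts all nodes.\<close>

lemma card_protected:
  assumes "search_ordered T"
  shows "finite (nonempty_nodes T) \<and> real (card {v \<in> nonempty_nodes T. k_protected k (nonempty_nodes T) v})
    = node_sum (\<lambda>u. of_bool (1 \<le> keys u \<and> prot k u)) (shape_of T)"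
  using assms
proof (induction T)
  case (Node K ts)
  let ?\<phi> = "\<lambda>u. of_bool (1 \<le> keys u \<and> prot k u) :: real"
  let ?P = "\<lambda>T. {v \<in> nonempty_nodes T. k_protected k (nonempty_nodes T) v}"
  let ?T = "Node K ts"
  have so: "search_ordered (ts ! i)" if "i < length ts" for i
    using Node.prems that by (auto split: if_splits)
  have IH: "finite (nonempty_nodes (ts ! i))"
    "real (card (?P (ts ! i))) = node_sum ?\<phi> (shape_of (ts ! i))" if "i < length ts" for i
    using Node.IH[of "ts ! i"] so that by auto
  let ?R = "{v :: nat list. v = [] \<and> node_keys ?T \<noteq> {} \<and> k_protected k (nonempty_nodes ?T) []}"
  have nodes: "nonempty_nodes ?T \<subseteq> {[]} \<union> (\<Union>i<length ts. (#) i ` nonempty_nodes (ts ! i))"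
  proof
    fix v assume "v \<in> nonempty_nodes ?T"
    then show "v \<in> {[]} \<union> (\<Union>i<length ts. (#) i ` nonempty_nodes (ts ! i))"
      by (cases v) (auto simp: Cons_in_nonempty_nodes)
  qed
  have fin: "finite (nonempty_nodes ?T)"
    by (rule finite_subset[OF nodes]) (use IH in auto)
  have P: "?P ?T = ?R \<union> (\<Union>i<length ts. (#) i ` ?P (ts ! i))"
  proof (rule set_eqI)
    fix v
    show "v \<in> ?P ?T \<longleftrightarrow> v \<in> ?R \<union> (\<Union>i<length ts. (#) i ` ?P (ts ! i))"
    proof (cases v)
      case Nil
      then show ?thesis by (auto simp: Nil_in_nonempty_nodes)
    next
      case (Cons i w)
      have "v \<in> ?P ?T \<longleftrightarrow> i < length ts \<and> w \<in> ?P (ts ! i)"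
        by (auto simp: Cons Cons_in_nonempty_nodes k_protected_Cons)
      moreover have "v \<in> (\<Union>i<length ts. (#) i ` ?P (ts ! i)) \<longleftrightarrow> i < length ts \<and> w \<in> ?P (ts ! i)"
        unfolding Cons by blast
      ultimately show ?thesis by (simp add: Cons)
    qed
  qed
  have "card (?P ?T) = card ?R + card (\<Union>i<length ts. (#) i ` ?P (ts ! i))"
    unfolding P
  proof (rule card_Un_disjoint)
    show "finite (\<Union>i<length ts. (#) i ` ?P (ts ! i))" using IH(1) by auto
  qed auto
  also have "card (\<Union>i<length ts. (#) i ` ?P (ts ! i)) = (\<Sum>i<length ts. card ((#) i ` ?P (ts ! i)))"
    using IH by (intro card_UN_disjoint) auto
  also have "\<dots> = (\<Sum>i<length ts. card (?P (ts ! i)))"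
    by (intro sum.cong refl card_image) auto
  finally have "real (card (?P ?T)) = real (card ?R) + (\<Sum>i<length ts. node_sum ?\<phi> (shape_of (ts ! i)))"
    using IH by simp
  also have R: "real (card ?R) = ?\<phi> (shape_of ?T)"
  proof (cases "node_keys ?T = {}")
    case True
    then have "shape_of ?T = Part 0" using node_keys_empty_iff[OF Node.prems] by blast
    then show ?thesis using True by (simp del: shape_of.simps)
  next
    case False
    have "1 \<le> keys (shape_of ?T)"
      using False node_keys_empty_iff[OF Node.prems] empty_iff_keys[OF wf_shape_of[OF Node.prems]]
      by linarith
    then show ?thesis
      using False k_protected_root[OF Node.prems False, of k] by (simp del: shape_of.simps)
  qed
  also have "?\<phi> (shape_of ?T) + (\<Sum>i<length ts. node_sum ?\<phi> (shape_of (ts ! i))) = node_sum ?\<phi> (shape_of ?T)"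
  proof (cases "card K < m - 1")
    case True
    then have "ts = []" using Node.prems by simp
    then show ?thesis using True by simp
  next
    case False
    then show ?thesis by (simp only: shape_of.simps if_False node_sum_Full_nth) simp
  qed
  finally show ?case using fin by blast
qed

definition prot_count :: "nat \<Rightarrow> shape \<Rightarrow> real" where
  "prot_count k = node_sum (\<lambda>u. of_bool (1 \<le> keys u \<and> prot k u))"

definition prot_mean :: "nat \<Rightarrow> nat \<Rightarrow> real" where
  "prot_mean k s = shape_mean s (\<lambda>u. of_bool (prot k u))"

lemma prot_mean_bounds: "0 \<le> prot_mean k s" "prot_mean k s \<le> 1"
  using shape_mean_mono[of s "\<lambda>_. 0" "\<lambda>u. of_bool (prot k u)"] shape_mean_mono[of s "\<lambda>u. of_bool (prot k u)" "\<lambda>_. 1"]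
  by (simp_all add: prot_mean_def shape_mean_const)

lemma protected_fraction_shape:
  assumes "distinct xs"
  shows "protected_fraction k (search_tree m xs) =
    prot_count k (shape_of (build_tree m xs)) / nonempty_count (shape_of (build_tree m xs))"
proof -
  let ?T = "build_tree m xs"
  have so: "search_ordered ?T" using build_tree_ordered[OF assms] by simp
  have "real (card (nonempty_nodes ?T)) = nonempty_count (shape_of ?T)"
    using card_protected[OF so, of 0] by (simp add: k_protected_def nonempty_count_def)
  then show ?thesis
    using card_protected[OF so, of k]
    by (simp add: protected_fraction_def search_tree_def prot_count_def)
qed

end

section \<open>Uniform ranks\<close>

lemma (in prob_space) indep_sets_reindex:
  assumes "indep_sets F I" "inj_on \<pi> J" "\<pi> ` J \<subseteq> I"
  shows "indep_sets (\<lambda>j. F (\<pi> j)) J"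
proof (rule indep_setsI)
  fix j assume "j \<in> J"
  then show "F (\<pi> j) \<subseteq> events" using assms(1,3) by (auto simp: indep_sets_def)
next
  fix A K assume K: "K \<noteq> {}" "K \<subseteq> J" "finite K" and A: "\<forall>j\<in>K. A j \<in> F (\<pi> j)"
  have inj: "inj_on \<pi> K" using assms(2) K(2) by (rule inj_on_subset)
  define B where "B = A \<circ> the_inv_into K \<pi>"
  have B: "B (\<pi> j) = A j" if "j \<in> K" for j using that inj by (simp add: B_def the_inv_into_f_f)
  have "prob (\<Inter>i\<in>\<pi> ` K. B i) = (\<Prod>i\<in>\<pi> ` K. prob (B i))"
  proof (rule indep_setsD[OF assms(1)])
    show "\<pi> ` K \<subseteq> I" using K(2) assms(3) by blast
    show "\<forall>i\<in>\<pi> ` K. B i \<in> F i" using A B by simp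
  qed (use K in auto)
  then show "prob (\<Inter> (A ` K)) = (\<Prod>j\<in>K. prob (A j))"
    using B by (simp add: image_image prod.reindex[OF inj])
qed

lemma (in prob_space) indep_vars_reindex:
  assumes "indep_vars (\<lambda>_. N) X I" "inj_on \<pi> J" "\<pi> ` J \<subseteq> I"
  shows "indep_vars (\<lambda>_. N) (\<lambda>j. X (\<pi> j)) J"
  unfolding indep_vars_def2
proof
  show "\<forall>j\<in>J. X (\<pi> j) \<in> M \<rightarrow>\<^sub>M N" using assms(1,3) unfolding indep_vars_def2 by auto
  show "indep_sets (\<lambda>j. {X (\<pi> j) -` A \<inter> space M |A. A \<in> sets N}) J"
    using assms(1) indep_sets_reindex[OF _ assms(2,3)] unfolding indep_vars_def2 by fast
qed

text \<open>Any position at which y keeps the list sorted equals the rank of y; since such a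
  position exists, the converse follows.\<close>

lemma take_drop_sorted_iff:
  fixes y :: real
  assumes xs: "sorted_wrt (<) xs" and y: "y \<notin> set xs" and r: "r \<le> length xs"
  shows "card {z \<in> set xs. z < y} = r \<longleftrightarrow> sorted_wrt (<) (take r xs @ y # drop r xs)"
proof -
  have d: "distinct xs" using xs by (simp add: strict_sorted_iff)
  have split: "card {z \<in> set xs. z < y} = r"
    if s: "sorted_wrt (<) (take r xs @ y # drop r xs)" and r: "r \<le> length xs" for r
  proof -
    have "{z \<in> set xs. z < y} = set (take r xs)"
    proof -
      have "set xs = set (take r xs) \<union> set (drop r xs)"
        by (metis append_take_drop_id set_append)
      then show ?thesis using s by (auto simp: sorted_wrt_append)
    qed
    then show ?thesis using d r by (simp add: distinct_card)
  qed
  have "\<exists>r\<le>length xs. sorted_wrt (<) (take r xs @ y # drop r xs)"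
    using xs y
  proof (induction xs)
    case Nil then show ?case by simp
  next
    case (Cons x xs)
    show ?case
    proof (cases "y < x")
      case True
      then show ?thesis using Cons.prems by (intro exI[of _ 0]) auto
    next
      case False
      then have "x < y" using Cons.prems by auto
      obtain r where r: "r \<le> length xs" "sorted_wrt (<) (take r xs @ y # drop r xs)"
        using Cons by auto
      have "set (take r xs) \<union> set (drop r xs) = set xs"
        by (metis append_take_drop_id set_append)
      then have "\<forall>z\<in>set (take r xs @ y # drop r xs). x < z"
        using Cons.prems \<open>x < y\<close> by auto
      then show ?thesis using r by (intro exI[of _ "Suc r"]) simp
    qed
  qed
  then obtain r' where "r' \<le> length xs" "sorted_wrt (<) (take r' xs @ y # drop r' xs)" by blast
  then show ?thesis using split[of r'] split[of r] r by blast
qed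

text \<open>These are inversion tables: the entry at index j ranges over \<open>{..j}\<close>, so
  there are n! of them.\<close>

fun rank_codes :: "nat \<Rightarrow> nat list set" where
  "rank_codes 0 = {[]}"
| "rank_codes (Suc n) = (\<lambda>(c, r). c @ [r]) ` (rank_codes n \<times> {..n})"

text \<open>\<open>rank_code n x\<close> lists the rank of each \<open>x j\<close> among its predecessors; \<open>code_order c\<close> recovers the
  indices in increasing order of their values.\<close>

definition rank_code :: "nat \<Rightarrow> (nat \<Rightarrow> real) \<Rightarrow> nat list" where
  "rank_code n x = map (\<lambda>j. card {i \<in> {..<j}. x i < x j}) [0..<n]"

definition code_order :: "nat list \<Rightarrow> nat list" where
  "code_order c = foldl (\<lambda>L r. take r L @ length L # drop r L) [] c"

lemma code_order_snoc: "code_order (c @ [r]) =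
    take r (code_order c) @ length (code_order c) # drop r (code_order c)"
  by (simp add: code_order_def)

lemma code_order_props:
  "c \<in> rank_codes n \<Longrightarrow> length (code_order c) = n \<and> set (code_order c) = {..<n} \<and> distinct (code_order c)"
proof (induction n arbitrary: c)
  case 0 then show ?case by (simp add: code_order_def)
next
  case (Suc n)
  then obtain c' r where c: "c = c' @ [r]" "c' \<in> rank_codes n" "r \<le> n" by auto
  let ?L = "code_order c'"
  have L: "length ?L = n" "set ?L = {..<n}" "distinct ?L" using Suc.IH[OF c(2)] by auto
  have s: "set (take r ?L) \<union> set (drop r ?L) = {..<n}"
    using L(2) by (metis append_take_drop_id set_append)
  have "distinct (take r ?L @ drop r ?L)" using L(3) by simp
  moreover have "n \<notin> set (take r ?L)" "n \<notin> set (drop r ?L)" using s by blast+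
  ultimately have "distinct (code_order c)" unfolding c(1) code_order_snoc L(1)
    by (simp only: distinct_append distinct.simps list.set Int_insert_right_if0) simp
  moreover have "set (code_order c) = {..<Suc n}"
    unfolding c(1) code_order_snoc L(1) lessThan_Suc s[symmetric] by simp
  moreover have "length (code_order c) = Suc n" unfolding c(1) code_order_snoc using L(1) c(3) by simp
  ultimately show ?case by simp
qed

lemma rank_code_Suc: "rank_code (Suc n) x = rank_code n x @ [card {i \<in> {..<n}. x i < x n}]"
  by (simp add: rank_code_def)

lemma rank_le: "card {i \<in> {..<n}. x i < (x n :: real)} \<le> n"
  using card_mono[of "{..<n}" "{i \<in> {..<n}. x i < x n}"] by auto

lemma rank_values:
  fixes x :: "nat \<Rightarrow> real"
  assumes "inj_on x {..<n}"
  shows "card {z \<in> x ` {..<n}. z < y} = card {i \<in> {..<n}. x i < y}"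
proof -
  have "{z \<in> x ` {..<n}. z < y} = x ` {i \<in> {..<n}. x i < y}" by auto
  moreover have "inj_on x {i \<in> {..<n}. x i < y}" using assms by (rule inj_on_subset) auto
  ultimately show ?thesis by (simp add: card_image)
qed

lemma rank_code_in: "rank_code n x \<in> rank_codes n"
proof (induction n)
  case (Suc n)
  then show ?case unfolding rank_code_Suc rank_codes.simps
    by (intro image_eqI[where x = "(rank_code n x, card {i \<in> {..<n}. x i < x n})"]) (use rank_le[of n x] in auto)
qed (simp add: rank_code_def)

text \<open>This turns a prescribed code into an order event, whose probability is invariant under
  permutations of i.i.d. keys.\<close>

lemma rank_code_eq_iff:
  assumes "c \<in> rank_codes n" "inj_on x {..<n}"
  shows "rank_code n x = c \<longleftrightarrow> sorted_wrt (<) (map x (code_order c))"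
  using assms
proof (induction n arbitrary: c)
  case 0 then show ?case by (simp add: rank_code_def code_order_def)
next
  case (Suc n)
  then obtain c' r where c: "c = c' @ [r]" "c' \<in> rank_codes n" "r \<le> n" by auto
  let ?L = "code_order c'"
  have L: "length ?L = n" "set ?L = {..<n}" using code_order_props[OF c(2)] by auto
  have inj: "inj_on x {..<n}" using Suc.prems(2) by (rule inj_on_subset) auto
  have xn: "x n \<notin> set (map x ?L)" using inj_onD[OF Suc.prems(2), of n] L(2) by fastforce
  have ord: "map x (code_order c) = take r (map x ?L) @ x n # drop r (map x ?L)"
    unfolding c(1) code_order_snoc L(1) by (simp add: take_map drop_map)
  have sub: "sorted_wrt (<) (map x ?L)" if "sorted_wrt (<) (take r (map x ?L) @ x n # drop r (map x ?L))"
  proof -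
    have "sorted_wrt (<) (take r (map x ?L) @ drop r (map x ?L))"
      using that unfolding sorted_wrt_append by auto
    then show ?thesis by (simp only: append_take_drop_id)
  qed
  have key: "card {i \<in> {..<n}. x i < x n} = r \<longleftrightarrow> sorted_wrt (<) (take r (map x ?L) @ x n # drop r (map x ?L))"
    if "sorted_wrt (<) (map x ?L)"
    using take_drop_sorted_iff[OF that xn, of r] L c(3) rank_values[OF inj, of "x n"] by simp
  have "rank_code (Suc n) x = c \<longleftrightarrow> rank_code n x = c' \<and> card {i \<in> {..<n}. x i < x n} = r"
    unfolding rank_code_Suc c(1) by simp
  also have "\<dots> \<longleftrightarrow> sorted_wrt (<) (map x ?L) \<and> card {i \<in> {..<n}. x i < x n} = r"
    using Suc.IH[OF c(2) inj] by simp
  also have "\<dots> \<longleftrightarrow> sorted_wrt (<) (map x (code_order c))"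
    unfolding ord using key sub by blast
  finally show ?case .
qed

lemma finite_rank_codes: "finite (rank_codes n)"
  by (induction n) auto

lemma sum_rank_codes_Suc:
  "(\<Sum>c\<in>rank_codes (Suc n). g c) = (\<Sum>c\<in>rank_codes n. \<Sum>r\<le>n. g (c @ [r]))"
proof -
  have "(\<Sum>c\<in>rank_codes (Suc n). g c) = (\<Sum>p\<in>rank_codes n \<times> {..n}. g (fst p @ [snd p]))"
    unfolding rank_codes.simps
    by (subst sum.reindex) (auto simp: inj_on_def case_prod_beta comp_def)
  then show ?thesis by (simp add: sum.cartesian_product split_def)
qed

section \<open>Shapes as functions of rank codes\<close>

context search_tree_arity
begin

definition code_shape :: "nat list \<Rightarrow> shape" where
  "code_shape c = foldl (\<lambda>t r. succs t ! r) (Part 0) c"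

lemma code_shape_snoc: "code_shape (c @ [r]) = succs (code_shape c) ! r"
  by (simp add: code_shape_def)

lemma code_shape_wf: "c \<in> rank_codes n \<Longrightarrow> wf_shape (code_shape c) \<and> keys (code_shape c) = n"
proof (induction n arbitrary: c)
  case 0 then show ?case using m2 by (simp add: code_shape_def)
next
  case (Suc n)
  then obtain c' r where c: "c = c' @ [r]" "c' \<in> rank_codes n" "r \<le> n" by auto
  then show ?case using Suc.IH[OF c(2)] succs_wf_keys[of "code_shape c'" "succs (code_shape c') ! r"]
    by (simp add: code_shape_snoc length_succs)
qed

lemma code_shape_step:
  "code_shape (rank_code (Suc n) x) \<in> set (succs (code_shape (rank_code n x)))"
  using code_shape_wf[OF rank_code_in, of n x] rank_le[of n x]
  by (simp add: rank_code_Suc code_shape_snoc length_succs)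

text \<open>Choosing the next rank is choosing the next entry of \<open>succs\<close>, so codes
  enumerate insertion histories.\<close>

lemma sum_code_shape: "(\<Sum>c\<in>rank_codes n. \<Phi> (code_shape c)) = shape_sum n \<Phi>"
proof (induction n arbitrary: \<Phi>)
  case 0 then show ?case by (simp add: code_shape_def shape_sum_0)
next
  case (Suc n)
  have "(\<Sum>c\<in>rank_codes (Suc n). \<Phi> (code_shape c)) = (\<Sum>c\<in>rank_codes n. up \<Phi> (code_shape c))"
    unfolding sum_rank_codes_Suc
  proof (intro sum.cong refl)
    fix c assume c: "c \<in> rank_codes n"
    have len: "length (succs (code_shape c)) = Suc n" using code_shape_wf[OF c] length_succs by simp
    show "(\<Sum>r\<le>n. \<Phi> (code_shape (c @ [r]))) = up \<Phi> (code_shape c)"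
      unfolding up_def code_shape_snoc
      by (simp add: sum_list_sum_nth len atLeast0LessThan lessThan_Suc_atMost)
  qed
  then show ?case using Suc by (simp add: shape_sum_Suc)
qed

lemma shape_of_build_tree:
  assumes "inj_on x {..<n}"
  shows "shape_of (build_tree m (map x [0..<n])) = code_shape (rank_code n x)"
  using assms
proof (induction n)
  case 0 then show ?case using shape_of_build_tree_Nil by (simp add: code_shape_def rank_code_def)
next
  case (Suc n)
  have inj: "inj_on x {..<n}" using Suc.prems by (rule inj_on_subset) auto
  have "distinct (map x [0..<Suc n])" using Suc.prems
    by (simp add: distinct_map atLeast0LessThan del: upt_Suc)
  then show ?case
    using Suc.IH[OF inj] shape_of_build_tree_snoc[of "map x [0..<n]" "x n"] rank_values[OF inj, of "x n"]
    by (simp add: rank_code_Suc code_shape_snoc keys_rank_def atLeast0LessThan)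
qed

end

section \<open>Exchangeability of i.i.d. keys with a continuous law\<close>

locale iid_keys = prob_space M for M :: "'a measure" +
  fixes X :: "nat \<Rightarrow> 'a \<Rightarrow> real" and D :: "real measure"
  assumes X_indep: "indep_vars (\<lambda>_. borel) X UNIV"
    and X_distr: "\<And>j. distr M borel (X j) = D"
    and D_cont: "continuous_on UNIV (cdf D)"
begin

lemma X_meas [measurable]: "X j \<in> borel_measurable M"
  using X_indep by (simp add: indep_vars_def)

lemma D_prob: "prob_space D"
  using prob_space_distr[OF X_meas[of 0]] X_distr by simp

lemma D_sets: "sets D = sets borel" "space D = UNIV"
  using X_distr[of 0] by auto

lemma D_singleton: "emeasure D {x} = 0"
proof -
  interpret D: prob_space D by (rule D_prob)
  interpret D: finite_borel_measure D
    using D_sets by unfold_locales auto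
  have "isCont (cdf D) x" using D_cont by (simp add: continuous_on_eq_continuous_at)
  then show ?thesis using D.isCont_cdf by (simp add: D.emeasure_eq_measure)
qed

text \<open>By independence a pair of keys has law \<open>D \<Otimes>\<^sub>M D\<close>. The
  sections of the diagonal are single points, which are null, and there are only countably many
  pairs.\<close>

lemma AE_distinct: "AE \<omega> in M. inj (\<lambda>j. X j \<omega>)"
proof -
  have pair: "AE \<omega> in M. X i \<omega> \<noteq> X j \<omega>" if "i \<noteq> j" for i j
  proof -
    interpret D: prob_space D by (rule D_prob)
    have "indep_vars (\<lambda>_. borel) (\<lambda>b. X (case_bool i j b)) UNIV"
      by (rule indep_vars_reindex[OF X_indep]) (use that in \<open>auto simp: inj_on_def split: bool.splits\<close>)
    moreover have "(\<lambda>b. X (case_bool i j b)) = case_bool (X i) (X j)"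
      by (auto simp: fun_eq_iff split: bool.split)
    moreover have "(\<lambda>_. borel) = case_bool borel (borel :: real measure)"
      by (auto simp: fun_eq_iff split: bool.split)
    ultimately have "indep_var borel (X i) borel (X j)" unfolding indep_var_def by simp
    then have d: "distr M (borel \<Otimes>\<^sub>M borel) (\<lambda>\<omega>. (X i \<omega>, X j \<omega>)) = D \<Otimes>\<^sub>M D"
      unfolding indep_var_distribution_eq X_distr by simp
    have "{p \<in> space (borel \<Otimes>\<^sub>M borel). fst p = (snd p :: real)} \<in> sets (borel \<Otimes>\<^sub>M borel)"
      by measurable
    then have diag: "{p :: real \<times> real. fst p = snd p} \<in> sets (borel \<Otimes>\<^sub>M borel)"
      by (simp add: space_pair_measure)
    have sD: "sets (D \<Otimes>\<^sub>M D) = sets (borel \<Otimes>\<^sub>M borel)"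
      by (intro sets_pair_measure_cong D_sets)
    have "emeasure M {\<omega> \<in> space M. X i \<omega> = X j \<omega>} = emeasure (D \<Otimes>\<^sub>M D) {p. fst p = snd p}"
      unfolding d[symmetric] using diag
      by (subst emeasure_distr) (auto intro!: arg_cong[where f = "emeasure M"] simp: space_pair_measure)
    also have "\<dots> = (\<integral>\<^sup>+x. emeasure D (Pair x -` {p. fst p = snd p}) \<partial>D)"
      using diag sD by (intro D.emeasure_pair_measure_alt) simp
    also have "\<dots> = (\<integral>\<^sup>+x. 0 \<partial>D)"
    proof (intro nn_integral_cong)
      fix x :: real
      have "Pair x -` {p. fst p = snd p} = {x}" by auto
      then show "emeasure D (Pair x -` {p. fst p = snd p}) = 0" using D_singleton by simp
    qed
    finally have "emeasure M {\<omega> \<in> space M. X i \<omega> = X j \<omega>} = 0" by simp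
    then show ?thesis by (intro AE_I[of _ _ "{\<omega> \<in> space M. X i \<omega> = X j \<omega>}"]) auto
  qed
  have "AE \<omega> in M. \<forall>i j. i \<noteq> j \<longrightarrow> X i \<omega> \<noteq> X j \<omega>"
    unfolding AE_all_countable using pair by auto
  then show ?thesis by (rule AE_mp) (auto simp: inj_def)
qed

lemma order_event_sets [measurable]:
  "{\<omega> \<in> space M. sorted_wrt (<) (map (\<lambda>j. X j \<omega>) L)} \<in> sets M"
  unfolding sorted_wrt_iff_nth_less by simp

text \<open>Any n distinct keys, in any order, have the same product law, so each order event has
  the probability of its standard form.\<close>

lemma prob_order:
  assumes "distinct L" "length L = n"
  shows "prob {\<omega> \<in> space M. sorted_wrt (<) (map (\<lambda>j. X j \<omega>) L)}
    = prob {\<omega> \<in> space M. sorted_wrt (<) (map (\<lambda>j. X j \<omega>) [0..<n])}"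
proof (cases "n = 0")
  \<comment> \<open>The product-law characterisation of independence is for a nonempty index set,
    hence the separate case n = 0.\<close>
  case False
  have *: "prob {\<omega> \<in> space M. sorted_wrt (<) (map (\<lambda>j. X j \<omega>) L)}
    = measure (PiM {..<n} (\<lambda>_. D)) {f \<in> space (PiM {..<n} (\<lambda>_. borel)). sorted_wrt (<) (map f [0..<n])}"
    if L: "distinct L" "length L = n" for L
  proof -
    let ?V = "\<lambda>\<omega>. \<lambda>i\<in>{..<n}. X (L ! i) \<omega>"
    have iv: "indep_vars (\<lambda>_. borel) (\<lambda>i. X (L ! i)) {..<n}"
      by (rule indep_vars_reindex[OF X_indep]) (use L in \<open>auto simp: inj_on_def nth_eq_iff_index_eq\<close>)
    then have d: "distr M (PiM {..<n} (\<lambda>_. borel)) ?V = PiM {..<n} (\<lambda>_. D)"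
      using False by (subst (asm) indep_vars_iff_distr_eq_PiM') (auto simp: X_distr lessThan_empty_iff)
    have S: "{f \<in> space (PiM {..<n} (\<lambda>_. borel)). sorted_wrt (<) (map f [0..<n])}
        \<in> sets (PiM {..<n} (\<lambda>_. borel :: real measure))"
      unfolding sorted_wrt_iff_nth_less by (simp cong: conj_cong)
    have V: "?V \<in> measurable M (PiM {..<n} (\<lambda>_. borel))" by measurable
    have "map (\<lambda>j. X j \<omega>) L = map (?V \<omega>) [0..<n]" for \<omega>
      using L by (intro nth_equalityI) auto
    then show ?thesis unfolding d[symmetric] measure_distr[OF V S]
      by (intro arg_cong[where f = prob]) (auto simp: space_PiM)
  qed
  show ?thesis using *[OF assms] *[of "[0..<n]"] by simp
qed (use assms in simp)

definition key_seq :: "'a \<Rightarrow> nat \<Rightarrow> real" where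
  "key_seq \<omega> = (\<lambda>j. X j \<omega>)"

lemma rank_code_event_sets: "{\<omega> \<in> space M. rank_code n (key_seq \<omega>) = c} \<in> sets M"
proof -
  \<comment> \<open>Cardinalities are rewritten as finite sums of indicators, which are visibly
    measurable.\<close>
  have "rank_code n (key_seq \<omega>) = c \<longleftrightarrow> length c = n \<and>
      (\<forall>j<n. (\<Sum>i<j. if X i \<omega> < X j \<omega> then 1 else 0 :: real) = real (c ! j))" for \<omega>
  proof -
    have "(\<Sum>i<j. if X i \<omega> < X j \<omega> then 1 else 0 :: real) = real (card {i \<in> {..<j}. X i \<omega> < X j \<omega>})" for j
      by (simp add: sum.If_cases Int_def)
    then show ?thesis by (auto simp: rank_code_def key_seq_def list_eq_iff_nth_eq)
  qed
  then show ?thesis by simp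
qed

end

section \<open>Almost sure convergence\<close>

context iid_keys
begin

lemma prob_rank_code_eq_order:
  assumes "c \<in> rank_codes n"
  shows "prob {\<omega> \<in> space M. rank_code n (key_seq \<omega>) = c}
    = prob {\<omega> \<in> space M. sorted_wrt (<) (map (\<lambda>j. X j \<omega>) [0..<n])}"
proof -
  have "prob {\<omega> \<in> space M. rank_code n (key_seq \<omega>) = c}
      = prob {\<omega> \<in> space M. sorted_wrt (<) (map (\<lambda>j. X j \<omega>) (code_order c))}"
  proof (rule finite_measure_eq_AE)
    show "AE \<omega> in M. \<omega> \<in> {\<omega> \<in> space M. rank_code n (key_seq \<omega>) = c}
        \<longleftrightarrow> \<omega> \<in> {\<omega> \<in> space M. sorted_wrt (<) (map (\<lambda>j. X j \<omega>) (code_order c))}"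
      using AE_distinct
    proof (rule AE_mp, intro AE_I2 impI)
      fix \<omega> assume "inj (\<lambda>j. X j \<omega>)"
      then have "inj_on (key_seq \<omega>) {..<n}" unfolding key_seq_def by (rule inj_on_subset) auto
      then show "\<omega> \<in> {\<omega> \<in> space M. rank_code n (key_seq \<omega>) = c}
        \<longleftrightarrow> \<omega> \<in> {\<omega> \<in> space M. sorted_wrt (<) (map (\<lambda>j. X j \<omega>) (code_order c))}"
        using rank_code_eq_iff[OF assms] by (simp add: key_seq_def)
    qed
  qed (rule rank_code_event_sets order_event_sets)+
  then show ?thesis using prob_order[of "code_order c" n] code_order_props[OF assms] by simp
qed

lemma prob_rank_code:
  assumes "c \<in> rank_codes n"
  shows "prob {\<omega> \<in> space M. rank_code n (key_seq \<omega>) = c} = 1 / real (card (rank_codes n))"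
proof -
  define p where "p = prob {\<omega> \<in> space M. sorted_wrt (<) (map (\<lambda>j. X j \<omega>) [0..<n])}"
  have "1 = prob (\<Union>c\<in>rank_codes n. {\<omega> \<in> space M. rank_code n (key_seq \<omega>) = c})"
  proof -
    have "(\<Union>c\<in>rank_codes n. {\<omega> \<in> space M. rank_code n (key_seq \<omega>) = c}) = space M"
      using rank_code_in by auto
    then show ?thesis by (simp add: prob_space)
  qed
  also have "\<dots> = (\<Sum>c\<in>rank_codes n. prob {\<omega> \<in> space M. rank_code n (key_seq \<omega>) = c})"
    by (intro finite_measure_finite_Union finite_rank_codes)
       (auto simp: disjoint_family_on_def rank_code_event_sets)
  also have "\<dots> = real (card (rank_codes n)) * p"
    using prob_rank_code_eq_order by (simp add: p_def)
  finally have "real (card (rank_codes n)) * p = 1" by simp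
  then have "p = 1 / real (card (rank_codes n))"
    by (cases "card (rank_codes n) = 0") (auto simp: field_simps)
  then show ?thesis using prob_rank_code_eq_order[OF assms] by (simp add: p_def)
qed

end

locale random_search_tree = search_tree_arity m + iid_keys M X D
  for m :: nat and M :: "'a measure" and X :: "nat \<Rightarrow> 'a \<Rightarrow> real" and D :: "real measure"
begin

text \<open>Defined from the rank code rather than from the tree, so that well-formedness and the
  growth step hold at every \<omega>, even when keys coincide. It is the shape of the tree whenever
  the keys are distinct.\<close>

definition rshape :: "nat \<Rightarrow> 'a \<Rightarrow> shape" where
  "rshape n \<omega> = code_shape (rank_code n (key_seq \<omega>))"

lemma rshape_wf: "wf_shape (rshape n \<omega>)" "keys (rshape n \<omega>) = n"
  using code_shape_wf[OF rank_code_in] by (auto simp: rshape_def)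

lemma rshape_Suc: "rshape (Suc n) \<omega> \<in> set (succs (rshape n \<omega>))"
  unfolding rshape_def by (rule code_shape_step)

text \<open>The shape is determined by one of finitely many codes, so any \<Phi> of it is a simple
  function. This gives measurability and expectations without a \<sigma>-algebra on shapes.\<close>

lemma rshape_expand:
  assumes "\<omega> \<in> space M"
  shows "(\<Sum>c\<in>rank_codes n. \<Phi> (code_shape c) * indicator {\<omega> \<in> space M. rank_code n (key_seq \<omega>) = c} \<omega>)
    = (\<Phi> (rshape n \<omega>) :: real)"
proof -
  have "(\<Sum>c\<in>rank_codes n. \<Phi> (code_shape c) * indicator {\<omega> \<in> space M. rank_code n (key_seq \<omega>) = c} \<omega>)
    = (\<Sum>c\<in>rank_codes n. if c = rank_code n (key_seq \<omega>) then \<Phi> (code_shape c) else 0)"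
    using assms by (intro sum.cong) (auto simp: indicator_def)
  then show ?thesis using rank_code_in finite_rank_codes by (simp add: rshape_def)
qed

lemma rshape_measurable [measurable]: "(\<lambda>\<omega>. \<Phi> (rshape n \<omega>) :: real) \<in> borel_measurable M"
  by (subst measurable_cong[OF rshape_expand[symmetric]])
     (assumption, intro borel_measurable_sum borel_measurable_times borel_measurable_const
       borel_measurable_indicator rank_code_event_sets)

lemma has_bochner_integral_rshape:
  "has_bochner_integral M (\<lambda>\<omega>. \<Phi> (rshape n \<omega>)) (shape_mean n \<Phi>)"
proof -
  let ?E = "\<lambda>c. {\<omega> \<in> space M. rank_code n (key_seq \<omega>) = c}"
  have "has_bochner_integral M (\<lambda>\<omega>. \<Sum>c\<in>rank_codes n. \<Phi> (code_shape c) * indicator (?E c) \<omega>)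
      (\<Sum>c\<in>rank_codes n. \<Phi> (code_shape c) * prob (?E c))"
    using rank_code_event_sets
    by (intro has_bochner_integral_sum has_bochner_integral_mult_right has_bochner_integral_real_indicator)
       (auto simp: less_top[symmetric])
  moreover have "(\<Sum>c\<in>rank_codes n. \<Phi> (code_shape c) * prob (?E c)) = shape_mean n \<Phi>"
  proof -
    have card: "real (card (rank_codes n)) = fact n"
      using sum_code_shape[of "\<lambda>_. 1" n] by (simp add: shape_sum_def sum_list_triv length_shapes)
    have "(\<Sum>c\<in>rank_codes n. \<Phi> (code_shape c) * prob (?E c)) = (\<Sum>c\<in>rank_codes n. \<Phi> (code_shape c)) / fact n"
      unfolding sum_divide_distrib by (intro sum.cong refl) (simp add: prob_rank_code card)
    then show ?thesis by (simp add: sum_code_shape shape_mean_def)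
  qed
  ultimately show ?thesis
    by (subst has_bochner_integral_cong[OF refl rshape_expand[symmetric] refl]) simp_all
qed

lemma nn_integral_rshape:
  assumes "\<And>t. 0 \<le> \<Phi> t"
  shows "(\<integral>\<^sup>+\<omega>. ennreal (\<Phi> (rshape n \<omega>)) \<partial>M) = ennreal (shape_mean n \<Phi>)"
  using has_bochner_integral_rshape[of \<Phi> n] assms
  by (subst nn_integral_eq_integral) (auto simp: has_bochner_integral_iff)

end

text \<open>Between k^q and (k + 1)^q the sequence moves by at most B ((k + 1)^q - k^q), which is
  o(k^q).\<close>

lemma bounded_increments_interpolate:
  fixes b :: "nat \<Rightarrow> real"
  assumes inc: "\<And>n. \<bar>b (Suc n) - b n\<bar> \<le> B" and q: "0 < q"
    and lim: "(\<lambda>k. b (k ^ q) / (real (k ^ q) + 1)) \<longlonglongrightarrow> 0"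
  shows "(\<lambda>n. b n / (real n + 1)) \<longlonglongrightarrow> 0"
proof -
  have B0: "0 \<le> B" using inc[of 0] by linarith
  have inc': "\<bar>b (n + d) - b n\<bar> \<le> B * real d" for n d
  proof (induction d)
    case (Suc d)
    have "\<bar>b (n + Suc d) - b n\<bar> \<le> \<bar>b (Suc (n + d)) - b (n + d)\<bar> + \<bar>b (n + d) - b n\<bar>" by simp
    then show ?case using inc[of "n + d"] Suc by (simp add: distrib_left)
  qed simp
  \<comment> \<open>The integer part of the q-th root of n.\<close>
  define K where "K n = (GREATEST k. k ^ q \<le> n)" for n :: nat
  have bound: "k \<le> n" if "k ^ q \<le> n" for k n :: nat
    using that self_le_power[of k q] q by (cases "k = 0") auto
  have K: "K n ^ q \<le> n" for n
    unfolding K_def by (rule GreatestI_nat[of _ 0 n]) (use bound q in \<open>auto simp: power_0_left\<close>)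
  have K_max: "k \<le> K n" if "k ^ q \<le> n" for k n
    unfolding K_def by (rule Greatest_le_nat[of _ _ n]) (use bound that in auto)
  have K_less: "n < Suc (K n) ^ q" for n
    using K_max[of "Suc (K n)" n] by (cases "Suc (K n) ^ q \<le> n") auto
  have K_lim: "filterlim K at_top sequentially"
    unfolding filterlim_at_top eventually_sequentially using K_max by meson
  define g where "g k = \<bar>b (k ^ q) / (real (k ^ q) + 1)\<bar> + B * ((1 + 1 / real k) ^ q - 1)" for k
  have "(\<lambda>k. 1 + 1 / real k) \<longlonglongrightarrow> 1 + 0"
    by (intro tendsto_add tendsto_const lim_1_over_n)
  then have "(\<lambda>k. (1 + 1 / real k) ^ q) \<longlonglongrightarrow> (1 + 0) ^ q" by (rule tendsto_power)
  then have "(\<lambda>k. B * ((1 + 1 / real k) ^ q - 1)) \<longlonglongrightarrow> B * (1 - 1)"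
    by (intro tendsto_mult tendsto_diff tendsto_const) simp
  then have "g \<longlonglongrightarrow> 0 + 0" unfolding g_def
    using tendsto_rabs_zero[OF lim] by (intro tendsto_add) auto
  then have "(\<lambda>n. g (K n)) \<longlonglongrightarrow> 0" using K_lim by (simp add: filterlim_compose)
  then show ?thesis
  proof (rule Lim_null_comparison[rotated])
    have "norm (b n / (real n + 1)) \<le> g (K n)" if "1 \<le> n" for n
    proof -
      let ?k = "K n"
      have k: "1 \<le> ?k" using K_max[of 1 n] that by simp
      have kn: "real (?k ^ q) \<le> real n" using K[of n] of_nat_le_iff by blast
      have "\<bar>b n\<bar> \<le> \<bar>b (?k ^ q)\<bar> + B * (real n - real (?k ^ q))"
        using inc'[of "?k ^ q" "n - ?k ^ q"] K[of n] by (simp add: of_nat_diff)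
      also have "\<dots> \<le> \<bar>b (?k ^ q)\<bar> + B * (real (Suc ?k ^ q) - real (?k ^ q))"
      proof (intro add_left_mono mult_left_mono diff_right_mono B0)
        show "real n \<le> real (Suc ?k ^ q)" using less_imp_le[OF K_less[of n]] of_nat_le_iff by blast
      qed
      finally have bn: "\<bar>b n\<bar> \<le> \<bar>b (?k ^ q)\<bar> + B * (real (Suc ?k ^ q) - real (?k ^ q))" .
      have "\<bar>b n\<bar> / (real n + 1) \<le> (\<bar>b (?k ^ q)\<bar> + B * (real (Suc ?k ^ q) - real (?k ^ q))) / (real (?k ^ q) + 1)"
      proof (rule frac_le)
        show "0 < real (?k ^ q) + 1" by (rule add_nonneg_pos) auto
        show "0 \<le> \<bar>b (?k ^ q)\<bar> + B * (real (Suc ?k ^ q) - real (?k ^ q))"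
          using bn by (meson abs_ge_zero order_trans)
      qed (use kn bn in auto)
      also have "\<dots> = \<bar>b (?k ^ q) / (real (?k ^ q) + 1)\<bar> + B * ((real (Suc ?k ^ q) - real (?k ^ q)) / (real (?k ^ q) + 1))"
        by (simp add: add_divide_distrib)
      also have "\<dots> \<le> g ?k"
      proof -
        have "(real (Suc ?k ^ q) - real (?k ^ q)) / (real (?k ^ q) + 1) \<le> (real (Suc ?k ^ q) - real (?k ^ q)) / real (?k ^ q)"
        proof (rule divide_left_mono)
          have "0 < real (?k ^ q)" using k by simp
          then show "0 < (real (?k ^ q) + 1) * real (?k ^ q)" by (intro mult_pos_pos) linarith+
        qed (auto intro: power_mono)
        also have "\<dots> = (1 + 1 / real ?k) ^ q - 1"
        proof -
          have "1 + 1 / real ?k = real (Suc ?k) / real ?k" using k by (simp add: field_simps)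
          then show ?thesis using k by (simp add: power_divide diff_divide_distrib)
        qed
        finally show ?thesis unfolding g_def by (intro add_left_mono mult_left_mono B0)
      qed
      finally show ?thesis by simp
    qed
    then show "\<forall>\<^sub>F n in sequentially. norm (b n / (real n + 1)) \<le> g (K n)"
      unfolding eventually_sequentially by blast
  qed
qed

section \<open>From mean square to almost sure convergence\<close>

context random_search_tree
begin

lemma l2_conv_imp_AE:
  assumes l2: "l2_conv p G c" and p: "p < 2" and incr: "bounded_incr G"
  shows "AE \<omega> in M. (\<lambda>n. G (rshape n \<omega>) / (real n + 1)) \<longlonglongrightarrow> c"
proof -
  obtain C where C: "0 \<le> C"
    "\<And>n. shape_mean n (\<lambda>t. (G t - c * (real n + 1))\<^sup>2) \<le> C * (real n + 1) powr p"
    using l2 unfolding l2_conv_def by blast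
  obtain B where B: "\<And>t x. wf_shape t \<Longrightarrow> x \<in> set (succs t) \<Longrightarrow> \<bar>G x - G t\<bar> \<le> B"
    using incr unfolding bounded_incr_def by blast
  \<comment> \<open>The choice gives q (2 - p) > 2, so the normalised second moments along k^q are
    O(1 / k^2). They are summable, and Tonelli makes the random series finite almost surely.\<close>
  obtain q :: nat where q: "2 / (2 - p) < real q" using reals_Archimedean2 by blast
  have q0: "0 < q" using q p by (cases q) auto
  have q2: "real q * (p - 2) \<le> - 2" using q p by (simp add: field_simps)
  define \<Psi> where "\<Psi> k t = ((G t - c * (real (k ^ q) + 1)) / (real (k ^ q) + 1))\<^sup>2" for k t
  have mean: "shape_mean (k ^ q) (\<Psi> k) \<le> C * (1 / real k ^ 2)" if k: "1 \<le> k" for k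
  proof -
    let ?N = "real (k ^ q) + 1"
    have "shape_mean (k ^ q) (\<Psi> k) = (1 / ?N\<^sup>2) * shape_mean (k ^ q) (\<lambda>t. (G t - c * ?N)\<^sup>2)"
      unfolding shape_mean_cmult[symmetric] \<Psi>_def by (simp add: power_divide)
    also have "\<dots> \<le> (1 / ?N\<^sup>2) * (C * ?N powr p)"
      using C(2)[of "k ^ q"] by (intro mult_left_mono) auto
    also have "\<dots> = C * ?N powr (p - 2)"
    proof -
      have "0 < ?N" by (rule add_nonneg_pos) auto
      then show ?thesis by (simp add: powr_diff powr_numeral)
    qed
    also have "\<dots> \<le> C * (real k powr real q) powr (p - 2)"
      using C(1) p k by (intro mult_left_mono powr_mono2') (auto simp: powr_realpow)
    also have "\<dots> = C * real k powr (real q * (p - 2))" by (simp add: powr_powr)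
    also have "\<dots> \<le> C * real k powr (- 2)"
      using C(1) k q2 by (intro mult_left_mono powr_mono) auto
    also have "real k powr (- 2) = 1 / real k ^ 2"
      using k by (simp add: powr_minus powr_numeral divide_simps)
    finally show ?thesis .
  qed
  have summ: "summable (\<lambda>k. shape_mean (k ^ q) (\<Psi> k))"
  proof (rule summable_comparison_test'[where N = 1])
    show "summable (\<lambda>k. C * (1 / real k ^ 2))"
      using inverse_power_summable[of 2, where ?'a = real] by (intro summable_mult) (simp add: field_simps)
    show "norm (shape_mean (k ^ q) (\<Psi> k)) \<le> C * (1 / real k ^ 2)" if "1 \<le> k" for k
      using mean[OF that] shape_mean_nonneg[of "k ^ q" "\<Psi> k"] by (simp add: \<Psi>_def)
  qed
  have "(\<integral>\<^sup>+\<omega>. (\<Sum>k. ennreal (\<Psi> k (rshape (k ^ q) \<omega>))) \<partial>M) = (\<Sum>k. ennreal (shape_mean (k ^ q) (\<Psi> k)))"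
  proof (subst nn_integral_suminf)
    show "(\<lambda>\<omega>. ennreal (\<Psi> k (rshape (k ^ q) \<omega>))) \<in> borel_measurable M" for k
      by (intro measurable_compose[OF rshape_measurable measurable_ennreal])
    have "(\<integral>\<^sup>+\<omega>. ennreal (\<Psi> k (rshape (k ^ q) \<omega>)) \<partial>M) = ennreal (shape_mean (k ^ q) (\<Psi> k))" for k
      by (rule nn_integral_rshape) (simp add: \<Psi>_def)
    then show "(\<Sum>k. \<integral>\<^sup>+\<omega>. ennreal (\<Psi> k (rshape (k ^ q) \<omega>)) \<partial>M) = (\<Sum>k. ennreal (shape_mean (k ^ q) (\<Psi> k)))"
      by simp
  qed
  also have "\<dots> \<noteq> \<infinity>"
    using summ by (subst suminf_ennreal2) (auto simp: \<Psi>_def intro!: shape_mean_nonneg)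
  finally have "AE \<omega> in M. (\<Sum>k. ennreal (\<Psi> k (rshape (k ^ q) \<omega>))) \<noteq> \<infinity>"
    by (intro nn_integral_PInf_AE) auto
  then show ?thesis
  proof (rule AE_mp, intro AE_I2 impI)
    fix \<omega> assume fin: "(\<Sum>k. ennreal (\<Psi> k (rshape (k ^ q) \<omega>))) \<noteq> \<infinity>"
    have "summable (\<lambda>k. \<Psi> k (rshape (k ^ q) \<omega>))"
      by (rule summable_suminf_not_top) (use fin in \<open>auto simp: \<Psi>_def\<close>)
    then have "(\<lambda>k. \<Psi> k (rshape (k ^ q) \<omega>)) \<longlonglongrightarrow> 0" by (rule summable_LIMSEQ_zero)
    then have "(\<lambda>k. sqrt (\<Psi> k (rshape (k ^ q) \<omega>))) \<longlonglongrightarrow> sqrt 0" by (rule tendsto_real_sqrt)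
    then have sub: "(\<lambda>k. (G (rshape (k ^ q) \<omega>) - c * (real (k ^ q) + 1)) / (real (k ^ q) + 1)) \<longlonglongrightarrow> 0"
      unfolding \<Psi>_def by (simp only: real_sqrt_abs real_sqrt_zero tendsto_rabs_zero_iff)
    have "(\<lambda>n. (G (rshape n \<omega>) - c * (real n + 1)) / (real n + 1)) \<longlonglongrightarrow> 0"
    proof (rule bounded_increments_interpolate[OF _ q0])
      show "\<bar>(G (rshape (Suc n) \<omega>) - c * (real (Suc n) + 1)) - (G (rshape n \<omega>) - c * (real n + 1))\<bar> \<le> B + \<bar>c\<bar>" for n
        using B[OF rshape_wf(1) rshape_Suc, of n \<omega>] by (simp add: algebra_simps)
    qed (rule sub)
    then have "(\<lambda>n. (G (rshape n \<omega>) - c * (real n + 1)) / (real n + 1) + c) \<longlonglongrightarrow> 0 + c"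
      by (intro tendsto_add tendsto_const)
    moreover have "(G (rshape n \<omega>) - c * (real n + 1)) / (real n + 1) + c = G (rshape n \<omega>) / (real n + 1)" for n
      by (simp add: diff_divide_distrib add.commute[of _ 1])
    ultimately show "(\<lambda>n. G (rshape n \<omega>) / (real n + 1)) \<longlonglongrightarrow> c" by simp
  qed
qed

text \<open>Of the nodes with more than S keys in their subtree, anything between none and all may
  be protected.\<close>

lemma prot_count_bounds:
  fixes k :: nat
  assumes "wf_shape t"
  defines "A \<equiv> \<lambda>S. \<Sum>s=1..S. node_sum (at_size s (\<lambda>u. of_bool (prot k u))) t"
  shows "A S \<le> prot_count k t" "prot_count k t \<le> A S + (nonempty_count t - (\<Sum>s=1..S. size_count s t))"
proof -
  have A: "A S = node_sum (\<lambda>u. \<Sum>s=1..S. at_size s (\<lambda>u. of_bool (prot k u)) u) t"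
    by (simp add: A_def node_sum_sum)
  have pick: "(\<Sum>s=1..S. at_size s \<phi> u) = (if 1 \<le> keys u \<and> keys u \<le> S then \<phi> u else 0)" for \<phi> u
    unfolding at_size_def by (subst sum.delta') auto
  show "A S \<le> prot_count k t"
    unfolding A prot_count_def pick by (rule node_sum_mono[OF _ assms(1)]) auto
  have "prot_count k t + (\<Sum>s=1..S. size_count s t) \<le> A S + nonempty_count t"
    unfolding A prot_count_def size_count_def nonempty_count_def node_sum_sum[symmetric] node_sum_add[symmetric] pick
    by (rule node_sum_mono[OF _ assms(1)]) auto
  then show "prot_count k t \<le> A S + (nonempty_count t - (\<Sum>s=1..S. size_count s t))" by simp
qed

end

text \<open>Telescoping, as each term is 2 / (s + 1) - 2 / (s + 2). The remainder is the limiting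
  share of nodes with more than S keys below or in them.\<close>

lemma sum_size_weights: "(\<Sum>s=1..S. 2 / ((real s + 1) * (real s + 2))) = 1 - 2 / (real S + 2)"
proof (induction S)
  case (Suc S)
  have "1 - 2 / (x + 2) + 2 / ((x + 2) * (x + 3)) = 1 - 2 / (x + 3)" if "0 \<le> x" for x :: real
    using that by (simp add: divide_simps) (simp add: algebra_simps)
  from this[of "real S"] show ?case using Suc by (simp add: add_ac)
qed simp

lemma sum_size_weights_1: "(\<lambda>s. 2 / ((real (Suc s) + 1) * (real (Suc s) + 2))) sums 1"
proof -
  have "(\<Sum>s<S. 2 / ((real (Suc s) + 1) * (real (Suc s) + 2))) = 1 - 2 / (real S + 2)" for S
  proof -
    have "(\<Sum>s=1..S. 2 / ((real s + 1) * (real s + 2))) = (\<Sum>s<S. 2 / ((real (Suc s) + 1) * (real (Suc s) + 2)))"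
      by (rule sum.reindex_bij_witness[of _ Suc "\<lambda>s. s - 1"]) auto
    then show ?thesis using sum_size_weights[of S] by simp
  qed
  moreover have "(\<lambda>S. 1 - 2 / (real S + 2)) \<longlonglongrightarrow> 1" by real_asymp
  ultimately show ?thesis unfolding sums_def by simp
qed

text \<open>At s = 0 the value is 1, matching the equal limits for empty and nonempty nodes; the
  weights with s \<ge> 1 form a probability distribution.\<close>

definition size_weight :: "nat \<Rightarrow> real" where
  "size_weight s = 2 / ((real s + 1) * (real s + 2))"

lemma size_weight_nonneg: "0 \<le> size_weight s"
  by (simp add: size_weight_def)

context search_tree_arity
begin

lemma summable_prot_weights: "summable (\<lambda>s. size_weight (Suc s) * prot_mean k (Suc s))"
proof (rule summable_comparison_test')
  show "summable (\<lambda>s. size_weight (Suc s))"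
    using sums_summable[OF sum_size_weights_1] by (simp add: size_weight_def)
  show "norm (size_weight (Suc s) * prot_mean k (Suc s)) \<le> size_weight (Suc s)" for s
    using prot_mean_bounds[of k "Suc s"] size_weight_nonneg[of "Suc s"]
    by (simp add: abs_mult mult_left_le)
qed

end

section \<open>Almost sure limit of the protected fraction\<close>

context random_search_tree
begin

lemma AE_protected_fraction:
  "AE \<omega> in M. (\<lambda>n. protected_fraction k (search_tree m (map (\<lambda>j. X j \<omega>) [0..<n])))
      \<longlonglongrightarrow> (\<Sum>s. size_weight (Suc s) * prot_mean k (Suc s))"
proof -
  let ?\<phi> = "\<lambda>u. of_bool (prot k u) :: real"
  let ?L = "\<Sum>s. size_weight (Suc s) * prot_mean k (Suc s)"
  have "AE \<omega> in M. (\<lambda>n. node_sum (at_size s ?\<phi>) (rshape n \<omega>) / (real n + 1))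
      \<longlonglongrightarrow> empty_limit * (size_weight s * prot_mean k s)" for s
  proof (rule l2_conv_imp_AE)
    show "l2_conv rate_exp (node_sum (at_size s ?\<phi>)) (empty_limit * (size_weight s * prot_mean k s))"
      using l2_conv_at_size[of ?\<phi> 1 s] by (simp add: size_weight_def prot_mean_def mult_ac)
    show "bounded_incr (node_sum (at_size s ?\<phi>))" by (rule bounded_incr_at_size[of _ 1]) simp
  qed (rule rate_exp_bounds)
  then have 1: "AE \<omega> in M. \<forall>s. (\<lambda>n. node_sum (at_size s ?\<phi>) (rshape n \<omega>) / (real n + 1))
      \<longlonglongrightarrow> empty_limit * (size_weight s * prot_mean k s)" by (simp add: AE_all_countable)
  have "AE \<omega> in M. (\<lambda>n. size_count s (rshape n \<omega>) / (real n + 1)) \<longlonglongrightarrow> empty_limit * size_weight s" for s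
  proof (rule l2_conv_imp_AE)
    show "l2_conv rate_exp (size_count s) (empty_limit * size_weight s)"
      using l2_conv_at_size[of "\<lambda>_. 1" 1 s]
      by (simp add: size_weight_def size_count_def shape_mean_const mult_ac)
  qed (rule rate_exp_bounds bounded_incr_size_count)+
  then have 2: "AE \<omega> in M. \<forall>s. (\<lambda>n. size_count s (rshape n \<omega>) / (real n + 1)) \<longlonglongrightarrow> empty_limit * size_weight s"
    by (simp add: AE_all_countable)
  have 3: "AE \<omega> in M. (\<lambda>n. nonempty_count (rshape n \<omega>) / (real n + 1)) \<longlonglongrightarrow> empty_limit"
    by (rule l2_conv_imp_AE[OF l2_conv_nonempty_count rate_exp_bounds(2) bounded_incr_nonempty_count])
  show ?thesis
    using AE_distinct 1 2 3
  proof eventually_elim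
    fix \<omega>
    assume inj: "inj (\<lambda>j. X j \<omega>)"
      and P: "\<forall>s. (\<lambda>n. node_sum (at_size s ?\<phi>) (rshape n \<omega>) / (real n + 1))
        \<longlonglongrightarrow> empty_limit * (size_weight s * prot_mean k s)"
      and C: "\<forall>s. (\<lambda>n. size_count s (rshape n \<omega>) / (real n + 1)) \<longlonglongrightarrow> empty_limit * size_weight s"
      and N: "(\<lambda>n. nonempty_count (rshape n \<omega>) / (real n + 1)) \<longlonglongrightarrow> empty_limit"
    define t where "t n = rshape n \<omega>" for n
    define a where "a S n = (\<Sum>s=1..S. node_sum (at_size s ?\<phi>) (t n)) / nonempty_count (t n)" for S n
    define e where "e S n = (nonempty_count (t n) - (\<Sum>s=1..S. size_count s (t n))) / nonempty_count (t n)" for S n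
    define r where "r n = prot_count k (t n) / nonempty_count (t n)" for n
    define l where "l S = (\<Sum>s=1..S. size_weight s * prot_mean k s)" for S
    have rescale: "x / y = (x / (real n + 1)) / (y / (real n + 1))" for x y :: real and n :: nat
    proof -
      have "real n + 1 \<noteq> 0" by linarith
      then show ?thesis by simp
    qed
    have a: "a S \<longlonglongrightarrow> l S" for S
    proof -
      have "(\<lambda>n. (\<Sum>s=1..S. node_sum (at_size s ?\<phi>) (t n) / (real n + 1)) / (nonempty_count (t n) / (real n + 1)))
        \<longlonglongrightarrow> (\<Sum>s=1..S. empty_limit * (size_weight s * prot_mean k s)) / empty_limit"
        unfolding t_def using P N empty_limit_pos by (intro tendsto_divide tendsto_sum) auto
      moreover have "(\<Sum>s=1..S. empty_limit * (size_weight s * prot_mean k s)) / empty_limit = l S"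
        using empty_limit_pos by (simp add: l_def sum_distrib_left[symmetric])
      moreover have "(\<Sum>s=1..S. node_sum (at_size s ?\<phi>) (t n) / (real n + 1)) / (nonempty_count (t n) / (real n + 1)) = a S n" for n
        unfolding a_def sum_divide_distrib[symmetric] by (rule rescale[symmetric])
      ultimately show ?thesis by (simp only:)
    qed
    have e: "e S \<longlonglongrightarrow> 2 / (real S + 2)" for S
    proof -
      have "(\<lambda>n. (nonempty_count (t n) / (real n + 1) - (\<Sum>s=1..S. size_count s (t n) / (real n + 1))) / (nonempty_count (t n) / (real n + 1)))
        \<longlonglongrightarrow> (empty_limit - (\<Sum>s=1..S. empty_limit * size_weight s)) / empty_limit"
        unfolding t_def using C N empty_limit_pos by (intro tendsto_divide tendsto_diff tendsto_sum) auto
      moreover have "(empty_limit - (\<Sum>s=1..S. empty_limit * size_weight s)) / empty_limit = 2 / (real S + 2)"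
      proof -
        have "(\<Sum>s=1..S. empty_limit * size_weight s) = empty_limit * (1 - 2 / (real S + 2))"
          unfolding sum_distrib_left[symmetric] size_weight_def sum_size_weights ..
        then show ?thesis using empty_limit_pos by (simp only:) (simp add: right_diff_distrib)
      qed
      moreover have "(nonempty_count (t n) / (real n + 1) - (\<Sum>s=1..S. size_count s (t n) / (real n + 1))) / (nonempty_count (t n) / (real n + 1)) = e S n" for n
        unfolding e_def sum_divide_distrib[symmetric] diff_divide_distrib[symmetric] by (rule rescale[symmetric])
      ultimately show ?thesis by (simp only:)
    qed
    have "eventually (\<lambda>n. 0 < nonempty_count (t n) / (real n + 1)) sequentially"
      using order_tendstoD(1)[OF N empty_limit_pos] by (simp add: t_def)
    then have pos: "eventually (\<lambda>n. 0 < nonempty_count (t n)) sequentially"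
      by eventually_elim (simp add: zero_less_divide_iff)
    have sandwich: "eventually (\<lambda>n. a S n \<le> r n \<and> r n \<le> a S n + e S n) sequentially" for S
      using pos
    proof eventually_elim
      case (elim n)
      then show ?case
        using prot_count_bounds[OF rshape_wf(1)[of n \<omega>], of k S]
        by (simp add: a_def e_def r_def t_def add_divide_distrib[symmetric] divide_right_mono)
    qed
    have l: "l \<longlonglongrightarrow> ?L"
    proof -
      have "l = (\<lambda>S. \<Sum>s<S. size_weight (Suc s) * prot_mean k (Suc s))"
        unfolding l_def by (intro ext, rule sum.reindex_bij_witness[of _ Suc "\<lambda>s. s - 1"]) auto
      then show ?thesis using summable_LIMSEQ[OF summable_prot_weights[of k]] by simp
    qed
    have "r \<longlonglongrightarrow> ?L"
    proof (rule LIMSEQ_I)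
      fix \<epsilon> :: real assume \<epsilon>: "0 < \<epsilon>"
      \<comment> \<open>S is fixed first, making both the limiting tail and the remainder of the
        series small; only then does n tend to infinity.\<close>
      have "(\<lambda>S. 2 / (real S + 2)) \<longlonglongrightarrow> 0" by real_asymp
      then have "eventually (\<lambda>S. 2 / (real S + 2) < \<epsilon> / 4) sequentially"
        by (rule order_tendstoD(2)) (use \<epsilon> in simp)
      moreover have "eventually (\<lambda>S. dist (l S) ?L < \<epsilon> / 4) sequentially"
        using tendstoD[OF l, of "\<epsilon> / 4"] \<epsilon> by simp
      ultimately have "eventually (\<lambda>S. 2 / (real S + 2) < \<epsilon> / 4 \<and> dist (l S) ?L < \<epsilon> / 4) sequentially"
        by (rule eventually_conj)
      then obtain S where S: "2 / (real S + 2) < \<epsilon> / 4" "dist (l S) ?L < \<epsilon> / 4"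
        using eventually_happens'[OF sequentially_bot] by blast
      have "eventually (\<lambda>n. dist (a S n) (l S) < \<epsilon> / 4) sequentially"
        using tendstoD[OF a, of "\<epsilon> / 4" S] \<epsilon> by simp
      moreover have "eventually (\<lambda>n. dist (e S n) (2 / (real S + 2)) < \<epsilon> / 4) sequentially"
        using tendstoD[OF e, of "\<epsilon> / 4" S] \<epsilon> by simp
      ultimately have "eventually (\<lambda>n. norm (r n - ?L) < \<epsilon>) sequentially"
        using sandwich[of S]
      proof eventually_elim
        case (elim n)
        then show ?case using S unfolding dist_real_def real_norm_def by linarith
      qed
      then show "\<exists>n0. \<forall>n\<ge>n0. norm (r n - ?L) < \<epsilon>" by (simp add: eventually_sequentially)
    qed
    moreover have "protected_fraction k (search_tree m (map (\<lambda>j. X j \<omega>) [0..<n])) = r n" for n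
    proof -
      have i: "inj_on (key_seq \<omega>) {..<n}" using inj unfolding key_seq_def by (rule inj_on_subset) auto
      have "distinct (map (key_seq \<omega>) [0..<n])" using i by (simp add: distinct_map atLeast0LessThan)
      then show ?thesis
        using protected_fraction_shape shape_of_build_tree[OF i]
        by (simp add: r_def t_def rshape_def key_seq_def)
    qed
    ultimately show "(\<lambda>n. protected_fraction k (search_tree m (map (\<lambda>j. X j \<omega>) [0..<n]))) \<longlonglongrightarrow> ?L"
      by simp
  qed
qed

end

section \<open>Generating functions of the root protection probabilities\<close>

text \<open>The Leibniz rule, phrased with function update so as to match
  \<open>up_children_prod\<close>.\<close>

lemma fps_deriv_prod_upd:
  fixes F :: "nat \<Rightarrow> real fps"
  assumes "finite A"
  shows "fps_deriv (\<Prod>i\<in>A. F i) = (\<Sum>i\<in>A. \<Prod>j\<in>A. (F(i := fps_deriv (F i))) j)"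
  using assms
proof (induction A)
  case (insert a A)
  have 1: "(\<Prod>j\<in>A. (F(a := fps_deriv (F a))) j) = (\<Prod>j\<in>A. F j)"
    using insert.hyps by (intro prod.cong) auto
  have 2: "(\<Prod>j\<in>insert a A. (F(i := fps_deriv (F i))) j) = F a * (\<Prod>j\<in>A. (F(i := fps_deriv (F i))) j)"
    if "i \<in> A" for i
    using insert.hyps that by (subst prod.insert) auto
  have "(\<Sum>i\<in>insert a A. \<Prod>j\<in>insert a A. (F(i := fps_deriv (F i))) j)
      = fps_deriv (F a) * (\<Prod>j\<in>A. F j) + (\<Sum>i\<in>A. F a * (\<Prod>j\<in>A. (F(i := fps_deriv (F i))) j))"
  proof -
    have "(\<Sum>i\<in>A. \<Prod>j\<in>insert a A. (F(i := fps_deriv (F i))) j)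
        = (\<Sum>i\<in>A. F a * (\<Prod>j\<in>A. (F(i := fps_deriv (F i))) j))"
      by (intro sum.cong refl 2)
    moreover have "(\<Prod>j\<in>insert a A. (F(a := fps_deriv (F a))) j) = fps_deriv (F a) * (\<Prod>j\<in>A. F j)"
      using insert.hyps 1 by simp
    ultimately show ?thesis using insert.hyps by simp
  qed
  then show ?case using insert by (simp add: sum_distrib_left)
qed simp

lemma fps_prod_nth_0: "fps_nth (\<Prod>i\<in>A. F i) 0 = (\<Prod>i\<in>A. fps_nth (F i) 0)"
  for F :: "'b \<Rightarrow> 'a::comm_ring_1 fps"
  by (induction A rule: infinite_finite_induct) auto

context search_tree_arity
begin

definition mean_fps :: "(shape \<Rightarrow> real) \<Rightarrow> real fps" where
  "mean_fps \<xi> = Abs_fps (\<lambda>r. shape_mean r \<xi>)"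

lemma mean_fps_up: "mean_fps (up \<xi>) = fps_deriv (mean_fps \<xi>)"
  by (rule fps_ext) (simp add: mean_fps_def shape_mean_Suc[symmetric])

text \<open>Every child has its own functional: one insertion replaces a single factor by its image
  under \<open>up\<close>, so the recursion does not stay within products of equal factors.\<close>

definition children_prod :: "(nat \<Rightarrow> shape \<Rightarrow> real) \<Rightarrow> shape \<Rightarrow> real" where
  "children_prod \<xi> t = (case t of Part j \<Rightarrow> 0 | Full ts \<Rightarrow> \<Prod>i<m. \<xi> i (ts ! i))"

text \<open>From m - 1 keys on the root is full, so a new key enters exactly one child.\<close>

lemma up_children_prod:
  assumes "wf_shape t" "m - 1 \<le> keys t"
  shows "up (children_prod \<xi>) t = (\<Sum>i<m. children_prod (\<xi>(i := up (\<xi> i))) t)"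
proof (cases t)
  case (Part j)
  then show ?thesis using assms by simp
next
  case (Full ts)
  then have len: "length ts = m" using assms by simp
  show ?thesis unfolding Full up_Full len
  proof (intro sum.cong refl)
    fix i assume i: "i \<in> {..<m}"
    have split: "(\<Prod>j<m. g j) = g i * (\<Prod>j\<in>{..<m} - {i}. g j)" for g :: "nat \<Rightarrow> real"
      using i by (subst prod.remove[of _ i]) auto
    have "children_prod \<xi> (Full (ts[i := x])) = (\<Prod>j\<in>{..<m} - {i}. \<xi> j (ts ! j)) * \<xi> i x" for x
      using i len by (simp add: children_prod_def split mult.commute)
    then have "up (\<lambda>x. children_prod \<xi> (Full (ts[i := x]))) (ts ! i)
        = (\<Prod>j\<in>{..<m} - {i}. \<xi> j (ts ! j)) * up (\<xi> i) (ts ! i)"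
      by (simp add: up_cmult)
    also have "\<dots> = children_prod (\<xi>(i := up (\<xi> i))) (Full ts)"
      by (simp add: children_prod_def split mult.commute)
    finally show "up (\<lambda>x. children_prod \<xi> (Full (ts[i := x]))) (ts ! i)
        = children_prod (\<xi>(i := up (\<xi> i))) (Full ts)" .
  qed
qed

text \<open>Given their total size, the sizes of the root's subtrees are uniform over all compositions and
  the subtrees are independent; replacing a factor by its image under \<^term>\<open>up\<close> differentiates its
  generating function, so both sides satisfy the same recursion in r.\<close>

lemma shape_sum_children_prod:
  "shape_sum (r + (m - 1)) (children_prod \<xi>)
    = fact (m - 1) * fact r * fps_nth (\<Prod>i<m. mean_fps (\<xi> i)) r"
proof (induction r arbitrary: \<xi>)
  case 0
  have "children_prod \<xi> t = (\<Prod>i<m. \<xi> i (Part 0))" if t: "wf_shape t" "keys t = m - 1" for t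
  proof (cases t)
    case (Part j) then show ?thesis using t by simp
  next
    case (Full ts)
    have z: "ts ! i = Part 0" if "i < m" for i
    proof -
      have "m - 1 + (\<Sum>t\<leftarrow>ts. keys t) = m - 1" using t(2) Full by simp
      then have "\<forall>t\<in>set ts. keys t = 0" by (simp add: sum_list_eq_0_iff)
      moreover have "ts ! i \<in> set ts" using t(1) Full that by simp
      ultimately have "keys (ts ! i) = 0" "wf_shape (ts ! i)" using t(1) Full by auto
      then show ?thesis using empty_iff_keys by blast
    qed
    then show ?thesis by (simp add: Full children_prod_def)
  qed
  then have "shape_mean (m - 1) (children_prod \<xi>) = (\<Prod>i<m. \<xi> i (Part 0))"
    using shape_mean_cong[of "m - 1" "children_prod \<xi>" "\<lambda>_. \<Prod>i<m. \<xi> i (Part 0)"] by (simp add: shape_mean_const)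
  then show ?case
    by (simp add: fps_prod_nth_0 mean_fps_def shape_mean_def shape_sum_0 divide_eq_eq mult.commute)
next
  case (Suc r)
  let ?F = "\<lambda>i. mean_fps (\<xi> i)"
  have "shape_sum (Suc r + (m - 1)) (children_prod \<xi>) = shape_sum (r + (m - 1)) (up (children_prod \<xi>))"
    by (simp add: shape_sum_Suc)
  also have "\<dots> = shape_sum (r + (m - 1)) (\<lambda>t. \<Sum>i<m. children_prod (\<xi>(i := up (\<xi> i))) t)"
    by (intro shape_sum_cong up_children_prod) auto
  also have "\<dots> = (\<Sum>i<m. shape_sum (r + (m - 1)) (children_prod (\<xi>(i := up (\<xi> i)))))"
  proof -
    have "shape_sum n (\<lambda>t. \<Sum>i\<in>I. g i t) = (\<Sum>i\<in>I. shape_sum n (g i))" if "finite I"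
      for n g and I :: "nat set"
      using that by (induction I) (auto simp: shape_sum_def sum_list_addf)
    then show ?thesis by simp
  qed
  also have "\<dots> = fact (m - 1) * fact r * fps_nth (\<Sum>i<m. \<Prod>j<m. (?F(i := fps_deriv (?F i))) j) r"
  proof -
    have "(\<lambda>j. mean_fps ((\<xi>(i := up (\<xi> i))) j)) = ?F(i := fps_deriv (?F i))" for i
      by (auto simp: mean_fps_up)
    then show ?thesis by (simp only: Suc.IH fps_sum_nth sum_distrib_left)
  qed
  also have "(\<Sum>i<m. \<Prod>j<m. (?F(i := fps_deriv (?F i))) j) = fps_deriv (\<Prod>i<m. ?F i)"
    by (rule fps_deriv_prod_upd[symmetric]) simp
  finally show ?case by (simp add: mult_ac)
qed

text \<open>Admitting \<open>Part 0\<close> mirrors the clause for children in \<open>prot\<close>,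
  and makes the constant coefficient 1. In the m-th power all children are empty or protected; the
  subtraction of 1 in \<open>fringe_coeff\<close> removes the case that all are empty.\<close>

definition prot_fps :: "nat \<Rightarrow> real fps" where
  "prot_fps k = mean_fps (\<lambda>u. of_bool (u = Part 0 \<or> prot k u))"

lemma prot_Part_0: "\<not> prot k (Part 0)"
  by (cases k) auto

lemma prot_mean_0: "prot_mean k 0 = 0"
  by (simp add: prot_mean_def shape_mean_def shape_sum_0 prot_Part_0)

lemma prot_fps_nth: "fps_nth (prot_fps k) r = (if r = 0 then 1 else prot_mean k r)"
proof (cases "r = 0")
  case False
  have "shape_mean r (\<lambda>u. of_bool (u = Part 0 \<or> prot k u)) = shape_mean r (\<lambda>u. of_bool (prot k u))"
    by (rule shape_mean_cong) (use False in auto)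
  then show ?thesis using False by (simp add: prot_fps_def mean_fps_def prot_mean_def)
qed (simp add: prot_fps_def mean_fps_def shape_mean_def shape_sum_0)

definition fringe_coeff :: "nat \<Rightarrow> nat \<Rightarrow> real" where
  "fringe_coeff k r = fps_nth (prot_fps k ^ m - 1) r"

text \<open>The factor is the reciprocal of the binomial coefficient of r + m - 1 over m - 1, which
  counts the ways to distribute r keys among m subtrees.\<close>

lemma prot_mean_Suc:
  "prot_mean (Suc k) (r + (m - 1)) = fact (m - 1) * fact r / fact (r + (m - 1)) * fringe_coeff k r"
proof -
  let ?\<xi> = "\<lambda>u. of_bool (u = Part 0 \<or> prot k u) :: real" and ?\<zeta> = "\<lambda>u. of_bool (u = Part 0) :: real"
  have pt: "of_bool (prot (Suc k) t) = children_prod (\<lambda>_. ?\<xi>) t - children_prod (\<lambda>_. ?\<zeta>) t"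
    if t: "wf_shape t" "keys t = r + (m - 1)" for t
  proof (cases t)
    case (Part j) then show ?thesis using t by simp
  next
    case (Full ts)
    have len: "length ts = m" using t Full by simp
    have all: "(\<Prod>i<m. of_bool (P (ts ! i)) :: real) = of_bool (\<forall>t\<in>set ts. P t)" for P
    proof (cases "\<forall>t\<in>set ts. P t")
      case True
      then show ?thesis using len by (simp add: all_set_conv_all_nth)
    next
      case False
      then obtain i where "i < m" "\<not> P (ts ! i)" using len by (auto simp: all_set_conv_all_nth)
      then have "(\<Prod>i<m. of_bool (P (ts ! i)) :: real) = 0" by (intro prod_zero) auto
      moreover have "of_bool (\<forall>t\<in>set ts. P t) = (0 :: real)" using False by (simp only: of_bool_eq)
      ultimately show ?thesis by (rule trans[OF _ sym])
    qed
    show ?thesis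
      unfolding Full children_prod_def shape.case all[of "\<lambda>t. t = Part 0 \<or> prot k t"] all[of "\<lambda>t. t = Part 0"]
      by auto
  qed
  have \<zeta>: "mean_fps ?\<zeta> = 1"
  proof (rule fps_ext)
    fix n
    have "shape_mean n ?\<zeta> = shape_mean n (\<lambda>_. of_bool (n = 0))"
      by (rule shape_mean_cong) (auto simp: empty_iff_keys)
    then show "fps_nth (mean_fps ?\<zeta>) n = fps_nth 1 n" by (simp add: mean_fps_def shape_mean_const)
  qed
  have "shape_sum (r + (m - 1)) (\<lambda>t. of_bool (prot (Suc k) t))
      = shape_sum (r + (m - 1)) (\<lambda>t. children_prod (\<lambda>_. ?\<xi>) t - children_prod (\<lambda>_. ?\<zeta>) t)"
    by (intro shape_sum_cong pt)
  also have "\<dots> = shape_sum (r + (m - 1)) (children_prod (\<lambda>_. ?\<xi>)) - shape_sum (r + (m - 1)) (children_prod (\<lambda>_. ?\<zeta>))"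
    by (simp add: shape_sum_def sum_list_subtractf)
  also have "\<dots> = fact (m - 1) * fact r * fringe_coeff k r"
    by (simp only: shape_sum_children_prod \<zeta> fringe_coeff_def prot_fps_def right_diff_distrib
        prod_constant card_lessThan power_one fps_sub_nth)
  finally show ?thesis by (simp add: prot_mean_def shape_mean_def)
qed

lemma prot_mean_Suc_small:
  assumes "s < m - 1"
  shows "prot_mean (Suc k) s = 0"
proof -
  have "prot_mean (Suc k) s = shape_mean s (\<lambda>_. 0)"
    unfolding prot_mean_def
  proof (rule shape_mean_cong)
    fix t assume "wf_shape t" "keys t = s"
    then show "of_bool (prot (Suc k) t) = (0 :: real)" using assms by (cases t) auto
  qed
  then show ?thesis by (simp add: shape_mean_const)
qed

lemma prot_mean_0_pos: "1 \<le> s \<Longrightarrow> prot_mean 0 s = 1"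
  using shape_mean_cong[of s "\<lambda>u. of_bool (prot 0 u)" "\<lambda>_. 1"]
  by (simp add: prot_mean_def shape_mean_const)

text \<open>Up to a positive factor the coefficient is a probability. Nonnegativity is what permits
  termwise integration.\<close>

lemma fringe_coeff_nonneg: "0 \<le> fringe_coeff k r"
proof -
  have "fringe_coeff k r = prot_mean (Suc k) (r + (m - 1)) * (fact (r + (m - 1)) / (fact (m - 1) * fact r))"
    unfolding prot_mean_Suc by simp
  then show ?thesis
    using shape_mean_nonneg[of "r + (m - 1)" "\<lambda>u. of_bool (prot (Suc k) u)"]
    by (simp add: prot_mean_def)
qed

lemma prot_fps_radius: "1 \<le> fps_conv_radius (prot_fps k)"
  unfolding fps_conv_radius_def one_ereal_def
proof (rule conv_radius_geI_ex')
  fix r :: real assume r: "0 < r" "ereal r < ereal 1"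
  show "summable (\<lambda>n. fps_nth (prot_fps k) n * of_real r ^ n)"
  proof (rule summable_comparison_test')
    show "summable (\<lambda>n. r ^ n)" using r by (intro summable_geometric) auto
    show "norm (fps_nth (prot_fps k) n * of_real r ^ n) \<le> r ^ n" for n
      using r prot_mean_bounds[of k n] by (auto simp: prot_fps_nth abs_mult mult_left_le_one_le)
  qed
qed

lemma prot_fps_sums:
  assumes "0 \<le> z" "z < 1"
  shows "(\<lambda>s. prot_mean k s * z ^ s) sums (eval_fps (prot_fps k) z - 1)"
    and "(\<lambda>r. fringe_coeff k r * z ^ r) sums (eval_fps (prot_fps k) z ^ m - 1)"
proof -
  have z: "ereal (norm z) < fps_conv_radius (prot_fps k)"
    using assms by (intro less_le_trans[OF _ prot_fps_radius]) (simp add: one_ereal_def)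
  have one: "(\<lambda>r. fps_nth 1 r * z ^ r) sums 1" for z :: real
    using sums_If_finite_set[of "{0::nat}" "\<lambda>_. 1 :: real"]
    by (simp add: fps_one_nth if_distrib[of "\<lambda>x. x * _"] cong: if_cong)
  have "(\<lambda>s. fps_nth (prot_fps k) s * z ^ s - fps_nth 1 s * z ^ s) sums (eval_fps (prot_fps k) z - 1)"
    by (intro sums_diff sums_eval_fps z one)
  then show "(\<lambda>s. prot_mean k s * z ^ s) sums (eval_fps (prot_fps k) z - 1)"
    by (rule sums_cong[THEN iffD1, rotated]) (auto simp: prot_fps_nth prot_mean_0)
  have "(\<lambda>r. fps_nth (prot_fps k ^ m) r * z ^ r - fps_nth 1 r * z ^ r) sums (eval_fps (prot_fps k ^ m) z - 1)"
    by (intro sums_diff sums_eval_fps one less_le_trans[OF z fps_conv_radius_power])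
  then show "(\<lambda>r. fringe_coeff k r * z ^ r) sums (eval_fps (prot_fps k) z ^ m - 1)"
    by (simp add: fringe_coeff_def left_diff_distrib eval_fps_power[OF z])
qed

end

section \<open>Integrals\<close>

text \<open>Monotone convergence; the value of the sum and the integrability of the limit come out
  together.\<close>

lemma has_bochner_integral_sums:
  fixes u :: "nat \<Rightarrow> 'a \<Rightarrow> real"
  assumes u: "\<And>r. has_bochner_integral M (u r) (I r)" and nonneg: "\<And>r x. 0 \<le> u r x"
    and I: "I sums J" and U: "\<And>x. (\<lambda>r. u r x) sums U x"
  shows "has_bochner_integral M U J"
proof (rule has_bochner_integral_nn_integral)
  have meas [measurable]: "u r \<in> borel_measurable M" for r
    using u by (auto simp: has_bochner_integral_iff)
  have "U = (\<lambda>x. \<Sum>r. u r x)" by (intro ext) (rule sums_unique[OF U])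
  then show "U \<in> borel_measurable M" by (simp only:) measurable
  have I0: "0 \<le> I r" for r
  proof -
    have "I r = integral\<^sup>L M (u r)" using u[of r] by (simp add: has_bochner_integral_iff)
    then show ?thesis using nonneg by (simp add: integral_nonneg)
  qed
  then show "0 \<le> J" by (intro sums_le[OF _ sums_zero I])
  show "AE x in M. 0 \<le> U x" by (intro AE_I2 sums_le[OF _ sums_zero U] nonneg)
  have "(\<integral>\<^sup>+x. ennreal (U x) \<partial>M) = (\<integral>\<^sup>+x. (\<Sum>r. ennreal (u r x)) \<partial>M)"
    by (intro nn_integral_cong) (rule suminf_ennreal_eq[OF nonneg U, symmetric])
  also have "\<dots> = (\<Sum>r. \<integral>\<^sup>+x. ennreal (u r x) \<partial>M)" by (rule nn_integral_suminf) simp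
  also have "\<dots> = (\<Sum>r. ennreal (I r))"
  proof (intro suminf_cong)
    fix r
    show "(\<integral>\<^sup>+x. ennreal (u r x) \<partial>M) = ennreal (I r)"
      using u[of r] nonneg by (subst nn_integral_eq_integral) (auto simp: has_bochner_integral_iff)
  qed
  also have "\<dots> = ennreal J" by (rule suminf_ennreal_eq[OF I0 I])
  finally show "(\<integral>\<^sup>+x. ennreal (U x) \<partial>M) = ennreal J" .
qed

lemma has_bochner_integral_FTC_Icc_nonneg':
  fixes g G :: "real \<Rightarrow> real"
  assumes "g \<in> borel_measurable borel" "a \<le> b"
    and G: "\<And>x. DERIV G x :> g x" and nonneg: "\<And>x. a \<le> x \<Longrightarrow> x \<le> b \<Longrightarrow> 0 \<le> g x"
  shows "has_bochner_integral lborel (\<lambda>x. indicator {a..b} x * g x) (G b - G a)"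
proof (rule has_bochner_integral_nn_integral)
  show "(\<lambda>x. indicator {a..b} x * g x) \<in> borel_measurable lborel" using assms(1) by simp
  have "G a \<le> G b" using assms by (intro DERIV_nonneg_imp_nondecreasing[of a b G]) auto
  then show "0 \<le> G b - G a" by simp
  have "(\<integral>\<^sup>+x. ennreal (indicator {a..b} x * g x) \<partial>lborel) = (\<integral>\<^sup>+x. ennreal (g x) * indicator {a..b} x \<partial>lborel)"
    by (intro nn_integral_cong) (auto simp: indicator_def)
  also have "\<dots> = ennreal (G b - G a)"
    using assms by (intro nn_integral_FTC_Icc) auto
  finally show "(\<integral>\<^sup>+x. ennreal (indicator {a..b} x * g x) \<partial>lborel) = ennreal (G b - G a)" .
qed (auto simp: indicator_def nonneg)

lemma has_bochner_integral_FTC_Ici_nonneg: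
  fixes g G :: "real \<Rightarrow> real"
  assumes "g \<in> borel_measurable borel" and G: "\<And>x. DERIV G x :> g x"
    and nonneg: "\<And>x. a \<le> x \<Longrightarrow> 0 \<le> g x" and lim: "(G \<longlongrightarrow> T) at_top"
  shows "has_bochner_integral lborel (\<lambda>x. indicator {a..} x * g x) (T - G a)"
proof (rule has_bochner_integral_nn_integral)
  show "(\<lambda>x. indicator {a..} x * g x) \<in> borel_measurable lborel" using assms(1) by simp
  have "G a \<le> G x" if "a \<le> x" for x
    by (rule DERIV_nonneg_imp_nondecreasing[OF that]) (use G nonneg in blast)
  then have "G a \<le> T"
    by (intro tendsto_lowerbound[OF lim] eventually_mono[OF eventually_ge_at_top[of a]]) auto
  then show "0 \<le> T - G a" by simp
  have "(\<integral>\<^sup>+x. ennreal (indicator {a..} x * g x) \<partial>lborel) = (\<integral>\<^sup>+x. ennreal (g x) * indicator {a..} x \<partial>lborel)"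
    by (intro nn_integral_cong) (auto simp: indicator_def)
  also have "\<dots> = ennreal (T - G a)"
    using assms by (intro nn_integral_FTC_atLeast) auto
  finally show "(\<integral>\<^sup>+x. ennreal (indicator {a..} x * g x) \<partial>lborel) = ennreal (T - G a)" .
qed (auto simp: indicator_def nonneg)

text \<open>Integration by parts lowers r and raises a.\<close>

lemma convolution_antiderivative:
  fixes t :: real
  shows "\<exists>F. (\<forall>s. DERIV F s :> exp s * (exp s - 1) ^ a * (1 - exp (s - t)) ^ r) \<and> F 0 = 0 \<and>
    F t = fact r * fact a / fact (a + r + 1) * exp (- (real r * t)) * (exp t - 1) ^ (a + r + 1)"
proof (induction r arbitrary: a)
  case 0
  have "DERIV (\<lambda>s. (exp s - 1) ^ Suc a / real (Suc a)) s :> exp s * (exp s - 1) ^ a" for s :: real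
    by (auto intro!: derivative_eq_intros simp del: power_Suc of_nat_Suc)
  then show ?case
    by (intro exI[of _ "\<lambda>s. (exp s - 1) ^ Suc a / real (Suc a)"]) (simp del: of_nat_Suc)
next
  case (Suc r)
  obtain F where F: "\<And>s. DERIV F s :> exp s * (exp s - 1) ^ Suc a * (1 - exp (s - t)) ^ r" "F 0 = 0"
    "F t = fact r * fact (Suc a) / fact (Suc a + r + 1) * exp (- (real r * t)) * (exp t - 1) ^ (Suc a + r + 1)"
    using Suc.IH[of "Suc a"] by blast
  \<comment> \<open>The integrated term vanishes at s = 0 because of its first power and at s = t
    because of its second, so only the multiple of F survives at both ends.\<close>
  define H where "H s = (exp s - 1) ^ Suc a / real (Suc a) * (1 - exp (s - t)) ^ Suc r
      + real (Suc r) / real (Suc a) * exp (- t) * F s" for s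
  have H: "DERIV H s :> exp s * (exp s - 1) ^ a * (1 - exp (s - t)) ^ Suc r" for s
  proof -
    have "DERIV H s :> exp s * (exp s - 1) ^ a * (1 - exp (s - t)) ^ Suc r
        + (exp s - 1) ^ Suc a / real (Suc a) * (real (Suc r) * (1 - exp (s - t)) ^ r * (- exp (s - t)))
        + real (Suc r) / real (Suc a) * exp (- t) * (exp s * (exp s - 1) ^ Suc a * (1 - exp (s - t)) ^ r)"
      unfolding H_def
      by (auto intro!: derivative_eq_intros F(1) simp del: power_Suc of_nat_Suc)
         (simp add: diff_divide_distrib mult_ac del: power_Suc of_nat_Suc)
    moreover have "(exp s - 1) ^ Suc a / real (Suc a) * (real (Suc r) * (1 - exp (s - t)) ^ r * (- exp (s - t)))
        + real (Suc r) / real (Suc a) * exp (- t) * (exp s * (exp s - 1) ^ Suc a * (1 - exp (s - t)) ^ r) = 0"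
      by (simp add: exp_diff exp_minus divide_inverse mult_ac del: power_Suc of_nat_Suc)
    ultimately show ?thesis by (simp only: add.assoc add_0_right)
  qed
  have "H t = fact (Suc r) * fact a / fact (a + Suc r + 1) * exp (- (real (Suc r) * t)) * (exp t - 1) ^ (a + Suc r + 1)"
  proof -
    have "H t = real (Suc r) / real (Suc a) * exp (- t) *
      (fact r * fact (Suc a) / fact (Suc a + r + 1) * exp (- (real r * t)) * (exp t - 1) ^ (Suc a + r + 1))"
      by (simp add: H_def F(3))
    also have "Suc a + r + 1 = a + Suc r + 1" by simp
    also have "real (Suc r) / real (Suc a) * exp (- t) * (fact r * fact (Suc a) / fact (a + Suc r + 1)
        * exp (- (real r * t)) * (exp t - 1) ^ (a + Suc r + 1))
      = fact (Suc r) * fact a / fact (a + Suc r + 1) * (exp (- t) * exp (- (real r * t))) * (exp t - 1) ^ (a + Suc r + 1)"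
    proof -
      have gen: "R / A * e * (b * (A * c) / d * E * W) = (R * b) * c / d * (e * E) * W"
        if "A \<noteq> 0" for A R e b c d E W :: real using that by (cases "d = 0") (auto simp: field_simps)
      show ?thesis unfolding fact_Suc[of r] fact_Suc[of a] by (rule gen) simp
    qed
    also have "exp (- t) * exp (- (real r * t)) = exp (- (real (Suc r) * t))"
      by (simp add: exp_add[symmetric] algebra_simps)
    finally show ?thesis .
  qed
  moreover have "H 0 = 0" by (simp add: H_def F(2))
  ultimately show ?case using H by blast
qed

text \<open>Convolution with the density of the sum sends e^(-mu) (1 - e^(-u))^r to e^(-t) (1 -
  e^(-t))^(r + m - 1), with the very factor of \<open>prot_mean_Suc\<close>; this is why
  \<open>h_k\<close> and the tree probabilities obey one recursion. Taking out e^(-mt) leaves the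
  integrand treated above.\<close>

lemma convolution_integral:
  assumes t: "0 \<le> t" and m: "2 \<le> m"
  shows "has_bochner_integral lborel (\<lambda>s. indicator {0..t} s *
      (real (m - 1) * exp (- s) * (1 - exp (- s)) ^ (m - 2) * (exp (- (real m * (t - s))) * (1 - exp (- (t - s))) ^ r)))
    (fact (m - 1) * fact r / fact (r + (m - 1)) * (exp (- t) * (1 - exp (- t)) ^ (r + (m - 1))))"
proof -
  obtain a where a: "m = Suc (Suc a)" using m by (metis add_2_eq_Suc le_Suc_ex)
  obtain F where F: "\<And>s. DERIV F s :> exp s * (exp s - 1) ^ a * (1 - exp (s - t)) ^ r" "F 0 = 0"
    "F t = fact r * fact a / fact (a + r + 1) * exp (- (real r * t)) * (exp t - 1) ^ (a + r + 1)"
    using convolution_antiderivative by blast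
  have "has_bochner_integral lborel (\<lambda>s. indicator {0..t} s * (exp s * (exp s - 1) ^ a * (1 - exp (s - t)) ^ r)) (F t - F 0)"
    using t by (intro has_bochner_integral_FTC_Icc_nonneg' F(1)) auto
  then have "has_bochner_integral lborel (\<lambda>s. (real (Suc a) * exp (- (real m * t))) *
      (indicator {0..t} s * (exp s * (exp s - 1) ^ a * (1 - exp (s - t)) ^ r)))
    ((real (Suc a) * exp (- (real m * t))) * (F t - F 0))"
    by (rule has_bochner_integral_mult_right)
  moreover have "(real (Suc a) * exp (- (real m * t))) * (indicator {0..t} s * (exp s * (exp s - 1) ^ a * (1 - exp (s - t)) ^ r))
      = indicator {0..t} s *
      (real (m - 1) * exp (- s) * (1 - exp (- s)) ^ (m - 2) * (exp (- (real m * (t - s))) * (1 - exp (- (t - s))) ^ r))" for s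
  proof -
    have e1: "1 - exp (- s) = exp (- s) * (exp s - 1)" by (simp add: right_diff_distrib exp_minus)
    have "exp (- (real m * t)) * exp s = exp (- s) * exp (- s) ^ a * exp (- (real m * (t - s)))"
      by (simp add: exp_of_nat_mult[symmetric] exp_add[symmetric] a algebra_simps)
    then show ?thesis unfolding e1 power_mult_distrib by (simp add: a mult_ac del: of_nat_Suc)
  qed
  moreover have "(real (Suc a) * exp (- (real m * t))) * (F t - F 0)
      = fact (m - 1) * fact r / fact (r + (m - 1)) * (exp (- t) * (1 - exp (- t)) ^ (r + (m - 1)))"
  proof -
    have e1: "1 - exp (- t) = exp (- t) * (exp t - 1)" by (simp add: right_diff_distrib exp_minus)
    have "exp (- (real m * t)) * exp (- (real r * t)) = exp (- t) * exp (- t) ^ (r + (m - 1))"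
      by (simp add: exp_of_nat_mult[symmetric] exp_add[symmetric] a algebra_simps)
    then show ?thesis unfolding e1 power_mult_distrib F
      by (simp add: a mult_ac add_ac del: of_nat_Suc)
  qed
  ultimately show ?thesis by (simp only:)
qed

text \<open>With z = 1 - e^(-t) the integrand becomes (1 - z)^a z^r dz, so the limit is a Beta
  function. Integration by parts lowers a and raises r.\<close>

lemma beta_antiderivative:
  "\<exists>F. (\<forall>t::real. DERIV F t :> exp (- (real (Suc a) * t)) * (1 - exp (- t)) ^ r) \<and> F 0 = 0 \<and>
    (F \<longlongrightarrow> fact a * fact r / fact (a + r + 1)) at_top"
proof (induction a arbitrary: r)
  case 0
  define F where "F t = (1 - exp (- t)) ^ Suc r / real (Suc r)" for t :: real
  have "DERIV F t :> exp (- t) * (1 - exp (- t)) ^ r" for t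
    unfolding F_def by (auto intro!: derivative_eq_intros simp del: power_Suc of_nat_Suc)
  moreover have "(F \<longlongrightarrow> (1 - 0) ^ Suc r / real (Suc r)) at_top"
    unfolding F_def
    by (intro tendsto_intros filterlim_compose[OF exp_at_bot] filterlim_uminus_at_bot_at_top) auto
  moreover have "F 0 = 0" by (simp add: F_def)
  ultimately show ?case by (intro exI[of _ F]) (simp add: divide_simps)
next
  case (Suc a)
  obtain F where F: "\<And>t::real. DERIV F t :> exp (- (real (Suc a) * t)) * (1 - exp (- t)) ^ Suc r" "F 0 = 0"
    "(F \<longlongrightarrow> fact a * fact (Suc r) / fact (a + Suc r + 1)) at_top"
    using Suc.IH[of "Suc r"] by blast
  define H where "H t = exp (- (real (Suc a) * t)) * ((1 - exp (- t)) ^ Suc r / real (Suc r))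
      + real (Suc a) / real (Suc r) * F t" for t
  have gen: "- A * x * (q / R) + A / R * (x * q) = 0" for A x q R :: real by simp
  have "DERIV H t :> exp (- (real (Suc (Suc a)) * t)) * (1 - exp (- t)) ^ r" for t
  proof -
    have "DERIV H t :> exp (- (real (Suc a) * t)) * (exp (- t) * (1 - exp (- t)) ^ r)
        + (- real (Suc a) * exp (- (real (Suc a) * t)) * ((1 - exp (- t)) ^ Suc r / real (Suc r))
        + real (Suc a) / real (Suc r) * (exp (- (real (Suc a) * t)) * (1 - exp (- t)) ^ Suc r))"
      unfolding H_def
      by (auto intro!: derivative_eq_intros F(1) simp del: power_Suc of_nat_Suc)
         (simp add: diff_divide_distrib mult_ac del: power_Suc of_nat_Suc)
    moreover have "- real (Suc a) * exp (- (real (Suc a) * t)) * ((1 - exp (- t)) ^ Suc r / real (Suc r))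
        + real (Suc a) / real (Suc r) * (exp (- (real (Suc a) * t)) * (1 - exp (- t)) ^ Suc r) = 0"
      using gen[of "real (Suc a)" "exp (- (real (Suc a) * t))" "(1 - exp (- t)) ^ Suc r" "real (Suc r)"] .
    moreover have "exp (- (real (Suc (Suc a)) * t)) = exp (- (real (Suc a) * t)) * exp (- t)"
      by (simp add: exp_add[symmetric] algebra_simps)
    ultimately show ?thesis by (simp only: add_0_right mult.assoc)
  qed
  moreover have "(H \<longlongrightarrow> 0 * ((1 - 0) ^ Suc r / real (Suc r))
      + real (Suc a) / real (Suc r) * (fact a * fact (Suc r) / fact (a + Suc r + 1))) at_top"
    unfolding H_def
  proof (intro tendsto_add tendsto_mult tendsto_const F(3))
    show "((\<lambda>t. exp (- (real (Suc a) * t))) \<longlongrightarrow> 0) at_top" by real_asymp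
    show "((\<lambda>t. (1 - exp (- t)) ^ Suc r / real (Suc r)) \<longlongrightarrow> (1 - 0) ^ Suc r / real (Suc r)) at_top"
      by (intro tendsto_intros filterlim_compose[OF exp_at_bot] filterlim_uminus_at_bot_at_top) auto
  qed
  moreover have "0 * ((1 - 0) ^ Suc r / real (Suc r)) + real (Suc a) / real (Suc r) * (fact a * fact (Suc r) / fact (a + Suc r + 1))
      = (fact (Suc a) * fact r / fact (Suc a + r + 1) :: real)"
    by (simp del: of_nat_Suc)
  moreover have "H 0 = 0" by (simp add: H_def F(2))
  ultimately show ?case by metis
qed

lemma beta_integral:
  "has_bochner_integral lborel (\<lambda>t. indicator {0..} t * (exp (- (real (Suc a) * t)) * (1 - exp (- t)) ^ r))
    (fact a * fact r / fact (a + r + 1))"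
proof -
  obtain F where F: "\<And>t::real. DERIV F t :> exp (- (real (Suc a) * t)) * (1 - exp (- t)) ^ r" "F 0 = 0"
    "(F \<longlongrightarrow> fact a * fact r / fact (a + r + 1)) at_top"
    using beta_antiderivative by blast
  have "has_bochner_integral lborel (\<lambda>t. indicator {0..} t * (exp (- (real (Suc a) * t)) * (1 - exp (- t)) ^ r))
    (fact a * fact r / fact (a + r + 1) - F 0)"
    by (intro has_bochner_integral_FTC_Ici_nonneg F) auto
  then show ?thesis by (simp add: F(2))
qed

text \<open>The density of the maximum of n independent Exp(1) variables, which has the law of the
  sum of independent Exp(i), i = 1, ..., n (Renyi's representation).\<close>

definition max_exp_density :: "nat \<Rightarrow> real \<Rightarrow> real" where
  "max_exp_density n x = (if x < 0 then 0 else real n * exp (- x) * (1 - exp (- x)) ^ (n - 1))"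

lemma max_exp_density_nonneg: "0 \<le> max_exp_density n x"
  by (simp add: max_exp_density_def)

lemma max_exp_density_measurable [measurable]: "max_exp_density n \<in> borel_measurable borel"
  unfolding max_exp_density_def[abs_def] by measurable

text \<open>In terms of lifetimes: the first of n + 1 deaths takes an Exp(n + 1) time, and by lack
  of memory the remaining time is the maximum of n fresh lifetimes.\<close>

lemma max_exp_density_convolution:
  assumes "1 \<le> n"
  shows "(\<integral>\<^sup>+y. ennreal (exponential_density (real (Suc n)) (x - y)) * ennreal (max_exp_density n y) \<partial>lborel)
    = ennreal (max_exp_density (Suc n) x)"
proof (cases "x < 0")
  case True
  have "ennreal (exponential_density (real (Suc n)) (x - y)) * ennreal (max_exp_density n y) = 0" for y
    using True by (cases "y < 0") (auto simp: exponential_density_def max_exp_density_def)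
  then have "(\<integral>\<^sup>+y. ennreal (exponential_density (real (Suc n)) (x - y)) * ennreal (max_exp_density n y) \<partial>lborel)
      = (\<integral>\<^sup>+y. 0 \<partial>(lborel :: real measure))"
    by (intro nn_integral_cong)
  then show ?thesis using True by (simp add: max_exp_density_def)
next
  case False
  let ?g = "\<lambda>y. real (Suc n) * exp (- (real (Suc n) * x)) * (real n * (exp y - 1) ^ (n - 1) * exp y)"
  let ?G = "\<lambda>y. real (Suc n) * exp (- (real (Suc n) * x)) * (exp y - 1) ^ n"
  have eq: "ennreal (exponential_density (real (Suc n)) (x - y)) * ennreal (max_exp_density n y)
      = ennreal (?g y) * indicator {0..x} y" for y
  proof (cases "y \<in> {0..x}")
    case True
    have e: "1 - exp (- y) = exp (- y) * (exp y - 1)" by (simp add: right_diff_distrib exp_minus)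
    have s: "exp (- (x - y) * real (Suc n)) * (exp (- y) * exp (- y) ^ (n - 1))
        = exp (- (real (Suc n) * x)) * exp y"
      using assms by (simp add: exp_of_nat_mult[symmetric] exp_add[symmetric] of_nat_diff algebra_simps)
    have "exponential_density (real (Suc n)) (x - y) * max_exp_density n y
       = real (Suc n) * real n * (exp y - 1) ^ (n - 1) * (exp (- (x - y) * real (Suc n)) * (exp (- y) * exp (- y) ^ (n - 1)))"
      using True unfolding exponential_density_def max_exp_density_def e power_mult_distrib
      by (simp add: mult_ac)
    also have "\<dots> = ?g y" unfolding s by (simp add: mult_ac)
    finally show ?thesis using True
      by (simp add: ennreal_mult''[symmetric] max_exp_density_nonneg)
  next
    case False
    then show ?thesis by (auto simp: exponential_density_def max_exp_density_def)
  qed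
  have "(\<integral>\<^sup>+y. ennreal (?g y) * indicator {0..x} y \<partial>lborel) = ennreal (?G x - ?G 0)"
  proof -
    have "DERIV ?G y :> ?g y" for y
      by (auto intro!: derivative_eq_intros simp del: of_nat_Suc)
    then show ?thesis using False by (intro nn_integral_FTC_Icc) auto
  qed
  also have "?G x - ?G 0 = max_exp_density (Suc n) x"
  proof -
    have e: "1 - exp (- x) = exp (- x) * (exp x - 1)" by (simp add: right_diff_distrib exp_minus)
    have s: "exp (- (real (Suc n) * x)) = exp (- x) * exp (- x) ^ n"
      by (simp add: exp_of_nat_mult[symmetric] exp_add[symmetric] algebra_simps)
    show ?thesis using False assms unfolding max_exp_density_def e power_mult_distrib s by simp
  qed
  finally show ?thesis unfolding eq .
qed

lemma (in prob_space) sum_exponential_distributed: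
  assumes "1 \<le> n" "indep_vars (\<lambda>_. borel) Y {1..n}"
    and "\<And>i. i \<in> {1..n} \<Longrightarrow> distributed M lborel (Y i) (\<lambda>x. ennreal (exponential_density (real i) x))"
  shows "distributed M lborel (\<lambda>\<omega>. \<Sum>i=1..n. Y i \<omega>) (\<lambda>x. ennreal (max_exp_density n x))"
  using assms
proof (induction n rule: nat_induct_at_least)
  case base
  have "exponential_density 1 = max_exp_density 1"
    by (auto simp: exponential_density_def max_exp_density_def)
  then show ?case using base(2)[of 1] by simp
next
  case (Suc n)
  have ins: "{1..Suc n} = insert (Suc n) {1..n}" by auto
  have indep: "indep_var borel (Y (Suc n)) borel (\<lambda>\<omega>. \<Sum>i=1..n. Y i \<omega>)"
    using Suc.prems(1) unfolding ins by (intro indep_vars_sum) auto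
  have IH: "distributed M lborel (\<lambda>\<omega>. \<Sum>i=1..n. Y i \<omega>) (\<lambda>x. ennreal (max_exp_density n x))"
    using Suc.prems by (intro Suc.IH indep_vars_subset[OF Suc.prems(1)]) auto
  have "distributed M lborel (\<lambda>\<omega>. Y (Suc n) \<omega> + (\<Sum>i=1..n. Y i \<omega>))
     (\<lambda>x. \<integral>\<^sup>+y. ennreal (exponential_density (real (Suc n)) (x - y)) * ennreal (max_exp_density n y) \<partial>lborel)"
    by (rule distributed_convolution[OF indep _ IH]) (use Suc.prems(2)[of "Suc n"] in simp)
  then show ?case unfolding max_exp_density_convolution[OF Suc.hyps] by (simp add: add.commute)
qed

section \<open>Identification of \<open>h_k\<close> and the two formulas for
  \<open>P_k\<close>\<close>

context search_tree_arity
begin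

context
  fixes f :: "real \<Rightarrow> real"
  assumes f_meas [measurable]: "f \<in> borel_measurable borel"
    and f_AE: "AE s in lborel. f s = max_exp_density (m - 1) s"
begin

lemma protect_bracket:
  assumes h: "protect_h m f k u = exp (- u) * (eval_fps (prot_fps k) (1 - exp (- u)) - 1)" and u: "0 \<le> u"
  shows "(\<lambda>r. fringe_coeff k r * (exp (- (real m * u)) * (1 - exp (- u)) ^ r))
    sums ((protect_h m f k u + exp (- u)) ^ m - exp (- (real m * u)))"
proof -
  have "(\<lambda>r. exp (- (real m * u)) * (fringe_coeff k r * (1 - exp (- u)) ^ r))
      sums (exp (- (real m * u)) * (eval_fps (prot_fps k) (1 - exp (- u)) ^ m - 1))"
    using u by (intro sums_mult prot_fps_sums(2)) auto
  moreover have "(protect_h m f k u + exp (- u)) ^ m - exp (- (real m * u))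
      = exp (- (real m * u)) * (eval_fps (prot_fps k) (1 - exp (- u)) ^ m - 1)"
  proof -
    have "protect_h m f k u + exp (- u) = exp (- u) * eval_fps (prot_fps k) (1 - exp (- u))"
      by (simp add: h right_diff_distrib)
    moreover have "exp (- u) ^ m = exp (- (real m * u))" by (simp add: exp_of_nat_mult[symmetric])
    ultimately show ?thesis by (simp add: power_mult_distrib right_diff_distrib)
  qed
  ultimately show ?thesis by (simp add: mult.left_commute)
qed

text \<open>The density f is known only almost everywhere, but it enters through integrals, so the
  identity holds for every t \<ge> 0. In the step the bracket is expanded in powers of 1 - e^(-u),
  convolved termwise, and \<open>prot_mean_Suc\<close> absorbs the factorials.\<close>

lemma protect_h_eq:
  "0 \<le> t \<Longrightarrow> protect_h m f k t = exp (- t) * (eval_fps (prot_fps k) (1 - exp (- t)) - 1)"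
proof (induction k arbitrary: t)
  case 0
  let ?z = "1 - exp (- t)"
  have z: "0 \<le> ?z" "?z < 1" using 0 by auto
  have "(\<lambda>s. ?z ^ s) sums (1 / (1 - ?z))" using z by (intro geometric_sums) simp
  then have "(\<lambda>s. ?z ^ Suc s) sums (1 / (1 - ?z) - 1)" by (subst sums_Suc_iff) simp
  moreover have "(\<lambda>s. prot_mean 0 (Suc s) * ?z ^ Suc s) sums (eval_fps (prot_fps 0) ?z - 1 - prot_mean 0 0 * ?z ^ 0)"
    using prot_fps_sums(1)[OF z, of 0] by (subst sums_Suc_iff) simp
  ultimately have "eval_fps (prot_fps 0) ?z - 1 = 1 / (1 - ?z) - 1"
    by (simp add: prot_mean_0_pos prot_mean_0 sums_unique2)
  then show ?case by (simp add: exp_minus field_simps)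
next
  case (Suc k)
  let ?b = "\<lambda>s. (protect_h m f k (t - s) + exp (- (t - s))) ^ m - exp (- (real m * (t - s)))"
  let ?w = "\<lambda>r s. exp (- (real m * (t - s))) * (1 - exp (- (t - s))) ^ r"
  let ?z = "1 - exp (- t)"
  define J where "J = exp (- t) * (eval_fps (prot_fps (Suc k)) ?z - 1)"
  have b: "(\<lambda>r. indicator {0..t} s * (fringe_coeff k r * ?w r s)) sums (indicator {0..t} s * ?b s)" for s
  proof (cases "s \<in> {0..t}")
    case True
    then show ?thesis using protect_bracket[OF Suc.IH, of "t - s"] by simp
  qed simp
  have "has_bochner_integral lborel (\<lambda>s. max_exp_density (m - 1) s * (indicator {0..t} s * ?b s)) J"
  proof (rule has_bochner_integral_sums)
    fix r
    have "has_bochner_integral lborel (\<lambda>s. fringe_coeff k r * (indicator {0..t} s *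
        (real (m - 1) * exp (- s) * (1 - exp (- s)) ^ (m - 2) * ?w r s)))
      (fringe_coeff k r * (fact (m - 1) * fact r / fact (r + (m - 1)) * (exp (- t) * ?z ^ (r + (m - 1)))))"
      using Suc.prems m2 by (intro has_bochner_integral_mult_right convolution_integral)
    moreover have "fringe_coeff k r * (indicator {0..t} s *
        (real (m - 1) * exp (- s) * (1 - exp (- s)) ^ (m - 2) * ?w r s))
      = max_exp_density (m - 1) s * (indicator {0..t} s * (fringe_coeff k r * ?w r s))" for s
      by (auto simp: max_exp_density_def indicator_def numeral_2_eq_2)
    moreover have "fringe_coeff k r * (fact (m - 1) * fact r / fact (r + (m - 1)) * (exp (- t) * ?z ^ (r + (m - 1))))
      = exp (- t) * (prot_mean (Suc k) (r + (m - 1)) * ?z ^ (r + (m - 1)))"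
      unfolding prot_mean_Suc by simp
    ultimately show "has_bochner_integral lborel
        (\<lambda>s. max_exp_density (m - 1) s * (indicator {0..t} s * (fringe_coeff k r * ?w r s)))
        (exp (- t) * (prot_mean (Suc k) (r + (m - 1)) * ?z ^ (r + (m - 1))))"
      by (simp only:)
  next
    fix r s
    show "0 \<le> max_exp_density (m - 1) s * (indicator {0..t} s * (fringe_coeff k r * ?w r s))"
      by (cases "s \<in> {0..t}") (auto simp: max_exp_density_nonneg fringe_coeff_nonneg)
  next
    have z: "0 \<le> ?z" "?z < 1" using Suc.prems by auto
    have "(\<Sum>s<m - 1. prot_mean (Suc k) s * ?z ^ s) = 0"
      by (intro sum.neutral) (simp add: prot_mean_Suc_small)
    then have "(\<lambda>r. prot_mean (Suc k) (r + (m - 1)) * ?z ^ (r + (m - 1))) sums (eval_fps (prot_fps (Suc k)) ?z - 1)"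
      using prot_fps_sums(1)[OF z, of "Suc k"] by (subst sums_iff_shift) simp
    then show "(\<lambda>r. exp (- t) * (prot_mean (Suc k) (r + (m - 1)) * ?z ^ (r + (m - 1)))) sums J"
      unfolding J_def by (rule sums_mult)
  next
    show "(\<lambda>r. max_exp_density (m - 1) s * (indicator {0..t} s * (fringe_coeff k r * ?w r s)))
        sums (max_exp_density (m - 1) s * (indicator {0..t} s * ?b s))" for s
      by (intro sums_mult b)
  qed
  then have J: "J = (\<integral>s. max_exp_density (m - 1) s * (indicator {0..t} s * ?b s) \<partial>lborel)"
    by (simp add: has_bochner_integral_integral_eq)
  have "protect_h m f (Suc k) t = (\<integral>s. f s * (indicator {0..t} s * ?b s) \<partial>lborel)"
    unfolding protect_h.simps set_lebesgue_integral_def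
    by (intro Bochner_Integration.integral_cong) auto
  also have "\<dots> = J" unfolding J
  proof (rule integral_cong_AE)
    \<comment> \<open>Measurability of the bracket in s is read off its expansion into explicit
      functions.\<close>
    have "(\<lambda>s. indicator {0..t} s * ?b s) = (\<lambda>s. \<Sum>r. indicator {0..t} s * (fringe_coeff k r * ?w r s))"
      by (intro ext) (rule sums_unique[OF b])
    then have V: "(\<lambda>s. indicator {0..t} s * ?b s) \<in> borel_measurable lborel"
      by (simp only:) measurable
    show "(\<lambda>s. f s * (indicator {0..t} s * ?b s)) \<in> borel_measurable lborel"
      "(\<lambda>s. max_exp_density (m - 1) s * (indicator {0..t} s * ?b s)) \<in> borel_measurable lborel"
      by (rule borel_measurable_times[OF _ V], simp)+
    show "AE s in lborel. f s * (indicator {0..t} s * ?b s) = max_exp_density (m - 1) s * (indicator {0..t} s * ?b s)"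
      using f_AE by eventually_elim simp
  qed
  finally show ?case by (simp add: J_def)
qed

lemma size_weight_prot_sums:
  "(\<lambda>s. size_weight s * prot_mean k s) sums (\<Sum>s. size_weight (Suc s) * prot_mean k (Suc s))"
  using sums_Suc[of "\<lambda>s. size_weight s * prot_mean k s", OF summable_sums[OF summable_prot_weights]]
  by (simp add: prot_mean_0)

text \<open>By the expansion of \<open>h_k\<close>, the integrand is a series in e^(-2t) (1 -
  e^(-t))^s. The Beta integral of such a term is 1 / ((s + 1) (s + 2)), half of
  \<open>size_weight\<close>, whence the factor 2 in front of the integral.\<close>

lemma protect_P_eq: "protect_P m f k = (\<Sum>s. size_weight (Suc s) * prot_mean k (Suc s))"
proof -
  let ?S = "\<Sum>s. size_weight (Suc s) * prot_mean k (Suc s)"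
  have "has_bochner_integral lborel (\<lambda>t. indicator {0..} t * (protect_h m f k t * exp (- t))) (?S / 2)"
  proof (rule has_bochner_integral_sums)
    fix s
    have "has_bochner_integral lborel (\<lambda>t. prot_mean k s *
        (indicator {0..} t * (exp (- (real (Suc 1) * t)) * (1 - exp (- t)) ^ s)))
      (prot_mean k s * (fact 1 * fact s / fact (1 + s + 1)))"
      by (intro has_bochner_integral_mult_right beta_integral)
    moreover have "prot_mean k s * (fact 1 * fact s / fact (1 + s + 1)) = size_weight s * prot_mean k s / 2"
      by (simp add: size_weight_def divide_simps) (simp add: algebra_simps)
    ultimately show "has_bochner_integral lborel (\<lambda>t. prot_mean k s *
        (indicator {0..} t * (exp (- (real (Suc 1) * t)) * (1 - exp (- t)) ^ s))) (size_weight s * prot_mean k s / 2)"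
      by (simp only:)
  next
    show "0 \<le> prot_mean k s * (indicator {0..} t * (exp (- (real (Suc 1) * t)) * (1 - exp (- t)) ^ s))" for s and t :: real
      by (cases "0 \<le> t") (auto simp: prot_mean_bounds)
  next
    show "(\<lambda>s. size_weight s * prot_mean k s / 2) sums (?S / 2)"
      by (intro sums_divide size_weight_prot_sums)
  next
    fix t :: real
    show "(\<lambda>s. prot_mean k s * (indicator {0..} t * (exp (- (real (Suc 1) * t)) * (1 - exp (- t)) ^ s)))
        sums (indicator {0..} t * (protect_h m f k t * exp (- t)))"
    proof (cases "0 \<le> t")
      case True
      have "(\<lambda>s. (exp (- t) * exp (- t)) * (prot_mean k s * (1 - exp (- t)) ^ s))
          sums ((exp (- t) * exp (- t)) * (eval_fps (prot_fps k) (1 - exp (- t)) - 1))"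
        using True by (intro sums_mult prot_fps_sums(1)) auto
      moreover have "exp (- (real (Suc 1) * t)) = exp (- t) * exp (- t)"
        by (simp add: exp_add[symmetric])
      ultimately show ?thesis using True by (simp add: protect_h_eq mult_ac)
    qed simp
  qed
  then have "(LBINT t:{0..}. protect_h m f k t * exp (- t)) = ?S / 2"
    by (simp add: set_lebesgue_integral_def has_bochner_integral_integral_eq)
  then show ?thesis by (simp add: protect_P_def)
qed

text \<open>Here the Beta integral has e^(-(m + 1)t). Its value m! r! / (m + r + 1)! combines with
  the factor of \<open>prot_mean_Suc\<close> to m / 2 times the size weight at s = r + m -
  1.\<close>

lemma protect_P_Suc: "protect_P m f (Suc k) = 2 / real m * (LBINT t:{0..}.
    exp (- t) * ((protect_h m f k t + exp (- t)) ^ m - exp (- (real m * t))))"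
proof -
  let ?S = "\<Sum>s. size_weight (Suc s) * prot_mean (Suc k) (Suc s)"
  have "has_bochner_integral lborel (\<lambda>t. indicator {0..} t *
      (exp (- t) * ((protect_h m f k t + exp (- t)) ^ m - exp (- (real m * t))))) (real m / 2 * ?S)"
  proof (rule has_bochner_integral_sums)
    fix r
    have "has_bochner_integral lborel (\<lambda>t. fringe_coeff k r *
        (indicator {0..} t * (exp (- (real (Suc m) * t)) * (1 - exp (- t)) ^ r)))
      (fringe_coeff k r * (fact m * fact r / fact (m + r + 1)))"
      by (intro has_bochner_integral_mult_right beta_integral)
    moreover have "fringe_coeff k r * (fact m * fact r / fact (m + r + 1))
        = real m / 2 * (size_weight (r + (m - 1)) * prot_mean (Suc k) (r + (m - 1)))"
    proof -
      obtain a where a: "m = Suc a" using m2 by (cases m) auto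
      have gen: "c * (M * p * q / (x * (y * d))) = M / 2 * (2 / (y * x) * (p * q / d * c))"
        for c M p q x y d :: real
        by (cases "x = 0"; cases "y = 0"; cases "d = 0") (auto simp: field_simps)
      have "fact (m + r + 1) = (real (r + a) + 2) * ((real (r + a) + 1) * fact (r + a))"
        by (simp add: a algebra_simps)
      then show ?thesis unfolding prot_mean_Suc size_weight_def
        by (simp only: a diff_Suc_1 fact_Suc[of a] gen)
    qed
    ultimately show "has_bochner_integral lborel (\<lambda>t. fringe_coeff k r *
        (indicator {0..} t * (exp (- (real (Suc m) * t)) * (1 - exp (- t)) ^ r)))
        (real m / 2 * (size_weight (r + (m - 1)) * prot_mean (Suc k) (r + (m - 1))))"
      by (simp only:)
  next
    show "0 \<le> fringe_coeff k r * (indicator {0..} t * (exp (- (real (Suc m) * t)) * (1 - exp (- t)) ^ r))" for r and t :: real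
      by (cases "0 \<le> t") (auto simp: fringe_coeff_nonneg)
  next
    have "(\<Sum>s<m - 1. size_weight s * prot_mean (Suc k) s) = 0"
      by (intro sum.neutral) (simp add: prot_mean_Suc_small)
    then have "(\<lambda>r. size_weight (r + (m - 1)) * prot_mean (Suc k) (r + (m - 1))) sums ?S"
      using size_weight_prot_sums[of "Suc k"] by (subst sums_iff_shift) simp
    then show "(\<lambda>r. real m / 2 * (size_weight (r + (m - 1)) * prot_mean (Suc k) (r + (m - 1)))) sums (real m / 2 * ?S)"
      by (rule sums_mult)
  next
    fix t :: real
    show "(\<lambda>r. fringe_coeff k r * (indicator {0..} t * (exp (- (real (Suc m) * t)) * (1 - exp (- t)) ^ r)))
      sums (indicator {0..} t * (exp (- t) * ((protect_h m f k t + exp (- t)) ^ m - exp (- (real m * t)))))"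
    proof (cases "0 \<le> t")
      case True
      have "(\<lambda>r. exp (- t) * (fringe_coeff k r * (exp (- (real m * t)) * (1 - exp (- t)) ^ r)))
        sums (exp (- t) * ((protect_h m f k t + exp (- t)) ^ m - exp (- (real m * t))))"
        using True by (intro sums_mult protect_bracket protect_h_eq)
      moreover have "exp (- (real (Suc m) * t)) = exp (- t) * exp (- (real m * t))"
        by (simp add: exp_add[symmetric] algebra_simps)
      ultimately show ?thesis using True by (simp add: mult_ac del: of_nat_Suc)
    qed simp
  qed
  then have L: "(LBINT t:{0..}. exp (- t) * ((protect_h m f k t + exp (- t)) ^ m - exp (- (real m * t))))
      = real m / 2 * ?S"
    by (simp add: set_lebesgue_integral_def has_bochner_integral_integral_eq)
  show ?thesis unfolding protect_P_eq L using m2 by simp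
qed

end

end

theorem mainTheorem4:
  fixes m :: nat
    and N :: "'b measure" and Y :: "nat \<Rightarrow> 'b \<Rightarrow> real" and f :: "real \<Rightarrow> real"
    and M :: "'a measure" and X :: "nat \<Rightarrow> 'a \<Rightarrow> real" and D :: "real measure"
  assumes m: "2 \<le> m"
    and N: "prob_space N"
    and Y_indep: "prob_space.indep_vars N (\<lambda>_. borel) Y {1..m - 1}"
    and Y_exp: "\<And>i. i \<in> {1..m - 1} \<Longrightarrow>
          distributed N lborel (Y i) (\<lambda>x. ennreal (exponential_density (real i) x))"
    and f_nonneg: "\<And>x. 0 \<le> f x"
    and f_density: "distributed N lborel (\<lambda>\<omega>. \<Sum>i = 1..m - 1. Y i \<omega>) (\<lambda>x. ennreal (f x))"
    and M: "prob_space M"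
    and X_indep: "prob_space.indep_vars M (\<lambda>_. borel) X UNIV"
    and X_distr: "\<And>j. distr M borel (X j) = D"
    and D_cont: "continuous_on UNIV (cdf D)"
  shows "(\<forall>k. AE \<omega> in M.
            (\<lambda>n. protected_fraction k (search_tree m (map (\<lambda>j. X j \<omega>) [0..<n])))
              \<longlonglongrightarrow> protect_P m f k) \<and>
         (\<forall>k\<ge>1. protect_P m f k =
            2 / real m * (LBINT t:{0..}.
              exp (- t) * ((protect_h m f (k - 1) t + exp (- t)) ^ m - exp (- (real m * t)))))"
proof -
  interpret random_search_tree m M X D
    using m M X_indep X_distr D_cont
    by (auto simp: random_search_tree_def search_tree_arity_def iid_keys_def iid_keys_axioms_def)
  have "(\<lambda>x. ennreal (f x)) \<in> borel_measurable lborel"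
    using f_density by (simp add: distributed_def)
  then have "(\<lambda>x. enn2real (ennreal (f x))) \<in> borel_measurable borel" by simp
  then have f_meas: "f \<in> borel_measurable borel" using f_nonneg by simp
  have "distributed N lborel (\<lambda>\<omega>. \<Sum>i = 1..m - 1. Y i \<omega>) (\<lambda>x. ennreal (max_exp_density (m - 1) x))"
    using m Y_indep Y_exp by (intro prob_space.sum_exponential_distributed[OF N]) auto
  \<comment> \<open>Densities are unique up to null sets; nonnegativity of both functions then
    allows passing from \<open>ennreal\<close> to reals.\<close>
  then have "AE x in lborel. ennreal (f x) = ennreal (max_exp_density (m - 1) x)"
    by (rule prob_space.distributed_unique[OF N f_density])
  then have f_AE: "AE x in lborel. f x = max_exp_density (m - 1) x"
    by eventually_elim (simp add: f_nonneg max_exp_density_nonneg)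
  have "protect_P m f k = 2 / real m * (LBINT t:{0..}.
      exp (- t) * ((protect_h m f (k - 1) t + exp (- t)) ^ m - exp (- (real m * t))))" if "1 \<le> k" for k
    using protect_P_Suc[OF f_meas f_AE, of "k - 1"] that by simp
  then show ?thesis
    using AE_protected_fraction unfolding protect_P_eq[OF f_meas f_AE] by blast
qed

end
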